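(* Let $B>0$ be given. The set $\mathcal M_B$ of all Mahler measures $m(F)$ of nonzero polynomials $F$ with integer coefficients, in any number of variables, and having length at most $B$, is a closed subset of $\mathbb R$. Furthermore, $0$ is an isolated point of $\mathcal M_B$.
   Context: For a nonzero complex (Laurent) polynomial $F$ in $k\ge 1$ variables, its (logarithmic) Mahler measure is $$m(F)=\int_0^1\cdots\int_0^1\log|F(e^{2\pi i t_1},\dots,e^{2\pi i t_k})|\,dt_1\cdots dt_k.$$ The length of a polynomial is the sum of the moduli of its coefficients.
   Formalization: That 0 is an isolated point of M_B is stated only for B ≥ 1; for 0 < B < 1 no nonzero integer polynomial has length at most B, so M_B is empty and 0 is not in it. *)

theory Defs
  imports "HOL-Analysis.Analysis" "HOL-Library.Poly_Mapping"
begin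

text \<open>
  A Laurent polynomial in the variables \<open>z\<^sub>0, z\<^sub>1, \<dots>\<close> is a finitely supported map from exponent
  vectors (themselves finitely supported) to coefficients. The number of variables is not part of
  the type; it is imposed through the predicate \<open>in_variables\<close>.
\<close>

type_synonym laurent_poly = "(nat \<Rightarrow>\<^sub>0 int) \<Rightarrow>\<^sub>0 complex"

definition in_variables :: "nat \<Rightarrow> laurent_poly \<Rightarrow> bool" where
  "in_variables k F \<longleftrightarrow> (\<forall>v\<in>Poly_Mapping.keys F. Poly_Mapping.keys v \<subseteq> {..<k})"

definition is_polynomial :: "laurent_poly \<Rightarrow> bool" where
  "is_polynomial F \<longleftrightarrow> (\<forall>v\<in>Poly_Mapping.keys F. \<forall>i. Poly_Mapping.lookup v i \<ge> 0)"

definition integer_coeffs :: "laurent_poly \<Rightarrow> bool" where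
  "integer_coeffs F \<longleftrightarrow> (\<forall>v. Poly_Mapping.lookup F v \<in> \<int>)"

definition laurent_eval :: "laurent_poly \<Rightarrow> (nat \<Rightarrow> complex) \<Rightarrow> complex" where
  "laurent_eval F z =
     (\<Sum>v\<in>Poly_Mapping.keys F. Poly_Mapping.lookup F v *
        (\<Prod>i\<in>Poly_Mapping.keys v. z i powi Poly_Mapping.lookup v i))"

definition poly_length :: "laurent_poly \<Rightarrow> real" where
  "poly_length F = (\<Sum>v\<in>Poly_Mapping.keys F. cmod (Poly_Mapping.lookup F v))"

text \<open>
  The integral is the Lebesgue integral over the unit cube. The integrand has a logarithmic
  singularity at the zeros of a nonzero \<open>F\<close> on the torus; these form a null set, so the library
  convention \<open>ln 0 = 0\<close> has no influence on the value.
\<close>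

definition mahler_measure :: "nat \<Rightarrow> laurent_poly \<Rightarrow> real" where
  "mahler_measure k F =
     (LINT t:({..<k} \<rightarrow>\<^sub>E {0..1})|(\<Pi>\<^sub>M i\<in>{..<k}. lborel).
        ln (cmod (laurent_eval F (\<lambda>j. exp (2 * complex_of_real pi * \<i> * complex_of_real (t j))))))"

definition mahler_set :: "real \<Rightarrow> real set" where
  "mahler_set B =
     {mahler_measure k F | k F.
        k \<ge> 1 \<and> F \<noteq> 0 \<and> in_variables k F \<and> is_polynomial F \<and> integer_coeffs F \<and> poly_length F \<le> B}"

text \<open>
  A nonzero polynomial with integer coefficients has length at least 1, so for \<open>B < 1\<close> there is
  nothing in the set, and in particular \<open>0\<close> is not in it.
\<close>

lemma mahler_set_eq_empty:
  assumes "B < 1"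
  shows "mahler_set B = {}"
proof -
  have "1 \<le> poly_length F" if nz: "F \<noteq> 0" and int: "integer_coeffs F" for F
  proof -
    from nz obtain v where v: "v \<in> Poly_Mapping.keys F" by fastforce
    obtain n where n: "Poly_Mapping.lookup F v = of_int n"
      using int by (auto simp: integer_coeffs_def elim: Ints_cases)
    have "n \<noteq> 0" using v n by (auto simp: in_keys_iff)
    then have "1 \<le> cmod (Poly_Mapping.lookup F v)"
      unfolding n norm_of_int by linarith
    also have "\<dots> \<le> poly_length F"
      unfolding poly_length_def by (rule member_le_sum) (use v in auto)
    finally show ?thesis .
  qed
  with assms show ?thesis by (fastforce simp: mahler_set_def)
qed

end

theory Submission
  imports Defs "HOL-Probability.Probability"
    "HOL-Computational_Algebra.Fundamental_Theorem_Algebra"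
    "HOL-Library.Diagonal_Subsequence"
begin

text \<open>
  A polynomial with \<open>n\<close> terms is a fixed linear form \<open>\<Sum>i<n. c i * x i\<close> evaluated at characters
  \<open>x i\<close> of a torus, and for integer coefficients and bounded length only finitely many \<open>c\<close> occur.
  Given a sequence of such polynomials, pass to a subsequence along which every integer relation
  between the exponent vectors eventually holds or eventually fails. The relations that eventually
  hold form a saturated lattice, hence are exactly the relations between the exponents of some limit
  polynomial with the same \<open>c\<close>. All moments of the squared modulus converge, because they only depend
  on the relations; and since a van der Corput differencing argument bounds the measure of
  \<open>{|F| \<le> y}\<close> by \<open>C y\<^sup>\<beta>\<close> with \<open>C, \<beta>\<close> depending on \<open>n\<close> only, the Mahler measures converge too.

  If the limit \<open>F\<close> has measure 0, choose a direction \<open>b\<close> in which its exponents are separated. Jensen's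
  formula along \<open>b\<close> shows that \<open>F(z s\<^sup>b)\<close>, as a polynomial in \<open>s\<close>, has extreme coefficient of modulus 1
  and no zero in \<open>|s| < 1\<close>. Late members of the sequence are specializations of \<open>F\<close>, so they inherit
  this property. It forces measure 0: the power sums of the reciprocal roots have integer means that
  are bounded by the degree \<open>d\<close> and satisfy \<open>e (p * m) \<equiv> e m\<close> modulo \<open>p\<close>, so \<open>e (p * m) = e m\<close> for all
  primes \<open>p > 2 d\<close>. Averaging over an arithmetic progression of indices yields \<open>e m = 0\<close> for \<open>m \<ge> 1\<close>,
  because a given root of unity is almost surely not a root.
\<close>

subsection \<open>Characters of the torus\<close>

text \<open>A bound on the length bounds neither the exponents nor the number of variables, so
  compactness has to come from the countably many possible relations. Convergence of moments does
  not by itself control the logarithm near 0. The small-ball estimate does, and uniformly, because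
  it uses only the number of terms and \<open>|c i| \<ge> 1\<close>, which integrality of nonzero
  coefficients guarantees. For the isolation of 0 the obstacle is that a late member is, up to a
  multiple of its exponents, \<open>F\<close> restricted to a subgroup of the torus, often a null
  set, whereas measure 0 of \<open>F\<close> gives information only almost everywhere. Nonvanishing
  in \<open>|s| < 1\<close> is therefore sharpened to the lower bound \<open>(1 - |s|)^d\<close>,
  which passes by continuity to every point of the torus and hence to every restriction. Since late
  members then have measure exactly 0, nonzero measures cannot tend to 0 along a sequence.
  Closedness and isolation thus both reduce to closedness of the set without 0.\<close>

definition unif :: "real measure" where
  "unif = uniform_measure lborel {0..1}"

definition torus :: "nat \<Rightarrow> (nat \<Rightarrow> real) measure" where
  "torus k = PiM {..<k} (\<lambda>_. unif)"

text \<open>Defined at every real point, not only in the unit cube, so that it can be evaluated at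
  integer multiples and at linear images of a point.\<close>

definition chi :: "nat \<Rightarrow> (nat \<Rightarrow> int) \<Rightarrow> (nat \<Rightarrow> real) \<Rightarrow> complex" where
  "chi k v t = cis (2 * pi * (\<Sum>l<k. of_int (v l) * t l))"

definition shift :: "nat \<Rightarrow> (nat \<Rightarrow> real) \<Rightarrow> (nat \<Rightarrow> real) \<Rightarrow> (nat \<Rightarrow> real)" where
  "shift k a t = (\<lambda>i\<in>{..<k}. frac (t i + a i))"

lemma sets_unif [measurable_cong, simp]: "sets unif = sets borel"
  by (simp add: unif_def)

lemma space_unif [simp]: "space unif = UNIV"
  by (simp add: unif_def)

lemma measurable_unif_eq [simp]: "measurable M unif = borel_measurable M"
  by (rule measurable_cong_sets) auto

lemma measurable_from_unif_eq [simp]: "measurable unif M = measurable borel M"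
  by (rule measurable_cong_sets) auto

lemma borel_measurable_frac [measurable]: "(frac :: real \<Rightarrow> real) \<in> borel_measurable borel"
proof -
  have "(\<lambda>x::real. x - of_int \<lfloor>x\<rfloor>) \<in> borel_measurable borel" by measurable
  then show ?thesis by (simp add: frac_def[abs_def])
qed

lemma prob_space_unif: "prob_space unif"
  unfolding unif_def by (rule prob_space_uniform_measure) auto

lemma nn_integral_unif:
  assumes [measurable]: "f \<in> borel_measurable borel"
  shows "(\<integral>\<^sup>+x. f x \<partial>unif) = (\<integral>\<^sup>+x. f x * indicator {0..1} x \<partial>lborel)"
  unfolding unif_def by (subst nn_integral_uniform_measure) (auto simp: divide_ennreal_def)

text \<open>With \<open>b = frac a\<close>, translation modulo 1 carries \<open>[0, 1 - b)\<close>
  onto \<open>[b, 1)\<close> and \<open>[1 - b, 1)\<close> onto \<open>[0, b)\<close>; the two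
  images fill the interval again, up to the null set \<open>{1}\<close>.\<close>

lemma nn_integral_unif_translate:
  assumes [measurable]: "f \<in> borel_measurable borel"
  shows "(\<integral>\<^sup>+x. f (frac (x + a)) \<partial>unif) = (\<integral>\<^sup>+x. f x \<partial>unif)"
proof -
  define b where "b = frac a"
  have b: "0 \<le> b" "b < 1" by (auto simp: b_def frac_lt_1)
  have fr: "frac (x + a) = frac (x + b)" for x
    by (simp add: b_def)
  have "(\<integral>\<^sup>+x. f (frac (x + a)) \<partial>unif) = (\<integral>\<^sup>+x. f (frac (x + b)) * indicator {0..1} x \<partial>lborel)"
    unfolding fr by (subst nn_integral_unif) auto
  also have "\<dots> = (\<integral>\<^sup>+x. f (b + x) * indicator {b..<1} (b + x)
                     + f ((b - 1) + x) * indicator {0..<b} ((b - 1) + x) \<partial>lborel)"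
  proof (rule nn_integral_cong_AE)
    have "AE x in lborel. x \<noteq> (1::real)" by (rule AE_lborel_singleton)
    then show "AE x in lborel. f (frac (x + b)) * indicator {0..1} x =
        f (b + x) * indicator {b..<1} (b + x) + f ((b - 1) + x) * indicator {0..<b} ((b - 1) + x)"
    proof eventually_elim
      case (elim x)
      consider "x < 0 \<or> x > 1" | "0 \<le> x" "x < 1 - b" | "1 - b \<le> x" "x < 1"
        using elim by linarith
      then show ?case
      proof cases
        case 1 then show ?thesis using b by (auto simp: indicator_def)
      next
        case 2
        then have "frac (x + b) = b + x" using b by (subst frac_unique_iff) auto
        with 2 b show ?thesis by (auto simp: indicator_def add.commute)
      next
        case 3
        then have "frac (x + b) = (b - 1) + x" using b by (subst frac_unique_iff) auto
        with 3 b show ?thesis by (auto simp: indicator_def)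
      qed
    qed
  qed
  also have "\<dots> = (\<integral>\<^sup>+x. f (b + x) * indicator {b..<1} (b + x) \<partial>lborel)
                   + (\<integral>\<^sup>+x. f ((b - 1) + x) * indicator {0..<b} ((b - 1) + x) \<partial>lborel)"
    by (rule nn_integral_add) auto
  also have "(\<integral>\<^sup>+x. f (b + x) * indicator {b..<1} (b + x) \<partial>lborel) =
      (\<integral>\<^sup>+x. f x * indicator {b..<1} x \<partial>lborel)"
    using nn_integral_real_affine[of "\<lambda>x. f x * indicator {b..<1} x" 1 b] by simp
  also have "(\<integral>\<^sup>+x. f ((b - 1) + x) * indicator {0..<b} ((b - 1) + x) \<partial>lborel) =
      (\<integral>\<^sup>+x. f x * indicator {0..<b} x \<partial>lborel)"
    using nn_integral_real_affine[of "\<lambda>x. f x * indicator {0..<b} x" 1 "b - 1"] by simp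
  also have "(\<integral>\<^sup>+x. f x * indicator {b..<1} x \<partial>lborel) + (\<integral>\<^sup>+x. f x * indicator {0..<b} x \<partial>lborel) =
      (\<integral>\<^sup>+x. f x * indicator {b..<1} x + f x * indicator {0..<b} x \<partial>lborel)"
    by (rule nn_integral_add[symmetric]) auto
  also have "\<dots> = (\<integral>\<^sup>+x. f x * indicator {0..1} x \<partial>lborel)"
  proof (rule nn_integral_cong_AE)
    have "AE x in lborel. x \<noteq> (1::real)" by (rule AE_lborel_singleton)
    then show "AE x in lborel. f x * indicator {b..<1} x + f x * indicator {0..<b} x
        = f x * indicator {0..1} x"
      by eventually_elim (use b in \<open>auto simp: indicator_def\<close>)
  qed
  finally show ?thesis by (subst (2) nn_integral_unif) auto
qed

lemma distr_unif_translate: "distr unif unif (\<lambda>x. frac (x + a)) = unif"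
proof (rule measure_eqI)
  fix A assume A: "A \<in> sets (distr unif unif (\<lambda>x. frac (x + a)))"
  then have [measurable]: "A \<in> sets borel" by simp
  have "emeasure (distr unif unif (\<lambda>x. frac (x + a))) A =
      (\<integral>\<^sup>+x. indicator A x \<partial>distr unif unif (\<lambda>x. frac (x + a)))"
    using A by (subst nn_integral_indicator) auto
  also have "\<dots> = (\<integral>\<^sup>+x. indicator A (frac (x + a)) \<partial>unif)"
    by (subst nn_integral_distr) auto
  also have "\<dots> = (\<integral>\<^sup>+x. indicator A x \<partial>unif)"
    by (rule nn_integral_unif_translate) auto
  finally show "emeasure (distr unif unif (\<lambda>x. frac (x + a))) A = emeasure unif A"
    by simp
qed simp

lemma prob_space_torus: "prob_space (torus k)"
  unfolding torus_def by (rule prob_space_PiM) (rule prob_space_unif)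

interpretation torus: prob_space "torus k" for k by (rule prob_space_torus)

lemma measurable_torus_component [measurable]: "i < k \<Longrightarrow> (\<lambda>t. t i) \<in> borel_measurable (torus k)"
  unfolding torus_def using measurable_component_singleton[of i "{..<k}" "\<lambda>_. unif"]
  by (simp add: measurable_cong_sets[OF refl sets_unif])

lemma space_torus: "space (torus k) = PiE {..<k} (\<lambda>_. UNIV)"
  by (simp add: torus_def space_PiM)

lemma sets_torus: "sets (torus k) = sets (PiM {..<k} (\<lambda>_. borel))"
  unfolding torus_def by (rule sets_PiM_cong) auto

lemma measurable_chi [measurable]: "chi k v \<in> borel_measurable (torus k)"
proof -
  have [measurable]: "cis \<in> borel_measurable borel"
    by (intro borel_measurable_continuous_onI continuous_intros)
  have "(\<lambda>t. cis (2 * pi * (\<Sum>l<k. of_int (v l) * t l))) \<in> borel_measurable (torus k)"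
    by measurable
  then show ?thesis by (simp add: chi_def[abs_def])
qed

lemma measurable_shift [measurable]: "shift k a \<in> measurable (torus k) (torus k)"
proof -
  have "(\<lambda>t. \<lambda>i\<in>{..<k}. frac (t i + a i)) \<in> measurable (torus k) (PiM {..<k} (\<lambda>_. unif))"
    by (rule measurable_restrict) (auto simp: measurable_cong_sets[OF refl sets_unif])
  then show ?thesis by (simp add: shift_def[abs_def] torus_def[symmetric])
qed

lemma distr_torus_shift: "distr (torus k) (torus k) (shift k a) = torus k"
proof -
  interpret P: product_prob_space "\<lambda>_::nat. unif"
    by (rule product_prob_spaceI) (rule prob_space_unif)
  show ?thesis
    unfolding torus_def
  proof (rule P.PiM_eqI)
    fix A :: "nat \<Rightarrow> real set" assume A: "\<And>i. i \<in> {..<k} \<Longrightarrow> A i \<in> sets unif"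
    have "emeasure (distr (PiM {..<k} (\<lambda>_. unif)) (PiM {..<k} (\<lambda>_. unif)) (shift k a)) (PiE {..<k} A)
        = emeasure (PiM {..<k} (\<lambda>_. unif)) (shift k a -` PiE {..<k} A \<inter> space (PiM {..<k} (\<lambda>_. unif)))"
      using measurable_shift[of k a] A
      by (intro emeasure_distr sets_PiM_I_finite) (auto simp: torus_def)
    also have "shift k a -` PiE {..<k} A \<inter> space (PiM {..<k} (\<lambda>_. unif)) =
        PiE {..<k} (\<lambda>i. (\<lambda>x. frac (x + a i)) -` A i)"
      by (auto simp: space_PiM PiE_def Pi_def extensional_def shift_def)
    also have "emeasure (PiM {..<k} (\<lambda>_. unif)) \<dots> =
        (\<Prod>i<k. emeasure unif ((\<lambda>x. frac (x + a i)) -` A i))"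
    proof (intro P.emeasure_PiM)
      fix i assume "i \<in> {..<k}"
      then have [measurable]: "A i \<in> sets borel" using A by auto
      have "(\<lambda>x. frac (x + a i)) \<in> measurable borel borel" by measurable
      from measurable_sets_borel[OF this, of "A i"]
      show "(\<lambda>x. frac (x + a i)) -` A i \<in> sets unif" by simp
    qed simp
    also have "\<dots> = (\<Prod>i<k. emeasure unif (A i))"
    proof (intro prod.cong refl)
      fix i assume "i \<in> {..<k}"
      then have [measurable]: "A i \<in> sets borel" using A by auto
      have "emeasure unif (A i) = emeasure (distr unif unif (\<lambda>x. frac (x + a i))) (A i)"
        by (simp add: distr_unif_translate)
      also have "\<dots> = emeasure unif ((\<lambda>x. frac (x + a i)) -` A i)"
        by (subst emeasure_distr) auto
      finally show "emeasure unif ((\<lambda>x. frac (x + a i)) -` A i) = emeasure unif (A i)" ..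
    qed
    finally show "emeasure (distr (PiM {..<k} (\<lambda>_. unif)) (PiM {..<k} (\<lambda>_. unif)) (shift k a)) (PiE {..<k} A)
        = (\<Prod>i<k. emeasure unif (A i))" .
  qed auto
qed

lemma nn_integral_torus_shift:
  assumes "f \<in> borel_measurable (torus k)"
  shows "(\<integral>\<^sup>+t. f (shift k a t) \<partial>torus k) = (\<integral>\<^sup>+t. f t \<partial>torus k)"
  using assms by (subst (2) distr_torus_shift[of k a, symmetric], subst nn_integral_distr) auto

lemma integral_torus_shift:
  fixes f :: "_ \<Rightarrow> 'a :: {banach, second_countable_topology}"
  assumes "f \<in> borel_measurable (torus k)"
  shows "(\<integral>t. f (shift k a t) \<partial>torus k) = (\<integral>t. f t \<partial>torus k)"
  using assms by (subst (2) distr_torus_shift[of k a, symmetric], subst integral_distr) auto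

lemma norm_chi [simp]: "norm (chi k v t) = 1"
  by (simp add: chi_def)

lemma chi_nonzero [simp]: "chi k v t \<noteq> 0"
  using norm_chi[of k v t] by fastforce

lemma chi_add: "chi k (\<lambda>l. v l + w l) t = chi k v t * chi k w t"
  by (simp add: chi_def cis_mult algebra_simps sum.distrib)

lemma chi_uminus: "chi k (\<lambda>l. - v l) t = cnj (chi k v t)"
  by (simp add: chi_def sum_negf cis_cnj)

lemma chi_diff: "chi k (\<lambda>l. v l - w l) t = chi k v t * cnj (chi k w t)"
  using chi_add[of k v "\<lambda>l. - w l" t] by (simp add: chi_uminus)

lemma chi_zero [simp]: "chi k (\<lambda>l. 0) t = 1"
  by (simp add: chi_def)

lemma chi_power: "chi k v t ^ m = chi k (\<lambda>l. int m * v l) t"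
  unfolding chi_def Complex.DeMoivre by (rule arg_cong[where f = cis]) (simp add: sum_distrib_left mult_ac)

lemma chi_scale: "chi k v (\<lambda>l. of_int m * t l) = chi k (\<lambda>l. m * v l) t"
  by (simp add: chi_def mult_ac)

lemma chi_cong: "(\<And>l. l < k \<Longrightarrow> v l = w l) \<Longrightarrow> chi k v t = chi k w t"
  by (simp add: chi_def)

lemma cis_2pi_int: "cis (2 * pi * of_int m) = 1"
  by (metis cis_multiple_2pi Ints_of_int)

lemma chi_shift: "chi k v (shift k a t) = chi k v t * chi k v a"
proof -
  have "(\<Sum>l<k. of_int (v l) * shift k a t l) =
      (\<Sum>l<k. of_int (v l) * t l) + (\<Sum>l<k. of_int (v l) * a l)
       + of_int (\<Sum>l<k. - v l * \<lfloor>t l + a l\<rfloor>)"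
    unfolding of_int_sum sum.distrib[symmetric]
    by (intro sum.cong) (auto simp: shift_def frac_def algebra_simps)
  then have "chi k v (shift k a t) = cis (2 * pi * (\<Sum>l<k. of_int (v l) * t l) +
      2 * pi * (\<Sum>l<k. of_int (v l) * a l) + 2 * pi * of_int (\<Sum>l<k. - v l * \<lfloor>t l + a l\<rfloor>))"
    unfolding chi_def by (simp only: distrib_left)
  also have "\<dots> = chi k v t * chi k v a"
    by (simp only: cis_mult[symmetric] cis_2pi_int chi_def mult_1_right)
  finally show ?thesis .
qed

lemma integrable_torus_bounded:
  fixes f :: "_ \<Rightarrow> 'a :: {banach, second_countable_topology}"
  assumes "f \<in> borel_measurable (torus k)" "\<And>t. norm (f t) \<le> B"
  shows "integrable (torus k) f"
  using assms by (intro torus.integrable_const_bound[where B = B]) auto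

lemma integrable_chi [simp]: "integrable (torus k) (chi k v)"
  by (rule integrable_torus_bounded[where B = 1]) auto

lemma integral_chi: "(\<integral>t. chi k v t \<partial>torus k) = (if \<forall>l<k. v l = 0 then 1 else 0)"
proof (cases "\<forall>l<k. v l = 0")
  case True
  then have "chi k v t = 1" for t by (simp add: chi_def)
  with True show ?thesis by (simp add: torus.prob_space)
next
  case False
  then obtain i where i: "i < k" "v i \<noteq> 0" by auto
  \<comment> \<open>A shift by half a period in coordinate \<open>i\<close> changes the sign of the
    character, so the integral equals its own negative.\<close>
  define a :: "nat \<Rightarrow> real" where "a l = (if l = i then 1 / (2 * of_int (v i)) else 0)" for l
  have "(\<Sum>l<k. of_int (v l) * a l) = (\<Sum>l\<in>{i}. of_int (v l) * a l)"
    using i by (intro sum.mono_neutral_right) (auto simp: a_def)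
  also have "\<dots> = 1 / 2" using i by (simp add: a_def)
  finally have "chi k v a = -1" by (simp only: chi_def) simp
  then have "(\<integral>t. chi k v t \<partial>torus k) = (\<integral>t. - chi k v t \<partial>torus k)"
    by (subst integral_torus_shift[of _ k a, symmetric]) (auto simp: chi_shift)
  then show ?thesis using False by simp
qed

subsection \<open>Small values of trigonometric polynomials\<close>

definition tpoly :: "nat \<Rightarrow> nat \<Rightarrow> (nat \<Rightarrow> complex) \<Rightarrow> (nat \<Rightarrow> nat \<Rightarrow> int) \<Rightarrow> (nat \<Rightarrow> real) \<Rightarrow> complex" where
  "tpoly k n c v t = (\<Sum>i<n. c i * chi k (v i) t)"

definition separated :: "nat \<Rightarrow> nat \<Rightarrow> (nat \<Rightarrow> nat \<Rightarrow> int) \<Rightarrow> bool" where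
  "separated k n v \<longleftrightarrow> (\<forall>i<n. \<forall>j<n. i \<noteq> j \<longrightarrow> (\<exists>l<k. v i l \<noteq> v j l))"

lemma measurable_tpoly [measurable]: "tpoly k n c v \<in> borel_measurable (torus k)"
  unfolding tpoly_def[abs_def] by measurable

lemma norm_tpoly_le: "norm (tpoly k n c v t) \<le> (\<Sum>i<n. norm (c i))"
  unfolding tpoly_def by (rule order_trans[OF norm_sum]) (simp add: norm_mult)

text \<open>Where \<open>chi\<close> is within \<open>s\<close> of 1, the sum of its first \<open>N \<approx> 1 / (2 s)\<close> powers is at least \<open>N / 2\<close>,
  while its second moment is \<open>N\<close>.\<close>

lemma prob_chi_near_1:
  assumes u: "l < k" "u l \<noteq> 0" and s: "s > 0"
  shows "measure (torus k) {t \<in> space (torus k). norm (chi k u t - 1) \<le> s} \<le> 16 * s"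
proof (cases "s \<ge> 1 / 16")
  case True
  then show ?thesis using torus.prob_le_1[of k "{t \<in> space (torus k). norm (chi k u t - 1) \<le> s}"] by linarith
next
  case False
  define N where "N = nat \<lfloor>1 / (2 * s)\<rfloor>"
  have "1 / (2 * s) \<ge> 1" using False s by (simp add: field_simps)
  then have N1: "N \<ge> 1" and Nle: "real N \<le> 1 / (2 * s)" and Nge: "real N \<ge> 1 / (2 * s) - 1"
    unfolding N_def by linarith+
  \<comment> \<open>Rounding \<open>1 / (2 * s)\<close> down costs at most half of it, as
    \<open>1 / (4 * s) \<ge> 1\<close>. This turns the final bound \<open>4 / N\<close> into
    \<open>16 * s\<close>.\<close>
  have N4: "real N \<ge> 1 / (4 * s)"
  proof -
    have "1 / (4 * s) \<ge> 1" using False s by (simp add: field_simps)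
    moreover have "1 / (2 * s) = 1 / (4 * s) + 1 / (4 * s)" using s by (simp add: field_simps)
    ultimately show ?thesis using Nge by linarith
  qed
  define D where "D t = (\<Sum>j<N. chi k u t ^ j)" for t
  have [measurable]: "D \<in> borel_measurable (torus k)" unfolding D_def[abs_def] by measurable
  have Dle: "norm (D t) \<le> real N" for t
    unfolding D_def by (rule order_trans[OF norm_sum]) (simp add: norm_power)
  have int: "integrable (torus k) (\<lambda>t. (norm (D t))\<^sup>2)"
    by (rule integrable_torus_bounded[where B = "(real N)\<^sup>2"])
       (auto intro!: power_mono Dle)
  have "(\<integral>t. complex_of_real ((norm (D t))\<^sup>2) \<partial>torus k) =
      (\<integral>t. (\<Sum>i<N. \<Sum>j<N. chi k (\<lambda>l. (int i - int j) * u l) t) \<partial>torus k)"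
  proof (intro Bochner_Integration.integral_cong refl)
    fix t
    have "complex_of_real ((norm (D t))\<^sup>2) = D t * cnj (D t)"
      by (rule complex_norm_square)
    also have "\<dots> = (\<Sum>i<N. \<Sum>j<N. chi k u t ^ i * cnj (chi k u t ^ j))"
      by (simp add: D_def sum_product)
    also have "\<dots> = (\<Sum>i<N. \<Sum>j<N. chi k (\<lambda>l. (int i - int j) * u l) t)"
      by (simp add: chi_power flip: chi_uminus chi_add) (simp add: algebra_simps)
    finally show "complex_of_real ((norm (D t))\<^sup>2) =
      (\<Sum>i<N. \<Sum>j<N. chi k (\<lambda>l. (int i - int j) * u l) t)" .
  qed
  also have "\<dots> = (\<Sum>i<N. \<Sum>j<N. if i = j then 1 else 0)"
  proof -
    have "(\<forall>l<k. (int i - int j) * u l = 0) = (i = j)" for i j using u by auto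
    then show ?thesis by (simp add: integral_chi)
  qed
  also have "\<dots> = of_nat N" by simp
  finally have E: "(\<integral>t. (norm (D t))\<^sup>2 \<partial>torus k) = real N"
    by (simp only: integral_complex_of_real) (metis of_real_eq_iff of_real_of_nat_eq)
  let ?S = "{t \<in> space (torus k). norm (chi k u t - 1) \<le> s}"
  have big: "norm (D t) \<ge> real N / 2" if "norm (chi k u t - 1) \<le> s" for t
  proof -
    have pw: "norm (z ^ j - 1) \<le> real j * norm (z - 1)" if "norm z = 1" for z :: complex and j
    proof (induction j)
      case (Suc j)
      have "z ^ Suc j - 1 = z * (z ^ j - 1) + (z - 1)" by (simp add: algebra_simps)
      then have "norm (z ^ Suc j - 1) \<le> norm (z * (z ^ j - 1)) + norm (z - 1)"
        by (metis norm_triangle_ineq)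
      moreover have "norm (z * (z ^ j - 1)) = norm (z ^ j - 1)" using that by (simp only: norm_mult)
      moreover have "real (Suc j) * norm (z - 1) = real j * norm (z - 1) + norm (z - 1)"
        by (simp add: algebra_simps)
      ultimately show ?case using Suc by linarith
    qed simp
    have "norm (D t - of_nat N) = norm (\<Sum>j<N. chi k u t ^ j - 1)"
      by (simp add: D_def sum_subtractf)
    also have "\<dots> \<le> (\<Sum>j<N. real N * s)"
    proof (rule sum_norm_le)
      fix j assume "j \<in> {..<N}"
      have "norm (chi k u t ^ j - 1) \<le> real j * norm (chi k u t - 1)" by (rule pw) simp
      also have "\<dots> \<le> real N * s"
        using \<open>j \<in> _\<close> that by (intro mult_mono) auto
      finally show "norm (chi k u t ^ j - 1) \<le> real N * s" .
    qed
    also have "\<dots> = real N * (real N * s)" by simp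
    also have "\<dots> \<le> real N * (1 / 2)"
      using Nle s by (intro mult_left_mono) (auto simp: field_simps)
    finally have "norm (D t - of_nat N) \<le> real N / 2" by simp
    moreover have "norm (of_nat N :: complex) \<le> norm (D t - of_nat N) + norm (D t)"
      by (metis norm_triangle_sub norm_minus_commute add.commute)
    ultimately show ?thesis by simp
  qed
  have "?S \<subseteq> {t \<in> space (torus k). (norm (D t))\<^sup>2 \<ge> (real N / 2)\<^sup>2}"
    using big N1 by (auto intro!: power_mono)
  then have "measure (torus k) ?S \<le> measure (torus k) {t \<in> space (torus k). (norm (D t))\<^sup>2 \<ge> (real N / 2)\<^sup>2}"
    by (intro torus.finite_measure_mono) auto
  also have "\<dots> \<le> (\<integral>t. (norm (D t))\<^sup>2 \<partial>torus k) / (real N / 2)\<^sup>2"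
    using N1 by (intro integral_Markov_inequality_measure[where A = "{}"] int) auto
  also have "\<dots> = 4 / real N" unfolding E using N1 by (simp add: field_simps power2_eq_square)
  also have "\<dots> \<le> 16 * s" using N4 N1 s by (simp add: field_simps)
  finally show ?thesis .
qed

lemma separated_mono: "separated k n v \<Longrightarrow> m \<le> n \<Longrightarrow> separated k m v"
  by (auto simp: separated_def)

text \<open>Van der Corput differencing: if \<open>F\<close> is small at \<open>t\<close> and at \<open>t + h\<close>, then so is
  \<open>F (t + h) - chi (v n) h * F t\<close>, which has one term less and, for most \<open>h\<close>, coefficients of modulus
  at least \<open>s\<close>.\<close>

lemma prob_tpoly_vdC:
  fixes c :: "nat \<Rightarrow> complex"
  assumes C: "\<And>c'. (\<And>i. i < n \<Longrightarrow> norm (c' i) \<ge> 1) \<Longrightarrow>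
                measure (torus k) {t \<in> space (torus k). norm (tpoly k n c' v t) \<le> 2 * y / s} \<le> P"
    and c: "\<And>i. i < Suc n \<Longrightarrow> norm (c i) \<ge> 1" and v: "separated k (Suc n) v"
    and y: "y > 0" and s: "s > 0" and P: "P \<ge> 0"
  shows "(measure (torus k) {t \<in> space (torus k). norm (tpoly k (Suc n) c v t) \<le> y})\<^sup>2
           \<le> 16 * real n * s + P"
proof -
  let ?T = "torus k"
  define E where "E = {t \<in> space ?T. norm (tpoly k (Suc n) c v t) \<le> y}"
  have [measurable]: "E \<in> sets ?T" unfolding E_def by measurable
  define e where "e = measure ?T E"
  define bad where "bad = (\<Union>i<n. {h \<in> space ?T. norm (chi k (\<lambda>l. v i l - v n l) h - 1) \<le> s})"
  have [measurable]: "bad \<in> sets ?T" unfolding bad_def by measurable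
  have "measure ?T bad \<le> (\<Sum>i<n. measure ?T {h \<in> space ?T. norm (chi k (\<lambda>l. v i l - v n l) h - 1) \<le> s})"
    unfolding bad_def by (rule torus.finite_measure_subadditive_finite) auto
  also have "\<dots> \<le> (\<Sum>i<n. 16 * s)"
  proof (rule sum_mono)
    fix i assume i: "i \<in> {..<n}"
    then obtain l where "l < k" "v i l \<noteq> v n l" using v unfolding separated_def
      by (metis less_Suc_eq lessThan_iff order_less_irrefl)
    then show "measure ?T {h \<in> space ?T. norm (chi k (\<lambda>l. v i l - v n l) h - 1) \<le> s} \<le> 16 * s"
      using s by (intro prob_chi_near_1) auto
  qed
  finally have bad: "measure ?T bad \<le> 16 * real n * s" by (simp add: mult_ac)
  have sh: "shift k h t \<in> space ?T" for h t by (simp add: space_torus shift_def)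
  have comm: "tpoly k m c' v' (shift k h t) = tpoly k m c' v' (shift k t h)" for m c' v' h t
    by (simp add: tpoly_def chi_shift mult_ac)
  \<comment> \<open>\<open>In t h\<close> marks that both \<open>t\<close> and its translate by
    \<open>h\<close> lie in \<open>E\<close>. For fixed \<open>t\<close> the translate is uniformly
    distributed, so the double integral is \<open>e\<^sup>2\<close>.\<close>
  define In where "In t h = indicator E t * (indicator E (shift k h t) :: real)" for t h
  have In': "In t h = indicator E t * indicator E (shift k t h)" for t h
    unfolding In_def by (auto simp: indicator_def E_def sh comm)
  have Inm [measurable]: "case_prod In \<in> borel_measurable (?T \<Otimes>\<^sub>M ?T)"
  proof -
    have "(\<lambda>x. indicator E (fst x) * (if norm (\<Sum>i<Suc n. c i * (chi k (v i) (fst x) * chi k (v i) (snd x))) \<le> y then 1 else 0 :: real))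
        \<in> borel_measurable (?T \<Otimes>\<^sub>M ?T)" by measurable
    also have "(\<lambda>x. indicator E (fst x) * (if norm (\<Sum>i<Suc n. c i * (chi k (v i) (fst x) * chi k (v i) (snd x))) \<le> y then 1 else 0 :: real)) = case_prod In"
      by (auto simp: In_def indicator_def E_def sh tpoly_def chi_shift)
    finally show ?thesis .
  qed
  interpret P: pair_prob_space ?T ?T ..
  have int: "integrable (?T \<Otimes>\<^sub>M ?T) (case_prod In)"
    by (rule P.integrable_const_bound[where B = 1]) (auto simp: In_def indicator_def)
  have indE: "(\<integral>t. indicator E t \<partial>?T) = e" by (simp add: e_def)
  have "(\<integral>h. (\<integral>t. In t h \<partial>?T) \<partial>?T) = (\<integral>t. (\<integral>h. In t h \<partial>?T) \<partial>?T)"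
    by (rule P.Fubini_integral[OF int])
  also have "\<dots> = (\<integral>t. indicator E t * e \<partial>?T)"
  proof (intro Bochner_Integration.integral_cong refl)
    fix t
    have "(\<integral>h. indicator E (shift k t h) \<partial>?T) = (\<integral>h. (indicator E h :: real) \<partial>?T)"
      by (rule integral_torus_shift) auto
    then show "(\<integral>h. In t h \<partial>?T) = indicator E t * e" 
      by (simp only: In' integral_mult_right_zero indE)
  qed
  also have "\<dots> = e\<^sup>2" by (simp add: e_def power2_eq_square)
  finally have e2: "e\<^sup>2 = (\<integral>h. (\<integral>t. In t h \<partial>?T) \<partial>?T)" ..
  have "(\<integral>h. (\<integral>t. In t h \<partial>?T) \<partial>?T) \<le> (\<integral>h. indicator bad h + P \<partial>?T)"
  proof (rule integral_mono)
    show "integrable ?T (\<lambda>h. \<integral>t. In t h \<partial>?T)"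
      using P.integrable_snd[OF int] .
    show "integrable ?T (\<lambda>h. indicator bad h + P)"
      using P by (intro torus.integrable_const_bound[where B = "1 + P"]) (auto simp: indicator_def)
    fix h assume h: "h \<in> space ?T"
    show "(\<integral>t. In t h \<partial>?T) \<le> indicator bad h + P"
    proof (cases "h \<in> bad")
      case True
      have "(\<integral>t. In t h \<partial>?T) \<le> (\<integral>t. 1 \<partial>?T)"
      proof (rule integral_mono)
        show "integrable ?T (\<lambda>t. In t h)" unfolding In_def
          by (rule integrable_torus_bounded[where B = 1]) (auto simp: indicator_def)
      qed (auto simp: In_def indicator_def)
      then show ?thesis using True P by (simp add: torus.prob_space)
    next
      case False
      \<comment> \<open>The coefficients left by the differencing, divided by \<open>s\<close>: for
        \<open>h\<close> outside \<open>bad\<close> their modulus is again at least 1, so hypothesis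
        \<open>C\<close> applies, at level \<open>2 * y / s\<close>.\<close>
      define c' where "c' i = c i * (chi k (v i) h - chi k (v n) h) / of_real s" for i
      have c'1: "norm (c' i) \<ge> 1" if "i < n" for i
      proof -
        have "chi k (\<lambda>l. v i l - v n l) h * chi k (v n) h = chi k (v i) h"
          by (simp flip: chi_add)
        then have "chi k (v i) h - chi k (v n) h = (chi k (\<lambda>l. v i l - v n l) h - 1) * chi k (v n) h"
          by (simp add: algebra_simps)
        then have "norm (chi k (v i) h - chi k (v n) h) = norm (chi k (\<lambda>l. v i l - v n l) h - 1)"
          by (simp add: norm_mult)
        also have "\<dots> > s" using False h that by (force simp: bad_def not_le)
        finally have "norm (chi k (v i) h - chi k (v n) h) / s \<ge> 1" using s by simp
        moreover have "norm (c i) \<ge> 1" using c that by simp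
        ultimately have "1 * 1 \<le> norm (c i) * (norm (chi k (v i) h - chi k (v n) h) / s)"
          by (intro mult_mono) auto
        then show ?thesis using s by (simp add: c'_def norm_mult norm_divide)
      qed
      have "(\<integral>t. In t h \<partial>?T) \<le> (\<integral>t. indicator {t \<in> space ?T. norm (tpoly k n c' v t) \<le> 2 * y / s} t \<partial>?T)"
      proof (rule integral_mono)
        show "integrable ?T (\<lambda>t. In t h)" unfolding In_def
          by (rule integrable_torus_bounded[where B = 1]) (auto simp: indicator_def)
        show "integrable ?T (indicator {t \<in> space ?T. norm (tpoly k n c' v t) \<le> 2 * y / s} :: _ \<Rightarrow> real)"
          by (rule integrable_torus_bounded[where B = 1]) (auto simp: indicator_def)
        fix t assume t: "t \<in> space ?T"
        have "norm (tpoly k n c' v t) \<le> 2 * y / s" if "t \<in> E" "shift k h t \<in> E"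
        proof -
          have "tpoly k (Suc n) c v (shift k h t) - chi k (v n) h * tpoly k (Suc n) c v t =
              (\<Sum>i<n. c i * (chi k (v i) t * chi k (v i) h) - chi k (v n) h * (c i * chi k (v i) t))"
            by (simp add: tpoly_def chi_shift sum_distrib_left sum_subtractf distrib_left)
          also have "\<dots> = of_real s * tpoly k n c' v t"
            unfolding tpoly_def sum_distrib_left
            by (intro sum.cong refl) (use s in \<open>simp add: c'_def field_simps\<close>)
          finally have "tpoly k (Suc n) c v (shift k h t) - chi k (v n) h * tpoly k (Suc n) c v t = of_real s * tpoly k n c' v t" .
          then have "s * norm (tpoly k n c' v t) = norm (tpoly k (Suc n) c v (shift k h t) - chi k (v n) h * tpoly k (Suc n) c v t)"
            using s by (simp add: norm_mult)
          also have "\<dots> \<le> norm (tpoly k (Suc n) c v (shift k h t)) + norm (chi k (v n) h * tpoly k (Suc n) c v t)"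
            by (rule norm_triangle_ineq4)
          also have "\<dots> \<le> y + y"
            using that by (intro add_mono) (auto simp: E_def norm_mult)
          finally show ?thesis using s by (simp add: field_simps)
        qed
        then show "In t h \<le> indicator {t \<in> space ?T. norm (tpoly k n c' v t) \<le> 2 * y / s} t"
          using t by (auto simp: In_def indicator_def)
      qed
      also have "\<dots> = measure ?T {t \<in> space ?T. norm (tpoly k n c' v t) \<le> 2 * y / s}" by simp
      also have "\<dots> \<le> P" using c'1 by (intro C) auto
      finally show ?thesis using False by simp
    qed
  qed
  also have "\<dots> = measure ?T bad + P"
    by (subst Bochner_Integration.integral_add)
       (auto simp: torus.prob_space intro!: torus.integrable_const_bound[where B = 1])
  finally show ?thesis using bad e2 by (simp add: e_def E_def)
qed

text \<open>Each term beyond the first costs one differencing with \<open>s = sqrt y\<close>. It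
  replaces the level \<open>y\<close> by \<open>2 * sqrt y\<close>, and the square on the left costs
  another root, so \<open>\<beta>\<close> drops to \<open>\<beta> / 4\<close>; from
  \<open>\<beta> = 1\<close> for one term this gives \<open>1 / 4 ^ (n - 1)\<close>. The order of
  the quantifiers is the point: \<open>C\<close> and \<open>\<beta>\<close> serve all
  \<open>k\<close>, \<open>c\<close> and \<open>v\<close>.\<close>

lemma tpoly_small_ball:
  assumes "n \<ge> 1"
  shows "\<exists>C \<beta>. C \<ge> 1 \<and> 0 < \<beta> \<and> \<beta> \<le> 1 \<and> (\<forall>k c v y. (\<forall>i<n. norm (c i) \<ge> 1) \<longrightarrow> separated k n v \<longrightarrow> y > 0 \<longrightarrow>
           measure (torus k) {t \<in> space (torus k). norm (tpoly k n c v t) \<le> y} \<le> C * y powr \<beta>)"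
  using assms
proof (induction n rule: dec_induct)
  case base
  show ?case
  proof (intro exI[of _ 1] conjI allI impI)
    fix k v and c :: "nat \<Rightarrow> complex" and y :: real
    assume c: "\<forall>i<1. norm (c i) \<ge> 1" and y: "y > 0"
    have n: "norm (tpoly k 1 c v t) = norm (c 0)" for t by (simp add: tpoly_def norm_mult)
    show "measure (torus k) {t \<in> space (torus k). norm (tpoly k 1 c v t) \<le> y} \<le> 1 * y powr 1"
    proof (cases "y < 1")
      case True
      then have "\<not> norm (c 0) \<le> y" using c by force
      with y show ?thesis by (simp only: n) simp
    next
      case False
      have "measure (torus k) {t \<in> space (torus k). norm (tpoly k 1 c v t) \<le> y} \<le> 1"
        by (rule torus.prob_le_1)
      also have "1 \<le> 1 * y powr 1" using False y by simp
      finally show ?thesis .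
    qed
  qed auto
next
  case (step n)
  then obtain C \<beta> where C: "C \<ge> 1" "0 < \<beta>" "\<beta> \<le> 1"
    and IH: "\<forall>k c v y. (\<forall>i<n. norm (c i) \<ge> 1) \<longrightarrow> separated k n v \<longrightarrow> y > 0 \<longrightarrow>
           measure (torus k) {t \<in> space (torus k). norm (tpoly k n c v t) \<le> y} \<le> C * y powr \<beta>"
    by blast
  define K where "K = 16 * real n + 2 * C"
  have K1: "K \<ge> 1" using C by (simp add: K_def)
  show ?case
  proof (intro exI conjI allI impI)
    show "sqrt K \<ge> 1" using K1 by simp
    show "0 < \<beta> / 4" "\<beta> / 4 \<le> 1" using C by auto
    fix k v and c :: "nat \<Rightarrow> complex" and y :: real
    assume c: "\<forall>i<Suc n. norm (c i) \<ge> 1" and v: "separated k (Suc n) v" and y: "y > 0"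
    define e where "e = measure (torus k) {t \<in> space (torus k). norm (tpoly k (Suc n) c v t) \<le> y}"
    have e1: "e \<le> 1" by (simp add: e_def)
    have "e \<le> sqrt K * y powr (\<beta> / 4)"
    proof (cases "y \<ge> 1")
      case True
      then have "y powr (\<beta> / 4) \<ge> 1" using C by (intro ge_one_powr_ge_zero) auto
      then have "1 * 1 \<le> sqrt K * y powr (\<beta> / 4)" using K1 by (intro mult_mono) auto
      with e1 show ?thesis by simp
    next
      case False
      have sq: "2 * y / sqrt y = 2 * y powr (1 / 2)"
        using real_div_sqrt[of y] y by (metis order_less_imp_le powr_half_sqrt times_divide_eq_right)
      have b2: "2 powr \<beta> \<le> (2 powr 1 :: real)" using C by (intro powr_mono) auto
      have "(2 * y / sqrt y) powr \<beta> = 2 powr \<beta> * y powr (\<beta> / 2)"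
        unfolding sq using y by (simp add: powr_mult powr_powr)
      also have "\<dots> \<le> 2 * y powr (\<beta> / 2)"
        using b2 by (intro mult_right_mono) auto
      finally have q1: "C * (2 * y / sqrt y) powr \<beta> \<le> C * (2 * y powr (\<beta> / 2))"
        using C by (intro mult_left_mono) auto
      have "sqrt y \<le> y powr (\<beta> / 2)"
        using y False C by (subst powr_half_sqrt[symmetric]) (auto intro!: powr_mono')
      then have q2: "16 * real n * sqrt y \<le> 16 * real n * y powr (\<beta> / 2)"
        by (intro mult_left_mono) auto
      have "e\<^sup>2 \<le> 16 * real n * sqrt y + C * (2 * y / sqrt y) powr \<beta>"
        unfolding e_def
      proof (rule prob_tpoly_vdC)
        fix c' assume "\<And>i. i < n \<Longrightarrow> norm (c' i :: complex) \<ge> 1"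
        then show "measure (torus k) {t \<in> space (torus k). norm (tpoly k n c' v t) \<le> 2 * y / sqrt y}
            \<le> C * (2 * y / sqrt y) powr \<beta>"
          using v y by (intro IH[rule_format]) (auto intro: separated_mono)
      qed (use c v y C in auto)
      also have "\<dots> \<le> 16 * real n * y powr (\<beta> / 2) + C * (2 * y powr (\<beta> / 2))"
        using q1 q2 by linarith
      also have "\<dots> = K * y powr (\<beta> / 2)" by (simp add: K_def algebra_simps)
      also have "\<dots> = (sqrt K * y powr (\<beta> / 4))\<^sup>2"
        using K1 by (simp add: power_mult_distrib power2_eq_square[of "y powr _"] flip: powr_add)
      finally show ?thesis by (rule power2_le_imp_le) (use K1 in auto)
    qed
    then show "measure (torus k) {t \<in> space (torus k). norm (tpoly k (Suc n) c v t) \<le> y} \<le> sqrt K * y powr (\<beta> / 4)"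
      by (simp add: e_def)
  qed
qed

section \<open>Logarithms under a small-ball estimate\<close>

lemma (in prob_space) AE_pos_of_small_ball:
  fixes X :: "'a \<Rightarrow> real"
  assumes [measurable]: "X \<in> borel_measurable M"
    and sb: "\<And>y. y > 0 \<Longrightarrow> prob {x \<in> space M. X x \<le> y} \<le> C * y powr \<beta>"
    and \<beta>: "\<beta> > 0"
  shows "AE x in M. X x > 0"
proof -
  let ?p = "prob {x \<in> space M. X x \<le> 0}"
  have "?p \<le> C * exp (- \<beta>) ^ j" for j :: nat
  proof -
    have "?p \<le> prob {x \<in> space M. X x \<le> exp (- real j)}"
      by (intro finite_measure_mono) (auto intro: order_trans)
    also have "\<dots> \<le> C * exp (- real j) powr \<beta>" by (rule sb) simp
    also have "exp (- real j) powr \<beta> = exp (- \<beta>) ^ j"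
      by (simp add: powr_def mult_ac flip: exp_of_nat_mult)
    finally show ?thesis .
  qed
  moreover have "(\<lambda>j. C * exp (- \<beta>) ^ j) \<longlonglongrightarrow> C * 0"
    using \<beta> by (intro tendsto_mult tendsto_const LIMSEQ_power_zero) auto
  ultimately have "?p \<le> 0"
    by (intro LIMSEQ_le_const[where X = "\<lambda>j. C * exp (- \<beta>) ^ j"]) auto
  then have "?p = 0" using measure_nonneg[of M] by (intro antisym)
  then have "AE x in M. \<not> X x \<le> 0" by (subst (asm) prob_eq_0) auto
  then show ?thesis by eventually_elim simp
qed

text \<open>The positive part of \<open>ln \<delta> - ln X\<close> is at most the number of
  \<open>j\<close> with \<open>X \<le> \<delta> * exp (- j)\<close>. The probabilities of these
  events are dominated by a geometric series of ratio \<open>exp (- \<beta>)\<close>.\<close>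

lemma (in prob_space) nn_integral_ln_tail:
  fixes X :: "'a \<Rightarrow> real"
  assumes [measurable]: "X \<in> borel_measurable M"
    and sb: "\<And>y. y > 0 \<Longrightarrow> prob {x \<in> space M. X x \<le> y} \<le> C * y powr \<beta>"
    and \<beta>: "\<beta> > 0" and C: "C \<ge> 0" and \<delta>: "\<delta> > 0"
  shows "(\<integral>\<^sup>+x. ennreal (max 0 (ln \<delta> - ln (X x))) \<partial>M) \<le> ennreal (C * \<delta> powr \<beta> / (1 - exp (- \<beta>)))"
proof -
  define A where "A j = {x \<in> space M. X x \<le> \<delta> * exp (- real j)}" for j :: nat
  have [measurable]: "A j \<in> sets M" for j unfolding A_def by measurable
  have "(\<integral>\<^sup>+x. ennreal (max 0 (ln \<delta> - ln (X x))) \<partial>M) \<le> (\<integral>\<^sup>+x. suminf (\<lambda>j. indicator (A j) x) \<partial>M)"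
  proof (rule nn_integral_mono_AE)
    have "AE x in M. X x > 0" by (rule AE_pos_of_small_ball[OF _ sb \<beta>]) auto
    moreover have "AE x in M. x \<in> space M" by (rule AE_space)
    ultimately show "AE x in M. ennreal (max 0 (ln \<delta> - ln (X x))) \<le> suminf (\<lambda>j. indicator (A j) x)"
    proof eventually_elim
      case (elim x)
      define L where "L = ln \<delta> - ln (X x)"
      show ?case
      proof (cases "L \<le> 0")
        case True then show ?thesis by (simp add: L_def max_def)
      next
        case False
        define N where "N = Suc (nat \<lfloor>L\<rfloor>)"
        have "x \<in> A j" if "j < N" for j
        proof -
          have "real j \<le> L" using that False by (simp add: N_def) linarith
          then have "ln (X x) \<le> ln (\<delta> * exp (- real j))"
            using \<delta> by (simp add: ln_mult L_def)
          then show ?thesis using elim \<delta> by (simp add: A_def)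
        qed
        then have "(\<Sum>j<N. indicator (A j) x :: ennreal) = (\<Sum>j<N. 1)"
          by (intro sum.cong) auto
        then have N: "(\<Sum>j<N. indicator (A j) x :: ennreal) = ennreal (real N)"
          by (simp add: ennreal_of_nat_eq_real_of_nat)
        have "max 0 L \<le> real N" using False unfolding N_def by linarith
        then have "ennreal (max 0 L) \<le> ennreal (real N)" by (rule ennreal_leI)
        also have "\<dots> \<le> suminf (\<lambda>j. indicator (A j) x)"
          unfolding N[symmetric] by (rule sum_le_suminf) auto
        finally show ?thesis by (simp add: L_def)
      qed
    qed
  qed
  also have "\<dots> = suminf (\<lambda>j. emeasure M (A j))"
    by (subst nn_integral_suminf) auto
  also have "\<dots> \<le> suminf (\<lambda>j. ennreal (C * \<delta> powr \<beta> * exp (- \<beta>) ^ j))"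
  proof (rule suminf_le)
    fix j
    have "prob (A j) \<le> C * (\<delta> * exp (- real j)) powr \<beta>"
      unfolding A_def using \<delta> by (intro sb) auto
    also have "\<dots> = C * \<delta> powr \<beta> * exp (- \<beta>) ^ j"
      using \<delta> by (simp add: powr_mult) (simp add: powr_def mult_ac flip: exp_of_nat_mult)
    finally show "emeasure M (A j) \<le> ennreal (C * \<delta> powr \<beta> * exp (- \<beta>) ^ j)"
      by (simp add: emeasure_eq_measure ennreal_leI)
  qed auto
  also have "\<dots> = ennreal (suminf (\<lambda>j. C * \<delta> powr \<beta> * exp (- \<beta>) ^ j))"
    using \<beta> C by (intro suminf_ennreal2 summable_mult summable_geometric) auto
  also have "suminf (\<lambda>j. C * \<delta> powr \<beta> * exp (- \<beta>) ^ j) = C * \<delta> powr \<beta> / (1 - exp (- \<beta>))"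
    using \<beta> by (subst suminf_mult) (auto simp: suminf_geometric summable_geometric)
  finally show ?thesis .
qed

text \<open>Almost surely the truncated logarithm exceeds the true one by exactly \<open>D\<close>,
  whose mean the tail bound controls. The error depends on \<open>X\<close> only through
  \<open>C\<close> and \<open>\<beta>\<close>, so one \<open>\<delta>\<close> serves all members of
  a sequence.\<close>

lemma (in prob_space) ln_of_small_ball:
  fixes X :: "'a \<Rightarrow> real"
  assumes X [measurable]: "X \<in> borel_measurable M"
    and sb: "\<And>y. y > 0 \<Longrightarrow> prob {x \<in> space M. X x \<le> y} \<le> C * y powr \<beta>"
    and \<beta>: "\<beta> > 0" and C: "C \<ge> 0" and \<delta>: "\<delta> > 0" and L: "\<And>x. X x \<le> L"
  shows "integrable M (\<lambda>x. ln (X x))"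
    and "\<bar>(\<integral>x. ln (X x) \<partial>M) - (\<integral>x. ln (max (X x) \<delta>) \<partial>M)\<bar> \<le> C * \<delta> powr \<beta> / (1 - exp (- \<beta>))"
proof -
  define D where "D x = max 0 (ln \<delta> - ln (X x))" for x
  define K where "K = C * \<delta> powr \<beta> / (1 - exp (- \<beta>))"
  have K: "K \<ge> 0" using C \<beta> by (simp add: K_def)
  have nn: "(\<integral>\<^sup>+x. ennreal (D x) \<partial>M) \<le> ennreal K"
    unfolding D_def K_def by (rule nn_integral_ln_tail[OF X sb \<beta> C \<delta>])
  have [measurable]: "D \<in> borel_measurable M" unfolding D_def[abs_def] by measurable
  have iD: "integrable M D"
    by (rule integrableI_nonneg) (use nn in \<open>auto simp: D_def top_unique less_top[symmetric]\<close>)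
  have "ennreal (\<integral>x. D x \<partial>M) = (\<integral>\<^sup>+x. ennreal (D x) \<partial>M)"
    by (rule nn_integral_eq_integral[OF iD, symmetric]) (simp add: D_def)
  with nn K have iDK: "(\<integral>x. D x \<partial>M) \<le> K" by (metis ennreal_le_iff)
  have iD0: "(\<integral>x. D x \<partial>M) \<ge> 0" by (rule integral_nonneg_AE) (simp add: D_def)
  have iM: "integrable M (\<lambda>x. ln (max (X x) \<delta>))"
  proof (rule integrable_const_bound[where B = "\<bar>ln \<delta>\<bar> + \<bar>ln (max L \<delta>)\<bar>"])
    have "\<bar>ln (max (X x) \<delta>)\<bar> \<le> \<bar>ln \<delta>\<bar> + \<bar>ln (max L \<delta>)\<bar>" for x
    proof -
      have "ln \<delta> \<le> ln (max (X x) \<delta>)" "ln (max (X x) \<delta>) \<le> ln (max L \<delta>)"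
        using \<delta> L[of x] by (auto simp: less_max_iff_disj max_def)
      then show ?thesis by linarith
    qed
    then show "AE x in M. norm (ln (max (X x) \<delta>)) \<le> \<bar>ln \<delta>\<bar> + \<bar>ln (max L \<delta>)\<bar>" by auto
  qed auto
  have ae: "AE x in M. ln (X x) = ln (max (X x) \<delta>) - D x"
  proof -
    have "AE x in M. X x > 0" by (rule AE_pos_of_small_ball[OF _ sb \<beta>]) auto
    then show ?thesis by eventually_elim (use \<delta> in \<open>auto simp: D_def max_def\<close>)
  qed
  have "integrable M (\<lambda>x. ln (max (X x) \<delta>) - D x)" using iM iD by simp
  then show "integrable M (\<lambda>x. ln (X x))"
    using ae by (subst integrable_cong_AE) auto
  have "(\<integral>x. ln (X x) \<partial>M) = (\<integral>x. ln (max (X x) \<delta>) - D x \<partial>M)"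
    by (rule integral_cong_AE) (use ae in auto)
  also have "\<dots> = (\<integral>x. ln (max (X x) \<delta>) \<partial>M) - (\<integral>x. D x \<partial>M)"
    using iM iD by simp
  finally show "\<bar>(\<integral>x. ln (X x) \<partial>M) - (\<integral>x. ln (max (X x) \<delta>) \<partial>M)\<bar> \<le> C * \<delta> powr \<beta> / (1 - exp (- \<beta>))"
    using iDK iD0 by (simp add: K_def)
qed

subsection \<open>Continuity of the Mahler measure in the exponents\<close>

definition logint :: "nat \<Rightarrow> nat \<Rightarrow> (nat \<Rightarrow> complex) \<Rightarrow> (nat \<Rightarrow> nat \<Rightarrow> int) \<Rightarrow> real" where
  "logint k n c v = (\<integral>t. ln (norm (tpoly k n c v t)) \<partial>torus k)"

lemma integrable_ln_tpoly:
  assumes "n \<ge> 1" "\<And>i. i < n \<Longrightarrow> norm (c i) \<ge> 1" "separated k n v"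
  shows "integrable (torus k) (\<lambda>t. ln (norm (tpoly k n c v t)))"
    and "AE t in torus k. tpoly k n c v t \<noteq> 0"
proof -
  obtain C \<beta> where C: "C \<ge> 1" "0 < \<beta>" and sb: "\<And>y. y > 0 \<Longrightarrow>
      measure (torus k) {t \<in> space (torus k). norm (tpoly k n c v t) \<le> y} \<le> C * y powr \<beta>"
    using tpoly_small_ball[OF assms(1)] assms(2,3) by blast
  show "integrable (torus k) (\<lambda>t. ln (norm (tpoly k n c v t)))"
    by (rule torus.ln_of_small_ball(1)[where \<delta> = 1, OF _ sb C(2) _ _ norm_tpoly_le]) (use C in auto)
  have "AE t in torus k. norm (tpoly k n c v t) > 0"
    by (rule torus.AE_pos_of_small_ball[OF _ sb C(2)]) auto
  then show "AE t in torus k. tpoly k n c v t \<noteq> 0" by eventually_elim auto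
qed

text \<open>For these \<open>a\<close> the product of the characters \<open>chi k (v i)\<close>
  raised to the powers \<open>a i\<close> is identically 1, and for all other \<open>a\<close> it
  has mean 0. The relations therefore determine all mixed moments of the characters.\<close>

definition rel :: "nat \<Rightarrow> nat \<Rightarrow> (nat \<Rightarrow> nat \<Rightarrow> int) \<Rightarrow> (nat \<Rightarrow> int) \<Rightarrow> bool" where
  "rel k n v a \<longleftrightarrow> (\<forall>l<k. (\<Sum>i<n. a i * v i l) = 0)"

text \<open>The extra character makes a recursion possible: expanding one factor
  \<open>|F|^2\<close> moves \<open>a\<close> by a difference of unit vectors, so the moments with
  \<open>a = 0\<close> alone would not be closed under it.\<close>

definition moment :: "nat \<Rightarrow> nat \<Rightarrow> (nat \<Rightarrow> complex) \<Rightarrow> (nat \<Rightarrow> nat \<Rightarrow> int) \<Rightarrow> nat \<Rightarrow> (nat \<Rightarrow> int) \<Rightarrow> complex" where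
  "moment k n c v m a =
     (\<integral>t. of_real ((norm (tpoly k n c v t))\<^sup>2) ^ m * chi k (\<lambda>l. \<Sum>i<n. a i * v i l) t \<partial>torus k)"

lemma integrable_moment:
  "integrable (torus k) (\<lambda>t. complex_of_real ((norm (tpoly k n c v t))\<^sup>2) ^ m * chi k u t)"
  by (rule integrable_torus_bounded[where B = "((\<Sum>i<n. norm (c i))\<^sup>2) ^ m"])
     (auto simp: norm_mult norm_power intro!: power_mono norm_tpoly_le)

lemma moment_0: "moment k n c v 0 a = (if rel k n v a then 1 else 0)"
  by (simp add: moment_def rel_def integral_chi)

lemma moment_Suc:
  "moment k n c v (Suc m) a = (\<Sum>i<n. \<Sum>j<n. c i * cnj (c j) *
      moment k n c v m (\<lambda>p. a p + (if p = i then 1 else 0) - (if p = j then 1 else 0)))"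
proof -
  have sq: "complex_of_real ((norm (tpoly k n c v t))\<^sup>2) ^ Suc m * chi k (\<lambda>l. \<Sum>i<n. a i * v i l) t =
     (\<Sum>i<n. \<Sum>j<n. c i * cnj (c j) * (complex_of_real ((norm (tpoly k n c v t))\<^sup>2) ^ m *
        chi k (\<lambda>l. \<Sum>p<n. (a p + (if p = i then 1 else 0) - (if p = j then 1 else 0)) * v p l) t))" for t
  proof -
    have "complex_of_real ((norm (tpoly k n c v t))\<^sup>2) = tpoly k n c v t * cnj (tpoly k n c v t)"
      by (rule complex_norm_square)
    also have "\<dots> = (\<Sum>i<n. \<Sum>j<n. c i * cnj (c j) * (chi k (v i) t * cnj (chi k (v j) t)))"
      by (simp add: tpoly_def sum_product mult_ac)
    finally have 1: "complex_of_real ((norm (tpoly k n c v t))\<^sup>2) = \<dots>" .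
    have 2: "chi k (\<lambda>l. \<Sum>p<n. (a p + (if p = i then 1 else 0) - (if p = j then 1 else 0)) * v p l) t
        = chi k (v i) t * cnj (chi k (v j) t) * chi k (\<lambda>l. \<Sum>i<n. a i * v i l) t" if "i < n" "j < n" for i j
    proof -
      have "(\<Sum>p<n. (a p + (if p = i then 1 else 0) - (if p = j then 1 else 0)) * v p l)
          = (\<Sum>p<n. a p * v p l + (if p = i then v p l else 0) - (if p = j then v p l else 0))" for l
        by (intro sum.cong refl) (auto simp: algebra_simps)
      then have "(\<Sum>p<n. (a p + (if p = i then 1 else 0) - (if p = j then 1 else 0)) * v p l)
          = v i l + - v j l + (\<Sum>p<n. a p * v p l)" for l
        using that by (simp add: sum.distrib sum_subtractf)
      then show ?thesis by (simp add: chi_add chi_diff)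
    qed
    let ?A = "complex_of_real ((norm (tpoly k n c v t))\<^sup>2) ^ m" and ?X = "chi k (\<lambda>l. \<Sum>i<n. a i * v i l) t"
    have ac: "p * q * (r * s) = p * (r * (q * s))" for p q r s :: complex by simp
    have "complex_of_real ((norm (tpoly k n c v t))\<^sup>2) ^ Suc m * ?X =
        complex_of_real ((norm (tpoly k n c v t))\<^sup>2) * (?A * ?X)"
      by (simp only: power_Suc mult.assoc)
    also have "\<dots> = (\<Sum>i<n. \<Sum>j<n. c i * cnj (c j) * (chi k (v i) t * cnj (chi k (v j) t))) * (?A * ?X)"
      by (rule arg_cong[OF 1])
    also have "\<dots> = (\<Sum>i<n. \<Sum>j<n. c i * cnj (c j) * (chi k (v i) t * cnj (chi k (v j) t)) * (?A * ?X))"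
      by (simp only: sum_distrib_right)
    also have "\<dots> = (\<Sum>i<n. \<Sum>j<n. c i * cnj (c j) * (?A *
        chi k (\<lambda>l. \<Sum>p<n. (a p + (if p = i then 1 else 0) - (if p = j then 1 else 0)) * v p l) t))"
    proof (intro sum.cong refl)
      fix i j assume "i \<in> {..<n}" "j \<in> {..<n}"
      then show "c i * cnj (c j) * (chi k (v i) t * cnj (chi k (v j) t)) * (?A * ?X) = c i * cnj (c j) * (?A *
        chi k (\<lambda>l. \<Sum>p<n. (a p + (if p = i then 1 else 0) - (if p = j then 1 else 0)) * v p l) t)"
        using ac[of "c i * cnj (c j)" "chi k (v i) t * cnj (chi k (v j) t)" ?A ?X]
        by (simp only: lessThan_iff 2)
    qed
    finally show ?thesis .
  qed
  have int: "integrable (torus k) (\<lambda>t. c i * cnj (c j) * (complex_of_real ((norm (tpoly k n c v t))\<^sup>2) ^ m *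
        chi k u t))" for i j u
    by (rule integrable_mult_right[OF integrable_moment])
  have "moment k n c v (Suc m) a = (\<integral>t. (\<Sum>i<n. \<Sum>j<n. c i * cnj (c j) * (complex_of_real ((norm (tpoly k n c v t))\<^sup>2) ^ m *
        chi k (\<lambda>l. \<Sum>p<n. (a p + (if p = i then 1 else 0) - (if p = j then 1 else 0)) * v p l) t)) \<partial>torus k)"
    unfolding moment_def by (rule Bochner_Integration.integral_cong[OF refl sq])
  also have "\<dots> = (\<Sum>i<n. \<Sum>j<n. \<integral>t. c i * cnj (c j) * (complex_of_real ((norm (tpoly k n c v t))\<^sup>2) ^ m *
        chi k (\<lambda>l. \<Sum>p<n. (a p + (if p = i then 1 else 0) - (if p = j then 1 else 0)) * v p l) t) \<partial>torus k)"
    using int by (simp only: Bochner_Integration.integral_sum Bochner_Integration.integrable_sum)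
  also have "\<dots> = (\<Sum>i<n. \<Sum>j<n. c i * cnj (c j) *
      moment k n c v m (\<lambda>p. a p + (if p = i then 1 else 0) - (if p = j then 1 else 0)))"
    by (simp only: moment_def integral_mult_right_zero)
  finally show ?thesis .
qed

lemma moment_tendsto:
  assumes "\<And>a. eventually (\<lambda>j. rel (K j) n (V j) a = rel k n w a) sequentially"
  shows "(\<lambda>j. moment (K j) n c (V j) m a) \<longlonglongrightarrow> moment k n c w m a"
proof (induction m arbitrary: a)
  case 0
  have "eventually (\<lambda>j. moment (K j) n c (V j) 0 a = moment k n c w 0 a) sequentially"
    using assms[of a] by eventually_elim (simp add: moment_0)
  then show ?case by (rule tendsto_eventually)
next
  case (Suc m)
  then show ?case unfolding moment_Suc by (intro tendsto_sum tendsto_mult tendsto_const)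
qed

lemma real_moment_tendsto:
  assumes "\<And>a. eventually (\<lambda>j. rel (K j) n (V j) a = rel k n w a) sequentially"
  shows "(\<lambda>j. \<integral>t. ((norm (tpoly (K j) n c (V j) t))\<^sup>2) ^ m \<partial>torus (K j))
           \<longlonglongrightarrow> (\<integral>t. ((norm (tpoly k n c w t))\<^sup>2) ^ m \<partial>torus k)"
proof -
  have "moment k n c v m (\<lambda>_. 0) = of_real (\<integral>t. ((norm (tpoly k n c v t))\<^sup>2) ^ m \<partial>torus k)" for k v
    unfolding moment_def by (simp flip: of_real_power integral_complex_of_real)
  with moment_tendsto[OF assms, of c m "\<lambda>_. 0"] show ?thesis
    by (simp only: tendsto_of_real_iff)
qed

theorem logint_tendsto:
  assumes n: "n \<ge> 1" and c: "\<And>i. i < n \<Longrightarrow> norm (c i) \<ge> 1"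
    and V: "\<And>j. separated (K j) n (V j)" and w: "separated k n w"
    and rel: "\<And>a. eventually (\<lambda>j. rel (K j) n (V j) a = rel k n w a) sequentially"
  shows "(\<lambda>j. logint (K j) n c (V j)) \<longlonglongrightarrow> logint k n c w"
proof (rule tendstoI)
  fix e :: real assume "e > 0"
  \<comment> \<open>Truncation and polynomial approximation cost one \<open>\<epsilon>\<close> each,
    for both polynomials compared; the fifth pays for the convergence of the moments.\<close>
  define \<epsilon> where "\<epsilon> = e / 5"
  have \<epsilon>: "\<epsilon> > 0" using \<open>e > 0\<close> by (simp add: \<epsilon>_def)
  obtain C \<beta> where C: "C \<ge> 1" "0 < \<beta>" and sb: "\<And>k v y. separated k n v \<Longrightarrow> y > 0 \<Longrightarrow>
      measure (torus k) {t \<in> space (torus k). norm (tpoly k n c v t) \<le> y} \<le> C * y powr \<beta>"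
    using tpoly_small_ball[OF n] c by blast
  define S where "S = (\<Sum>i<n. norm (c i))"
  have "((\<lambda>\<delta>. C * \<delta> powr \<beta> / (1 - exp (- \<beta>))) \<longlongrightarrow> C * 0 / (1 - exp (- \<beta>))) (at_right 0)"
    using C eventually_at_right_less[of "0::real"]
    by (intro tendsto_intros tendsto_zero_powrI) (auto elim: eventually_mono)
  then have "eventually (\<lambda>\<delta>. C * \<delta> powr \<beta> / (1 - exp (- \<beta>)) < \<epsilon>) (at_right 0)"
    using \<epsilon> by (intro order_tendstoD(2)) auto
  moreover have "eventually (\<lambda>\<delta>::real. \<delta> > 0) (at_right 0)" by (rule eventually_at_right_less)
  ultimately have "eventually (\<lambda>\<delta>. C * \<delta> powr \<beta> / (1 - exp (- \<beta>)) < \<epsilon> \<and> \<delta> > 0) (at_right 0)"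
    by eventually_elim simp
  then obtain \<delta> where \<delta>: "\<delta> > 0" "C * \<delta> powr \<beta> / (1 - exp (- \<beta>)) < \<epsilon>"
    using eventually_happens'[of "at_right (0::real)"] by auto
  \<comment> \<open>The square root makes \<open>g\<close> a polynomial in \<open>|F|^2\<close>, so
    that its mean is a linear combination of moments.\<close>
  have "continuous_on {0..S\<^sup>2} (\<lambda>x. ln (max (sqrt x) \<delta>))"
    using \<delta> by (intro continuous_intros) (auto simp: max_def)
  then obtain g where g: "real_polynomial_function g"
    and gapp: "\<And>x. x \<in> {0..S\<^sup>2} \<Longrightarrow> \<bar>ln (max (sqrt x) \<delta>) - g x\<bar> < \<epsilon>"
    using Stone_Weierstrass_real_polynomial_function[of "{0..S\<^sup>2}" "\<lambda>x. ln (max (sqrt x) \<delta>)" \<epsilon>] \<epsilon>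
    by auto
  obtain b N where gb: "g = (\<lambda>x. \<Sum>i\<le>N. b i * x ^ i)"
    using g unfolding real_polynomial_function_iff_sum by auto
  define G where "G k v = (\<integral>t. g ((norm (tpoly k n c v t))\<^sup>2) \<partial>torus k)" for k v
  have im: "integrable (torus k) (\<lambda>t. ((norm (tpoly k n c v t))\<^sup>2) ^ m)" for k v m
    by (rule integrable_torus_bounded[where B = "(S\<^sup>2) ^ m"])
       (auto simp: S_def intro!: power_mono norm_tpoly_le)
  have G: "G k v = (\<Sum>i\<le>N. b i * (\<integral>t. ((norm (tpoly k n c v t))\<^sup>2) ^ i \<partial>torus k))" for k v
    unfolding G_def gb using im by (simp del: power_mult)
  have near: "\<bar>logint k n c v - G k v\<bar> \<le> 2 * \<epsilon>" if v: "separated k n v" for k v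
  proof -
    have 1: "\<bar>logint k n c v - (\<integral>t. ln (max (norm (tpoly k n c v t)) \<delta>) \<partial>torus k)\<bar> \<le> \<epsilon>"
      unfolding logint_def
      by (rule order_trans[OF torus.ln_of_small_ball(2)[OF _ sb[OF v] C(2) _ \<delta>(1) norm_tpoly_le]])
         (use C \<delta> in auto)
    have ptw: "\<bar>ln (max (norm (tpoly k n c v t)) \<delta>) - g ((norm (tpoly k n c v t))\<^sup>2)\<bar> \<le> \<epsilon>" for t
    proof -
      have "(norm (tpoly k n c v t))\<^sup>2 \<le> S\<^sup>2"
        unfolding S_def by (rule power_mono[OF norm_tpoly_le]) simp
      then show ?thesis using gapp[of "(norm (tpoly k n c v t))\<^sup>2"] by simp
    qed
    have gint: "integrable (torus k) (\<lambda>t. g ((norm (tpoly k n c v t))\<^sup>2))"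
      unfolding gb using im by (auto simp del: power_mult)
    have mint: "integrable (torus k) (\<lambda>t. ln (max (norm (tpoly k n c v t)) \<delta>) - g ((norm (tpoly k n c v t))\<^sup>2))"
      using borel_measurable_integrable[OF gint] ptw
      by (intro integrable_torus_bounded[where B = \<epsilon>]) auto
    have mint': "integrable (torus k) (\<lambda>t. ln (max (norm (tpoly k n c v t)) \<delta>))"
      using Bochner_Integration.integrable_add[OF mint gint] by simp
    have "\<bar>(\<integral>t. ln (max (norm (tpoly k n c v t)) \<delta>) \<partial>torus k) - G k v\<bar> =
        \<bar>\<integral>t. ln (max (norm (tpoly k n c v t)) \<delta>) - g ((norm (tpoly k n c v t))\<^sup>2) \<partial>torus k\<bar>"
      unfolding G_def using mint' gint by simp
    also have "\<dots> \<le> (\<integral>t. \<bar>ln (max (norm (tpoly k n c v t)) \<delta>) - g ((norm (tpoly k n c v t))\<^sup>2)\<bar> \<partial>torus k)"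
      by (rule integral_abs_bound)
    also have "\<dots> \<le> (\<integral>t. \<epsilon> \<partial>torus k)"
      using mint ptw by (intro integral_mono) auto
    also have "\<dots> = \<epsilon>" by (simp add: torus.prob_space)
    finally show ?thesis using 1 by linarith
  qed
  have "(\<lambda>j. G (K j) (V j)) \<longlonglongrightarrow> G k w"
    unfolding G by (intro tendsto_sum tendsto_mult tendsto_const real_moment_tendsto rel)
  then have "eventually (\<lambda>j. dist (G (K j) (V j)) (G k w) < \<epsilon>) sequentially"
    using \<epsilon> by (rule tendstoD)
  then show "eventually (\<lambda>j. dist (logint (K j) n c (V j)) (logint k n c w) < e) sequentially"
  proof eventually_elim
    case (elim j)
    then show ?case using near[OF V[of j]] near[OF w] unfolding dist_real_def \<epsilon>_def by linarith
  qed
qed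

text \<open>Continuity applied to a constant sequence. It will permit exchanging an exponent system
  for a nonzero multiple of itself, which has the same relations.\<close>

lemma logint_cong_rel:
  assumes "n \<ge> 1" "\<And>i. i < n \<Longrightarrow> norm (c i) \<ge> 1" "separated k n v" "separated k' n w"
    and "\<And>a. rel k n v a = rel k' n w a"
  shows "logint k n c v = logint k' n c w"
proof -
  have "(\<lambda>j::nat. logint k n c v) \<longlonglongrightarrow> logint k' n c w"
    by (rule logint_tendsto) (use assms in auto)
  then show ?thesis by (simp add: LIMSEQ_const_iff)
qed

subsection \<open>Power sums of the reciprocal roots\<close>

text \<open>Zeros are split off one at a time; none is 0, as the constant coefficient is 1. Working
  with reciprocals of zeros allows padding by \<open>\<alpha> i = 0\<close>, so one \<open>d\<close>
  serves a whole family of polynomials whose degrees vary.\<close>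

lemma poly_eq_prod_reciprocal_roots:
  fixes p :: "complex poly"
  assumes "coeff p 0 = 1" "degree p \<le> d"
  shows "\<exists>\<alpha>. p = (\<Prod>i<d. [:1, - \<alpha> i:])"
  using assms
proof (induction d arbitrary: p)
  case 0
  then obtain a where "p = [:a:]" by (metis degree_eq_zeroE le_zero_eq)
  with 0 have "p = 1" by (simp add: one_pCons)
  then show ?case by simp
next
  case (Suc d)
  show ?case
  proof (cases "degree p \<le> d")
    case True
    then obtain \<alpha> where "p = (\<Prod>i<d. [:1, - \<alpha> i:])" using Suc by blast
    then have "p = (\<Prod>i<Suc d. [:1, - (\<alpha>(d := 0)) i:])"
      by (simp add: one_pCons[symmetric])
    then show ?thesis by blast
  next
    case False
    then have deg: "degree p = Suc d" using Suc.prems by simp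
    then have "\<not> constant (poly p)" by (simp add: constant_degree)
    then obtain z where z: "poly p z = 0" using fundamental_theorem_of_algebra by blast
    have "poly p 0 = 1" using Suc.prems by (simp add: poly_0_coeff_0)
    with z have z0: "z \<noteq> 0" by auto
    obtain q where q: "p = [:-z, 1:] * q" using z by (auto simp: poly_eq_0_iff_dvd dvd_def)
    define r where "r = smult (-z) q"
    have pr: "p = r * [:1, - (1 / z):]" using z0 by (simp add: q r_def)
    have "q \<noteq> 0" using q deg by auto
    then have "degree p = Suc (degree q)" unfolding q by (subst degree_mult_eq) auto
    then have "degree r \<le> d" using deg z0 by (simp add: r_def)
    moreover have "coeff r 0 = 1" using Suc.prems(1) unfolding pr by (simp add: coeff_mult)
    ultimately obtain \<alpha> where \<alpha>: "r = (\<Prod>i<d. [:1, - \<alpha> i:])" using Suc.IH by blast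
    have "p = (\<Prod>i<Suc d. [:1, - (\<alpha>(d := 1 / z)) i:])"
      unfolding pr \<alpha> by (simp add: mult.commute)
    then show ?thesis by blast
  qed
qed

text \<open>The coefficient at index 0 is 0 rather than \<open>d\<close>, so that the series is
  exactly \<open>- X F' / F\<close> for the product \<open>F\<close> of the factors
  \<open>1 - \<alpha> i * X\<close>.\<close>

definition power_sums :: "nat \<Rightarrow> (nat \<Rightarrow> complex) \<Rightarrow> complex fps" where
  "power_sums d \<alpha> = Abs_fps (\<lambda>m. if m = 0 then 0 else \<Sum>i<d. \<alpha> i ^ m)"

lemma power_sums_nth: "m \<ge> 1 \<Longrightarrow> fps_nth (power_sums d \<alpha>) m = (\<Sum>i<d. \<alpha> i ^ m)"
  by (simp add: power_sums_def)

text \<open>For a single factor, \<open>- X F' / F\<close> is the geometric series in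
  \<open>\<alpha> i * X\<close> without its constant term; the product rule adds up the
  factors.\<close>

lemma newton_power_sums:
  "(\<Prod>i<d. 1 - fps_const (\<alpha> i) * fps_X) * power_sums d \<alpha> =
     - fps_X * fps_deriv (\<Prod>i<d. 1 - fps_const (\<alpha> i) * fps_X :: complex fps)"
proof (induction d)
  case 0
  show ?case by (simp add: power_sums_def fps_eq_iff)
next
  case (Suc d)
  define F where "F = (\<Prod>i<d. 1 - fps_const (\<alpha> i) * fps_X :: complex fps)"
  define g where "g = (1 - fps_const (\<alpha> d) * fps_X :: complex fps)"
  define s where "s = Abs_fps (\<lambda>m. if m = 0 then 0 else \<alpha> d ^ m)"
  have S: "power_sums (Suc d) \<alpha> = power_sums d \<alpha> + s"
    by (simp add: fps_eq_iff power_sums_def s_def)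
  have gs: "g * s = - fps_X * fps_deriv g"
  proof (rule fps_ext)
    fix m
    have "fps_nth (g * s) m = fps_nth s m - \<alpha> d * fps_nth (fps_X * s) m"
      by (simp add: g_def algebra_simps)
    also have "\<dots> = (if m = 1 then \<alpha> d else 0)"
      by (cases m) (auto simp: s_def)
    also have "\<dots> = fps_nth (- fps_X * fps_deriv g) m"
      by (cases m) (auto simp: g_def)
    finally show "fps_nth (g * s) m = fps_nth (- fps_X * fps_deriv g) m" .
  qed
  have "F * g * (power_sums d \<alpha> + s) = g * (F * power_sums d \<alpha>) + F * (g * s)"
    by (simp add: algebra_simps)
  also have "\<dots> = - fps_X * fps_deriv (F * g)"
    using Suc.IH unfolding gs F_def[symmetric] by (simp add: algebra_simps)
  finally show ?case unfolding S by (simp add: F_def g_def)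
qed

lemma cesaro_power_tendsto_0:
  fixes z :: complex
  assumes "norm z \<le> 1" "z \<noteq> 1"
  shows "(\<lambda>J. (\<Sum>q<J. z ^ q) / of_nat J) \<longlonglongrightarrow> 0"
proof (rule Lim_null_comparison)
  have "norm ((\<Sum>q<J. z ^ q) / of_nat J) \<le> 2 / norm (1 - z) * inverse (real J)" for J
  proof -
    have "norm (\<Sum>q<J. z ^ q) = norm (1 - z ^ J) / norm (1 - z)"
      using assms by (simp add: sum_gp_strict norm_divide)
    also have "norm (1 - z ^ J) \<le> norm (1::complex) + norm (z ^ J)" by (rule norm_triangle_ineq4)
    also have "\<dots> \<le> 2" using assms by (simp add: norm_power power_le_one)
    finally have "norm (\<Sum>q<J. z ^ q) \<le> 2 / norm (1 - z)" by (simp add: divide_right_mono)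
    then show ?thesis
      using mult_right_mono[of _ "2 / norm (1 - z)" "inverse (real J)"]
      by (simp add: norm_divide divide_inverse[of _ "real J"] mult_right_mono norm_inverse divide_right_mono)
  qed
  then show "eventually (\<lambda>J. norm ((\<Sum>q<J. z ^ q) / of_nat J) \<le> 2 / norm (1 - z) * inverse (real J)) sequentially"
    by (intro always_eventually) blast
  show "(\<lambda>J. 2 / norm (1 - z) * inverse (real J)) \<longlonglongrightarrow> 0"
    using tendsto_mult_right_zero[OF lim_inverse_n, of "2 / norm (1 - z)"] by simp
qed

text \<open>Bounds \<open>ln |1 - r * a|\<close> from below independently of \<open>r\<close>, which
  supplies the domination when \<open>r\<close> tends to 1.\<close>

lemma norm_one_minus_scaled_ge:
  fixes a :: complex
  assumes "norm a \<le> 1" "0 \<le> r" "r \<le> 1"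
  shows "norm (1 - a) / 2 \<le> norm (1 - of_real r * a)"
proof -
  have "norm (1 - a) = norm ((1 - of_real r * a) - of_real (1 - r) * a)"
    by (simp add: algebra_simps)
  also have "\<dots> \<le> norm (1 - of_real r * a) + norm (of_real (1 - r) * a)"
    by (rule norm_triangle_ineq4)
  also have "norm (of_real (1 - r) * a) \<le> 1 - r"
    using assms by (simp only: norm_mult norm_of_real) (simp add: mult_left_le)
  also have "1 - r \<le> norm (1 - of_real r * a)"
  proof -
    have "norm (of_real r * a) \<le> r" using assms by (simp add: norm_mult mult_left_le)
    then show ?thesis using norm_triangle_ineq2[of 1 "of_real r * a"] by simp
  qed
  finally show ?thesis by simp
qed

text \<open>With \<open>\<alpha>\<close> scaled by \<open>r < 1\<close>, the logarithm expands into
  a series of power sums, all of mean 0; then \<open>r\<close> tends to 1. Measurability is assumed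
  of the power sums only, because roots chosen separately at each point need not be measurable
  functions.\<close>

lemma (in prob_space) integral_ln_prod_eq_0:
  fixes \<alpha> :: "'a \<Rightarrow> nat \<Rightarrow> complex"
  assumes le: "\<And>x i. norm (\<alpha> x i) \<le> 1"
    and meas: "\<And>m. m \<ge> 1 \<Longrightarrow> (\<lambda>x. \<Sum>i<d. \<alpha> x i ^ m) \<in> borel_measurable M"
    and zero: "\<And>m. m \<ge> 1 \<Longrightarrow> (\<integral>x. (\<Sum>i<d. \<alpha> x i ^ m) \<partial>M) = 0"
    and int: "integrable M (\<lambda>x. ln (norm (\<Prod>i<d. 1 - \<alpha> x i)))"
    and nz: "AE x in M. (\<Prod>i<d. 1 - \<alpha> x i) \<noteq> 0"
  shows "(\<integral>x. ln (norm (\<Prod>i<d. 1 - \<alpha> x i)) \<partial>M) = 0"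
proof -
  define P where "P r x = (\<Prod>i<d. 1 - of_real r * \<alpha> x i)" for r x
  define g where "g r x = ln (norm (P r x))" for r x
  define f where "f r m x = - Re (of_real (r ^ m) / of_nat m * (\<Sum>i<d. \<alpha> x i ^ m))" for r m x
  have fm: "f r m \<in> borel_measurable M" for r m
  proof (cases "m \<ge> 1")
    case True
    note [measurable] = meas[OF True]
    show ?thesis unfolding f_def[abs_def] by measurable
  next
    case False then have "m = 0" by simp
    then show ?thesis by (simp add: f_def[abs_def])
  qed
  have fb: "\<bar>f r m x\<bar> \<le> real d * r ^ m" if "0 \<le> r" for r m x
  proof (cases "m \<ge> 1")
    case True
    have "\<bar>f r m x\<bar> \<le> norm (of_real (r ^ m) / of_nat m * (\<Sum>i<d. \<alpha> x i ^ m))"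
      unfolding f_def abs_minus_cancel by (rule abs_Re_le_cmod)
    also have "\<dots> = r ^ m / real m * norm (\<Sum>i<d. \<alpha> x i ^ m)"
      using that by (simp add: norm_mult norm_divide norm_power)
    also have "\<dots> \<le> r ^ m * real d"
    proof (intro mult_mono)
      have "r ^ m / real m \<le> r ^ m / 1" using True that by (intro divide_left_mono) auto
      then show "r ^ m / real m \<le> r ^ m" by simp
      have "norm (\<Sum>i<d. \<alpha> x i ^ m) \<le> (\<Sum>i<d. 1)"
        by (rule sum_norm_le) (simp add: norm_power power_le_one le)
      then show "norm (\<Sum>i<d. \<alpha> x i ^ m) \<le> real d" by simp
    qed (use that in auto)
    finally show ?thesis by (simp add: mult.commute)
  next
    case False then have "m = 0" by simp
    then show ?thesis by (simp add: f_def that)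
  qed
  have fs: "(\<lambda>m. f r m x) sums g r x" if r: "0 \<le> r" "r < 1" for r x
  proof -
    have lt: "norm (of_real r * \<alpha> x i) < 1" for i
    proof -
      have "norm (of_real r * \<alpha> x i) \<le> r * 1"
        using le r by (simp only: norm_mult norm_of_real) (intro mult_mono, auto)
      with r show ?thesis by simp
    qed
    have 1: "(\<lambda>m. - Re ((of_real r * \<alpha> x i) ^ m / of_nat m)) sums ln (norm (1 - of_real r * \<alpha> x i))" for i
    proof -
      have "(\<lambda>m. - ((- (- (of_real r * \<alpha> x i))) ^ m) / of_nat m) sums ln (1 + - (of_real r * \<alpha> x i))"
        by (rule Ln_series') (use lt[of i] in simp)
      then have "(\<lambda>m. Re (- ((- (- (of_real r * \<alpha> x i))) ^ m) / of_nat m)) sums Re (ln (1 + - (of_real r * \<alpha> x i)))"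
        by (rule sums_Re)
      moreover have "1 - of_real r * \<alpha> x i \<noteq> 0" using lt[of i] by fastforce
      ultimately show ?thesis by simp
    qed
    have "(\<lambda>m. \<Sum>i<d. - Re ((of_real r * \<alpha> x i) ^ m / of_nat m)) sums (\<Sum>i<d. ln (norm (1 - of_real r * \<alpha> x i)))"
      by (rule sums_sum) (rule 1)
    moreover have "(\<Sum>i<d. - Re ((of_real r * \<alpha> x i) ^ m / of_nat m)) = f r m x" for m
      by (simp add: f_def sum_negf power_mult_distrib flip: Re_sum sum_distrib_left sum_divide_distrib)
    moreover have "(\<Sum>i<d. ln (norm (1 - of_real r * \<alpha> x i))) = g r x"
    proof -
      have "norm (1 - of_real r * \<alpha> x i) > 0" for i using lt[of i] by fastforce
      then show ?thesis by (simp add: g_def P_def ln_prod flip: prod_norm)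
    qed
    ultimately show ?thesis by simp
  qed
  have g0: "(\<integral>x. g r x \<partial>M) = 0" if r: "0 \<le> r" "r < 1" for r
  proof -
    have sb: "summable (\<lambda>m. real d * r ^ m)"
      using r by (intro summable_mult summable_geometric) auto
    have fi: "integrable M (f r m)" for m
      by (rule integrable_const_bound[where B = "real d * r ^ m"]) (use fb[OF r(1)] fm in auto)
    have "(\<lambda>m. \<integral>x. f r m x \<partial>M) sums (\<integral>x. suminf (\<lambda>m. f r m x) \<partial>M)"
    proof (rule sums_integral[OF fi])
      show "AE x in M. summable (\<lambda>m. norm (f r m x))"
        by (intro AE_I2 summable_comparison_test'[OF sb, of 0]) (use fb[OF r(1)] in auto)
      have "(\<integral>x. norm (f r m x) \<partial>M) \<le> real d * r ^ m" for m
      proof -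
        have "(\<integral>x. norm (f r m x) \<partial>M) \<le> (\<integral>x. real d * r ^ m \<partial>M)"
          by (rule integral_mono) (use fi fb[OF r(1)] in auto)
        then show ?thesis by (simp add: prob_space)
      qed
      then show "summable (\<lambda>m. \<integral>x. norm (f r m x) \<partial>M)"
        by (intro summable_comparison_test'[OF sb, of 0]) auto
    qed
    moreover have "(\<integral>x. f r m x \<partial>M) = 0" for m
    proof (cases "m \<ge> 1")
      case True
      have "integrable M (\<lambda>x. \<Sum>i<d. \<alpha> x i ^ m)"
      proof (rule integrable_const_bound[where B = "real d"])
        have "norm (\<Sum>i<d. \<alpha> x i ^ m) \<le> (\<Sum>i<d. 1)" for x
          by (rule sum_norm_le) (simp add: norm_power power_le_one le)
        then show "AE x in M. norm (\<Sum>i<d. \<alpha> x i ^ m) \<le> real d" by simp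
      qed (use meas True in auto)
      then have "(\<integral>x. Re (of_real (r ^ m) / of_nat m * (\<Sum>i<d. \<alpha> x i ^ m)) \<partial>M) =
          Re (\<integral>x. of_real (r ^ m) / of_nat m * (\<Sum>i<d. \<alpha> x i ^ m) \<partial>M)"
        by (intro integral_Re integrable_mult_right)
      also have "\<dots> = 0" by (simp only: integral_mult_right_zero zero[OF True]) simp
      finally show ?thesis by (simp add: f_def)
    next
      case False then have "m = 0" by simp
      then show ?thesis by (simp add: f_def)
    qed
    moreover have "suminf (\<lambda>m. f r m x) = g r x" for x using fs[OF r] by (simp add: sums_iff)
    ultimately have "(\<lambda>m. 0) sums (\<integral>x. g r x \<partial>M)" by simp
    then show ?thesis using sums_zero sums_unique2 by blast
  qed
  define r where "r j = 1 - inverse (real (Suc j))" for j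
  have r: "0 \<le> r j" "r j < 1" for j by (auto simp: r_def inverse_le_1_iff)
  have r1: "r \<longlonglongrightarrow> 1"
    unfolding r_def using LIMSEQ_inverse_real_of_nat_add_minus[of 1] by simp
  have P1: "P 1 x = (\<Prod>i<d. 1 - \<alpha> x i)" for x by (simp add: P_def)
  have int1: "integrable M (g 1)" using int unfolding g_def P1 .
  \<comment> \<open>Obtained from the series in the power sums, since the individual
    \<open>\<alpha> x i\<close> are not known to be measurable in \<open>x\<close>.\<close>
  have gm: "g (r j) \<in> borel_measurable M" for j
  proof -
    have "(\<lambda>x. suminf (\<lambda>m. f (r j) m x)) \<in> borel_measurable M"
      using fm by (intro borel_measurable_suminf) auto
    also have "(\<lambda>x. suminf (\<lambda>m. f (r j) m x)) = g (r j)"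
      using fs[OF r] by (simp add: sums_iff fun_eq_iff)
    finally show ?thesis .
  qed
  have "(\<lambda>j. \<integral>x. g (r j) x \<partial>M) \<longlonglongrightarrow> (\<integral>x. g 1 x \<partial>M)"
  \<comment> \<open>Each factor is at most 2 and at least half of its value at \<open>r = 1\<close>,
    so \<open>g (r j)\<close> lies between \<open>g 1 - d * ln 2\<close> and
    \<open>d * ln 2\<close>.\<close>
  proof (rule integral_dominated_convergence[where w = "\<lambda>x. \<bar>g 1 x\<bar> + real d * ln 2"])
    show "integrable M (\<lambda>x. \<bar>g 1 x\<bar> + real d * ln 2)" using int1 by simp
    show "AE x in M. (\<lambda>j. g (r j) x) \<longlonglongrightarrow> g 1 x"
      using nz
    proof eventually_elim
      case (elim x)
      have "(\<lambda>j. P (r j) x) \<longlonglongrightarrow> (\<Prod>i<d. 1 - of_real 1 * \<alpha> x i)"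
        unfolding P_def by (intro tendsto_intros r1)
      then show ?case using elim unfolding g_def P1 by (intro tendsto_ln tendsto_norm) auto
    qed
    fix j
    show "AE x in M. norm (g (r j) x) \<le> \<bar>g 1 x\<bar> + real d * ln 2"
      using nz
    proof eventually_elim
      case (elim x)
      have pos1: "norm (1 - \<alpha> x i) > 0" if "i < d" for i using elim that by auto
      have pos: "norm (1 - of_real (r j) * \<alpha> x i) > 0" if "i < d" for i
      proof -
        have "norm (1 - \<alpha> x i) / 2 \<le> norm (1 - of_real (r j) * \<alpha> x i)"
          using r(2)[of j] by (intro norm_one_minus_scaled_ge le r(1)) auto
        with pos1[OF that] show ?thesis by linarith
      qed
      have g: "g (r j) x = (\<Sum>i<d. ln (norm (1 - of_real (r j) * \<alpha> x i)))"
        unfolding g_def P_def prod_norm[symmetric] by (rule ln_prod) (use pos in auto)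
      have g1: "g 1 x = (\<Sum>i<d. ln (norm (1 - \<alpha> x i)))"
        unfolding g_def P1 prod_norm[symmetric] by (rule ln_prod) (use pos1 in auto)
      have "g (r j) x \<le> (\<Sum>i<d. ln 2)"
        unfolding g
      proof (rule sum_mono)
        fix i assume i: "i \<in> {..<d}"
        have "norm (1 - of_real (r j) * \<alpha> x i) \<le> norm (1::complex) + norm (of_real (r j) * \<alpha> x i)"
          by (rule norm_triangle_ineq4)
        also have "norm (of_real (r j) * \<alpha> x i) \<le> 1 * 1"
          using r[of j] le[of x i] by (simp only: norm_mult norm_of_real) (intro mult_mono, auto)
        finally show "ln (norm (1 - of_real (r j) * \<alpha> x i)) \<le> ln 2" using pos i by simp
      qed
      moreover have "(\<Sum>i<d. ln (norm (1 - \<alpha> x i)) - ln 2) \<le> g (r j) x"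
        unfolding g
      proof (rule sum_mono)
        fix i assume i: "i \<in> {..<d}"
        have "ln (norm (1 - \<alpha> x i)) - ln 2 = ln (norm (1 - \<alpha> x i) / 2)"
          using pos1 i by (simp add: ln_div)
        also have "\<dots> \<le> ln (norm (1 - of_real (r j) * \<alpha> x i))"
          using pos1 pos i norm_one_minus_scaled_ge[OF le r(1), of j x i] r(2)[of j] by simp
        finally show "ln (norm (1 - \<alpha> x i)) - ln 2 \<le> ln (norm (1 - of_real (r j) * \<alpha> x i))" .
      qed
      moreover have "(\<Sum>i<d. ln (norm (1 - \<alpha> x i)) - ln 2) = g 1 x - real d * ln 2"
        by (simp add: sum_subtractf g1)
      moreover have "(\<Sum>i<d. ln 2) = real d * ln (2::real)" by simp
      ultimately show ?case unfolding real_norm_def by linarith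
    qed
  qed (use int1 gm in auto)
  then have "(\<lambda>j. 0) \<longlonglongrightarrow> (\<integral>x. g 1 x \<partial>M)" by (simp add: g0 r)
  then show ?thesis unfolding g_def P1 by (simp add: LIMSEQ_const_iff)
qed

section \<open>Integer trigonometric polynomials and Frobenius congruences\<close>

inductive int_trig :: "nat \<Rightarrow> ((nat \<Rightarrow> real) \<Rightarrow> complex) \<Rightarrow> bool" for k where
  int_trig_chi: "int_trig k (\<lambda>t. of_int c * chi k u t)"
| int_trig_add: "int_trig k f \<Longrightarrow> int_trig k g \<Longrightarrow> int_trig k (\<lambda>t. f t + g t)"

lemma int_trig_const: "int_trig k (\<lambda>t. of_int c)"
  using int_trig_chi[of k c "\<lambda>_. 0"] by simp

lemma int_trig_of_nat: "int_trig k (\<lambda>t. of_nat c)"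
  using int_trig_const[of k "int c"] by simp

lemma int_trig_0: "int_trig k (\<lambda>t. 0)"
  using int_trig_const[of k 0] by simp

lemma int_trig_1: "int_trig k (\<lambda>t. 1)"
  using int_trig_const[of k 1] by simp

lemma int_trig_mult_chi: "int_trig k f \<Longrightarrow> int_trig k (\<lambda>t. of_int c * chi k u t * f t)"
proof (induction rule: int_trig.induct)
  case (int_trig_chi d w)
  have "int_trig k (\<lambda>t. of_int (c * d) * chi k (\<lambda>l. u l + w l) t)" by (rule int_trig.int_trig_chi)
  then show ?case by (simp add: chi_add mult_ac)
next
  case (int_trig_add f g)
  then show ?case by (simp add: distrib_left int_trig.int_trig_add)
qed

lemma int_trig_mult: "int_trig k f \<Longrightarrow> int_trig k g \<Longrightarrow> int_trig k (\<lambda>t. f t * g t)"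
proof (induction rule: int_trig.induct)
  case (int_trig_chi c u)
  then show ?case by (rule int_trig_mult_chi)
next
  case (int_trig_add f h)
  then show ?case by (simp add: distrib_right int_trig.int_trig_add)
qed

lemma int_trig_uminus: "int_trig k f \<Longrightarrow> int_trig k (\<lambda>t. - f t)"
  using int_trig_mult[OF int_trig_const[of k "-1"]] by simp

lemma int_trig_diff: "int_trig k f \<Longrightarrow> int_trig k g \<Longrightarrow> int_trig k (\<lambda>t. f t - g t)"
  using int_trig_add[OF _ int_trig_uminus] by simp

lemma int_trig_sum: "(\<And>i. i \<in> A \<Longrightarrow> int_trig k (f i)) \<Longrightarrow> int_trig k (\<lambda>t. \<Sum>i\<in>A. f i t)"
  by (induction A rule: infinite_finite_induct) (auto intro: int_trig_0 int_trig_add)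

lemma int_trig_scale: "int_trig k f \<Longrightarrow> int_trig k (\<lambda>t. f (\<lambda>l. of_int m * t l))"
  by (induction rule: int_trig.induct) (auto simp: chi_scale intro: int_trig.intros)

lemma int_trig_measurable: "int_trig k f \<Longrightarrow> f \<in> borel_measurable (torus k)"
  by (induction rule: int_trig.induct) auto

lemma int_trig_integrable: "int_trig k f \<Longrightarrow> integrable (torus k) f"
  by (induction rule: int_trig.induct) auto

lemma int_trig_integral_Ints: "int_trig k f \<Longrightarrow> (\<integral>t. f t \<partial>torus k) \<in> \<int>"
  by (induction rule: int_trig.induct) (auto simp: integral_chi int_trig_integrable)

text \<open>On characters the scaling multiplies the exponent by \<open>m \<noteq> 0\<close>, so it
  neither creates nor destroys a trivial character, and only trivial characters have nonzero
  mean.\<close>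

lemma int_trig_integral_scale:
  "int_trig k f \<Longrightarrow> m \<noteq> 0 \<Longrightarrow> (\<integral>t. f (\<lambda>l. of_int m * t l) \<partial>torus k) = (\<integral>t. f t \<partial>torus k)"
proof (induction rule: int_trig.induct)
  case (int_trig_add f g)
  then show ?case by (simp add: int_trig_integrable int_trig_scale)
qed (auto simp: chi_scale integral_chi)

definition int_trig_fps :: "nat \<Rightarrow> ((nat \<Rightarrow> real) \<Rightarrow> complex fps) \<Rightarrow> bool" where
  "int_trig_fps k F \<longleftrightarrow> (\<forall>j. int_trig k (\<lambda>t. fps_nth (F t) j))"

lemma int_trig_fps_add: "int_trig_fps k F \<Longrightarrow> int_trig_fps k G \<Longrightarrow> int_trig_fps k (\<lambda>t. F t + G t)"
  by (simp add: int_trig_fps_def int_trig_add)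

lemma int_trig_fps_mult: "int_trig_fps k F \<Longrightarrow> int_trig_fps k G \<Longrightarrow> int_trig_fps k (\<lambda>t. F t * G t)"
  by (simp add: int_trig_fps_def fps_mult_nth int_trig_sum int_trig_mult)

lemma int_trig_fps_1: "int_trig_fps k (\<lambda>t. 1)"
  by (simp add: int_trig_fps_def fps_one_nth int_trig_0 int_trig_1)

lemma int_trig_fps_of_nat: "int_trig_fps k (\<lambda>t. of_nat c)"
  by (simp add: int_trig_fps_def fps_of_nat[symmetric] int_trig_0 int_trig_of_nat)

lemma int_trig_fps_power: "int_trig_fps k F \<Longrightarrow> int_trig_fps k (\<lambda>t. F t ^ m)"
  by (induction m) (auto intro: int_trig_fps_1 int_trig_fps_mult)

lemma int_trig_fps_sum: "(\<And>i. i \<in> A \<Longrightarrow> int_trig_fps k (F i)) \<Longrightarrow> int_trig_fps k (\<lambda>t. \<Sum>i\<in>A. F i t)"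
  by (simp add: int_trig_fps_def fps_sum_nth int_trig_sum)

lemma int_trig_fps_monom: "int_trig_fps k (\<lambda>t. fps_const (of_int c * chi k u t) * fps_X ^ N)"
  by (auto simp: int_trig_fps_def int_trig_0 int_trig_chi)

text \<open>A congruence modulo \<open>p\<close> with its quotient \<open>H\<close> made explicit.
  Over the complex numbers everything is divisible by \<open>p\<close>, so the content lies in
  \<open>H\<close> having integer trigonometric coefficients.\<close>

definition frob_cong :: "nat \<Rightarrow> nat \<Rightarrow> ((nat \<Rightarrow> real) \<Rightarrow> complex fps) \<Rightarrow> ((nat \<Rightarrow> real) \<Rightarrow> complex fps) \<Rightarrow> bool" where
  "frob_cong k p F G \<longleftrightarrow> (\<exists>H. int_trig_fps k H \<and> (\<forall>t. F t ^ p = G t + of_nat p * H t))"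

text \<open>The middle binomial coefficients are multiples of \<open>p\<close>, and integrality of
  \<open>F1\<close> and \<open>F2\<close> makes the cross terms, divided by \<open>p\<close>, an
  admissible part of the quotient.\<close>

lemma frob_cong_add:
  assumes p: "prime p" and F: "int_trig_fps k F1" "int_trig_fps k F2"
    and c: "frob_cong k p F1 G1" "frob_cong k p F2 G2"
  shows "frob_cong k p (\<lambda>t. F1 t + F2 t) (\<lambda>t. G1 t + G2 t)"
proof -
  obtain H1 H2 where H: "int_trig_fps k H1" "int_trig_fps k H2"
    and e: "\<And>t. F1 t ^ p = G1 t + of_nat p * H1 t" "\<And>t. F2 t ^ p = G2 t + of_nat p * H2 t"
    using c unfolding frob_cong_def by blast
  have p0: "p > 0" using p by (rule prime_gt_0_nat)
  define q where "q j = (p choose j) div p" for j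
  have q: "p choose j = p * q j" if "0 < j" "j < p" for j
    unfolding q_def using dvd_choose_prime[of j p] that p by simp
  define H where "H t = H1 t + H2 t + (\<Sum>j\<in>{1..<p}. of_nat (q j) * F1 t ^ j * F2 t ^ (p - j))" for t
  have "int_trig_fps k H"
    unfolding H_def[abs_def]
    by (intro int_trig_fps_add int_trig_fps_sum int_trig_fps_mult int_trig_fps_power int_trig_fps_of_nat H F)
  moreover have "(F1 t + F2 t) ^ p = G1 t + G2 t + of_nat p * H t" for t
  proof -
    have set: "{..p} = insert 0 (insert p {1..<p})" using p0 by auto
    have "(F1 t + F2 t) ^ p = (\<Sum>j\<le>p. of_nat (p choose j) * F1 t ^ j * F2 t ^ (p - j))"
      by (rule binomial_ring)
    also have "\<dots> = F2 t ^ p + F1 t ^ p + (\<Sum>j\<in>{1..<p}. of_nat (p choose j) * F1 t ^ j * F2 t ^ (p - j))"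
      unfolding set using p0 by (subst sum.insert; auto)
    also have "(\<Sum>j\<in>{1..<p}. of_nat (p choose j) * F1 t ^ j * F2 t ^ (p - j)) =
        of_nat p * (\<Sum>j\<in>{1..<p}. of_nat (q j) * F1 t ^ j * F2 t ^ (p - j))"
      unfolding sum_distrib_left by (intro sum.cong refl) (simp add: q mult_ac)
    finally show ?thesis by (simp add: e H_def algebra_simps)
  qed
  ultimately show ?thesis unfolding frob_cong_def by blast
qed

text \<open>Fermat's little theorem: induction over the natural numbers with the binomial expansion
  of \<open>(a + 1) ^ p\<close>, after reducing \<open>c\<close> modulo \<open>p\<close>.\<close>

lemma prime_dvd_power_diff:
  fixes c :: int
  assumes p: "prime p"
  shows "int p dvd c ^ p - c"
proof -
  have p0: "p > 0" using p by (rule prime_gt_0_nat)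
  have nat: "int p dvd int a ^ p - int a" for a
  proof (induction a)
    case 0
    then show ?case using p0 by (simp add: zero_power)
  next
    case (Suc a)
    have set: "{..p} = insert 0 (insert p {1..<p})" using p0 by auto
    have "int (Suc a) ^ p = (\<Sum>j\<le>p. of_nat (p choose j) * int a ^ j * 1 ^ (p - j))"
      using binomial_ring[of "int a" 1 p] by (simp add: add.commute)
    also have "\<dots> = 1 + int a ^ p + (\<Sum>j\<in>{1..<p}. int (p choose j) * int a ^ j)"
      unfolding set using p0 by (subst sum.insert; auto)
    finally have "int (Suc a) ^ p - int (Suc a) =
        (int a ^ p - int a) + (\<Sum>j\<in>{1..<p}. int (p choose j) * int a ^ j)" by simp
    moreover have "int p dvd (\<Sum>j\<in>{1..<p}. int (p choose j) * int a ^ j)"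
      using p0 p by (intro dvd_sum dvd_mult2) (auto intro!: dvd_choose_prime)
    ultimately show ?case using Suc by (metis dvd_add)
  qed
  define a where "a = nat (c mod int p)"
  have a: "int a = c mod int p" using p0 by (simp add: a_def)
  have "c ^ p mod int p = int a ^ p mod int p" unfolding a by (simp add: power_mod)
  then have "int p dvd c ^ p - int a ^ p" by (simp only: mod_eq_dvd_iff)
  moreover have "int p dvd int a - c" unfolding a by (simp add: mod_eq_dvd_iff[symmetric])
  moreover have "c ^ p - c = (c ^ p - int a ^ p) + (int a ^ p - int a) + (int a - c)" by simp
  ultimately show ?thesis using nat[of a] by (metis dvd_add)
qed

text \<open>The \<open>p\<close>-th power of a character at \<open>t\<close> is exactly the
  character at \<open>p t\<close>; the multiple of \<open>p\<close> comes from the integer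
  coefficient alone, by Fermat.\<close>

lemma frob_cong_monom:
  assumes p: "prime p"
  shows "frob_cong k p (\<lambda>t. fps_const (of_int c * chi k u t) * fps_X ^ N)
           (\<lambda>t. fps_const (of_int c * chi k u (\<lambda>l. of_int (int p) * t l)) * fps_X ^ (p * N))"
proof -
  obtain b where b: "c ^ p = c + int p * b"
    using prime_dvd_power_diff[OF p, of c] by (metis dvdE diff_add_cancel add.commute)
  show ?thesis
    unfolding frob_cong_def
  proof (intro exI conjI allI)
    let ?H = "\<lambda>t. fps_const (of_int b * chi k (\<lambda>l. int p * u l) t) * fps_X ^ (p * N)"
    show "int_trig_fps k ?H" by (rule int_trig_fps_monom)
    fix t
    have "(of_int c * chi k u t) ^ p = of_int (c ^ p) * chi k (\<lambda>l. int p * u l) t"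
      by (simp add: power_mult_distrib chi_power)
    also have "\<dots> = of_int c * chi k (\<lambda>l. int p * u l) t + of_nat p * (of_int b * chi k (\<lambda>l. int p * u l) t)"
      unfolding b by (simp add: algebra_simps)
    finally show "(fps_const (of_int c * chi k u t) * fps_X ^ N) ^ p =
        fps_const (of_int c * chi k u (\<lambda>l. of_int (int p) * t l)) * fps_X ^ (p * N) + of_nat p * ?H t"
      by (simp only: power_mult_distrib fps_const_power chi_scale power_mult[symmetric] mult.commute[of N p])
         (simp add: distrib_right fps_const_mult[symmetric] fps_const_add[symmetric] fps_of_nat mult.assoc
            del: fps_const_mult fps_const_add)
  qed
qed

lemma frob_cong_poly:
  fixes n :: nat
  assumes p: "prime p"
  shows "frob_cong k p (\<lambda>t. \<Sum>i<n. fps_const (of_int (c i) * chi k (v i) t) * fps_X ^ N i)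
           (\<lambda>t. \<Sum>i<n. fps_const (of_int (c i) * chi k (v i) (\<lambda>l. of_int (int p) * t l)) * fps_X ^ (p * N i))"
proof (induction n)
  case 0
  have "int_trig_fps k (\<lambda>t. 0)" by (simp add: int_trig_fps_def int_trig_0)
  then show ?case using prime_gt_0_nat[OF p]
    unfolding frob_cong_def by (intro exI[of _ "\<lambda>_. 0"]) auto
next
  case (Suc n)
  then show ?case unfolding sum.lessThan_Suc
    by (intro frob_cong_add p frob_cong_monom int_trig_fps_sum int_trig_fps_monom)
qed

lemma fps_compose_X_power_nth:
  fixes a :: "'a :: idom fps"
  assumes "p > 0"
  shows "fps_nth (a oo fps_X ^ p) j = (if p dvd j then fps_nth a (j div p) else 0)"
proof -
  have "fps_nth (a oo fps_X ^ p) j = (\<Sum>i=0..j. if j = p * i then fps_nth a i else 0)"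
    by (simp add: fps_compose_nth flip: power_mult) (intro sum.cong, auto)
  also have "\<dots> = (\<Sum>i\<in>{i\<in>{0..j}. j = p * i}. fps_nth a i)"
    by (rule sum.inter_filter[symmetric]) simp
  also have "\<dots> = (if p dvd j then fps_nth a (j div p) else 0)"
  proof (cases "p dvd j")
    case True
    then have "{i\<in>{0..j}. j = p * i} = {j div p}" using assms by (auto elim!: dvdE)
    with True show ?thesis by simp
  next
    case False
    then have "{i\<in>{0..j}. j = p * i} = {}" by auto
    with False show ?thesis by (simp only: sum.empty if_False)
  qed
  finally show ?thesis .
qed

text \<open>By Frobenius, \<open>F(t, X)\<^sup>p\<close> agrees with \<open>G(t, X) = F(pt, X\<^sup>p)\<close> modulo \<open>p\<close>; since \<open>S\<close> is the
  logarithmic derivative \<open>-X F' / F\<close>, comparing the logarithmic derivatives of both sides gives the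
  congruence of its coefficients.\<close>

lemma power_sum_congruence:
  fixes F S :: "(nat \<Rightarrow> real) \<Rightarrow> complex fps"
  assumes p: "prime p" and F: "int_trig_fps k F" and F0: "\<And>t. fps_nth (F t) 0 = 1"
    and S: "int_trig_fps k S" and FS: "\<And>t. F t * S t = - fps_X * fps_deriv (F t)"
    and fc: "frob_cong k p F (\<lambda>t. F (\<lambda>l. of_int (int p) * t l) oo fps_X ^ p)"
  shows "\<exists>Y. int_trig k Y \<and>
    (\<forall>t. fps_nth (S t) (p * m) - fps_nth (S (\<lambda>l. of_int (int p) * t l)) m = of_nat p * Y t)"
proof -
  have p0: "p > 0" using p by (rule prime_gt_0_nat)
  define pt :: "(nat \<Rightarrow> real) \<Rightarrow> nat \<Rightarrow> real" where "pt t l = of_int (int p) * t l" for t l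
  have pt: "(\<lambda>l. of_int (int p) * t l) = pt t" for t by (simp add: pt_def fun_eq_iff)
  define G where "G t = F (pt t) oo fps_X ^ p" for t
  define S' where "S' t = S (pt t) oo fps_X ^ p" for t
  obtain H where H: "int_trig_fps k H" and FH: "\<And>t. F t ^ p = G t + of_nat p * H t"
    using fc unfolding frob_cong_def G_def pt by blast
  have Xp0: "fps_nth (fps_X ^ p :: complex fps) 0 = 0" using p0 by simp
  \<comment> \<open>Chain rule for the substitution of \<open>X^p\<close>, whose inner derivative
    contributes the factor \<open>p\<close>.\<close>
  have GS: "of_nat p * (G t * S' t) = - fps_X * fps_deriv (G t)" for t
  proof (rule fps_ext)
    fix j
    have "G t * S' t = (F (pt t) * S (pt t)) oo fps_X ^ p"
      unfolding G_def S'_def by (rule fps_compose_mult_distrib[OF Xp0, symmetric])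
    also have "\<dots> = (- fps_X * fps_deriv (F (pt t))) oo fps_X ^ p" by (simp add: FS)
    finally have e: "G t * S' t = \<dots>" .
    have nth: "fps_nth (- fps_X * fps_deriv A) j = - of_nat j * fps_nth A j" for A :: "complex fps" and j
      by (cases j) (auto simp: algebra_simps)
    show "fps_nth (of_nat p * (G t * S' t)) j = fps_nth (- fps_X * fps_deriv (G t)) j"
      unfolding nth e unfolding G_def
      by (auto simp: fps_of_nat[symmetric] fps_compose_X_power_nth[OF p0] nth elim!: dvdE simp del: fps_of_nat)
         (use p0 in auto)
  qed
  \<comment> \<open>The logarithmic derivative of \<open>F^p = G + p H\<close>, with one factor
    \<open>p\<close> cancelled.\<close>
  have key: "G t * (S t - S' t) = - fps_X * fps_deriv (H t) - of_nat p * (H t * S t)" for t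
  proof -
    have "of_nat p * (F t ^ p * S t) = of_nat p * F t ^ (p - 1) * (F t * S t)"
      using p0 by (simp add: mult_ac power_minus_mult[symmetric, OF p0] del: power_minus_mult)
    also have "\<dots> = - fps_X * fps_deriv (F t ^ p)"
      unfolding FS by (simp add: fps_deriv_power' mult_ac)
    also have "\<dots> = of_nat p * (G t * S' t) + of_nat p * (- fps_X * fps_deriv (H t))"
      unfolding FH GS by (simp add: algebra_simps)
    finally have "of_nat p * ((G t + of_nat p * H t) * S t) = of_nat p * (G t * S' t - fps_X * fps_deriv (H t))"
      unfolding FH by (simp add: algebra_simps)
    then have "(G t + of_nat p * H t) * S t = G t * S' t - fps_X * fps_deriv (H t)"
      using p0 by (subst (asm) mult_cancel_left) auto
    then show ?thesis by (simp add: algebra_simps)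
  qed
  define W where "W t = S t - S' t" for t
  \<comment> \<open>In \<open>key\<close> the term \<open>- X H'\<close> need not be divisible by
    \<open>p\<close>, but at index \<open>p * m\<close> its coefficient carries the factor
    \<open>p * m\<close>. Since \<open>G\<close> is a series in \<open>X^p\<close> with constant
    coefficient 1, the recursion for the coefficients of \<open>W\<close> stays within the multiples
    of \<open>p\<close>.\<close>
  have "\<exists>Y. int_trig k Y \<and> (\<forall>t. fps_nth (W t) (p * m) = of_nat p * Y t)"
  proof (induction m rule: less_induct)
    case (less m)
    then obtain Y where Y: "\<And>l. l < m \<Longrightarrow> int_trig k (Y l)"
      and WY: "\<And>l t. l < m \<Longrightarrow> fps_nth (W t) (p * l) = of_nat p * Y l t"
      by metis
    define Z where "Z t = - of_nat m * fps_nth (H t) (p * m) - fps_nth (H t * S t) (p * m)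
        - (\<Sum>l\<in>{1..m}. fps_nth (F (pt t)) l * Y (m - l) t)" for t
    have "int_trig k Z"
    proof -
      have "int_trig k (\<lambda>t. of_int (- int m) * fps_nth (H t) (p * m))"
        using H unfolding int_trig_fps_def by (intro int_trig_mult int_trig_const) auto
      moreover have "int_trig k (\<lambda>t. fps_nth (H t * S t) (p * m))"
        using int_trig_fps_mult[OF H S] unfolding int_trig_fps_def by blast
      moreover have "int_trig k (\<lambda>t. \<Sum>l\<in>{1..m}. fps_nth (F (pt t)) l * Y (m - l) t)"
      proof (intro int_trig_sum int_trig_mult)
        fix l assume "l \<in> {1..m}"
        then show "int_trig k (Y (m - l))" by (intro Y) auto
        have "int_trig k (\<lambda>t. fps_nth (F t) l)" using F unfolding int_trig_fps_def by blast
        from int_trig_scale[OF this, of "int p"] show "int_trig k (\<lambda>t. fps_nth (F (pt t)) l)"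
          by (simp only: pt)
      qed
      ultimately have "int_trig k (\<lambda>t. of_int (- int m) * fps_nth (H t) (p * m) - fps_nth (H t * S t) (p * m)
        - (\<Sum>l\<in>{1..m}. fps_nth (F (pt t)) l * Y (m - l) t))" by (intro int_trig_diff)
      then show ?thesis by (simp add: Z_def[abs_def])
    qed
    moreover have "fps_nth (W t) (p * m) = of_nat p * Z t" for t
    proof -
      have "fps_nth (G t * W t) (p * m) = (\<Sum>i\<in>{0..p*m}. fps_nth (G t) i * fps_nth (W t) (p * m - i))"
        by (simp add: fps_mult_nth)
      also have "\<dots> = (\<Sum>i\<in>(\<lambda>l. p * l) ` {0..m}. fps_nth (G t) i * fps_nth (W t) (p * m - i))"
        using p0 by (intro sum.mono_neutral_right)
          (auto simp: G_def fps_compose_X_power_nth[OF p0] image_iff elim!: dvdE)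
      also have "\<dots> = (\<Sum>l\<in>{0..m}. fps_nth (F (pt t)) l * fps_nth (W t) (p * (m - l)))"
        using p0 by (subst sum.reindex)
          (auto simp: inj_on_def G_def fps_compose_X_power_nth[OF p0] diff_mult_distrib2 intro!: sum.cong)
      also have "\<dots> = fps_nth (W t) (p * m) + (\<Sum>l\<in>{1..m}. fps_nth (F (pt t)) l * fps_nth (W t) (p * (m - l)))"
        by (subst sum.atLeast_Suc_atMost) (auto simp: F0)
      also have "(\<Sum>l\<in>{1..m}. fps_nth (F (pt t)) l * fps_nth (W t) (p * (m - l))) =
          of_nat p * (\<Sum>l\<in>{1..m}. fps_nth (F (pt t)) l * Y (m - l) t)"
        unfolding sum_distrib_left by (intro sum.cong refl) (auto simp: WY)
      finally have 1: "fps_nth (G t * W t) (p * m) = fps_nth (W t) (p * m) +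
          of_nat p * (\<Sum>l\<in>{1..m}. fps_nth (F (pt t)) l * Y (m - l) t)" .
      have nth: "fps_nth (- fps_X * fps_deriv A) j = - of_nat j * fps_nth A j" for A :: "complex fps" and j
        by (cases j) (auto simp: algebra_simps)
      have "fps_nth (G t * W t) (p * m) = - of_nat (p * m) * fps_nth (H t) (p * m) - of_nat p * fps_nth (H t * S t) (p * m)"
        unfolding W_def key fps_sub_nth nth by (simp add: fps_of_nat[symmetric] del: fps_of_nat)
      with 1 show ?thesis unfolding Z_def by (simp add: algebra_simps)
    qed
    ultimately show ?case by blast
  qed
  moreover have "fps_nth (W t) (p * m) = fps_nth (S t) (p * m) - fps_nth (S (pt t)) m" for t
    using p0 by (simp add: W_def S'_def fps_compose_X_power_nth[OF p0])
  ultimately show ?thesis unfolding pt by simp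
qed

text \<open>The \<open>N i\<close> are exponents of an auxiliary variable \<open>s\<close>. At
  \<open>s = 1\<close> the polynomial is \<open>tpoly\<close>, which is thus the product of the
  factors \<open>1 - \<alpha> i\<close> over reciprocal zeros of modulus at most 1. What has to be
  shown is that all their power sums have mean 0.\<close>

lemma logint_eq_0_of_no_zeros:
  fixes c :: "nat \<Rightarrow> int" and v :: "nat \<Rightarrow> nat \<Rightarrow> int" and N :: "nat \<Rightarrow> nat"
  assumes \<tau>: "\<tau> < n" "c \<tau> = 1" "N \<tau> = 0" "\<And>l. v \<tau> l = 0"
    and N: "\<And>i. i < n \<Longrightarrow> i \<noteq> \<tau> \<Longrightarrow> N i \<ge> 1"
    and c: "\<And>i. i < n \<Longrightarrow> c i \<noteq> 0" and sep: "separated k n v"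
    and nz: "\<And>t s. norm s < 1 \<Longrightarrow> (\<Sum>i<n. of_int (c i) * chi k (v i) t * s ^ N i) \<noteq> 0"
  shows "logint k n (\<lambda>i. of_int (c i)) v = 0"
proof -
  have n1: "n \<ge> 1" using \<tau> by simp
  define f where "f t = (\<Sum>i<n. monom (of_int (c i) * chi k (v i) t) (N i))" for t
  define d where "d = (\<Sum>i<n. N i)"
  have pf: "poly (f t) s = (\<Sum>i<n. of_int (c i) * chi k (v i) t * s ^ N i)" for t s
    by (simp add: f_def poly_sum poly_monom)
  have f0: "coeff (f t) 0 = 1" for t
  proof -
    have "coeff (f t) 0 = (\<Sum>i<n. if i = \<tau> then 1 else 0)"
      unfolding f_def coeff_sum
    proof (intro sum.cong refl)
      fix i assume "i \<in> {..<n}"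
      then show "coeff (monom (of_int (c i) * chi k (v i) t) (N i)) 0 = (if i = \<tau> then 1 else 0)"
        using N[of i] \<tau> by (auto simp: chi_def)
    qed
    then show ?thesis using \<tau> by simp
  qed
  have fd: "degree (f t) \<le> d" for t
    unfolding f_def
  proof (rule degree_sum_le)
    fix i assume "i \<in> {..<n}"
    have "degree (monom (of_int (c i) * chi k (v i) t) (N i)) \<le> N i" by (rule degree_monom_le)
    also have "N i \<le> d" unfolding d_def using \<open>i \<in> _\<close> by (intro member_le_sum) auto
    finally show "degree (monom (of_int (c i) * chi k (v i) t) (N i)) \<le> d" .
  qed simp
  have "\<forall>t. \<exists>\<alpha>. f t = (\<Prod>i<d. [:1, - \<alpha> i:])"
    using poly_eq_prod_reciprocal_roots[OF f0 fd] by blast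
  then obtain \<alpha>0 where \<alpha>0: "\<And>t. f t = (\<Prod>i<d. [:1, - \<alpha>0 t i:])" by metis
  \<comment> \<open>Set to 0 from index \<open>d\<close> on because the bound \<open>le\<close> is
    later required for every index.\<close>
  define \<alpha> where "\<alpha> t i = (if i < d then \<alpha>0 t i else 0)" for t i
  have f\<alpha>: "f t = (\<Prod>i<d. [:1, - \<alpha> t i:])" for t
    unfolding \<alpha>0[of t] by (intro prod.cong) (auto simp: \<alpha>_def)
  have pf\<alpha>: "poly (f t) s = (\<Prod>i<d. 1 - \<alpha> t i * s)" for t s
    unfolding f\<alpha> by (simp add: poly_prod mult.commute)
  have root: "\<alpha> t i \<noteq> 0 \<Longrightarrow> poly (f t) (1 / \<alpha> t i) = 0" for t i
    unfolding pf\<alpha> by (rule prod_zero) (auto simp: \<alpha>_def split: if_splits intro!: bexI[of _ i])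
  have le: "norm (\<alpha> t i) \<le> 1" for t i
  proof (rule ccontr)
    assume "\<not> norm (\<alpha> t i) \<le> 1"
    then have "norm (\<alpha> t i) > 1" by simp
    then have "\<alpha> t i \<noteq> 0" "norm (1 / \<alpha> t i) < 1"
      unfolding norm_divide by (auto simp: divide_less_eq)
    then show False using root[of t i] nz[of "1 / \<alpha> t i" t] unfolding pf by blast
  qed
  define F where "F t = fps_of_poly (f t)" for t
  define S where "S t = power_sums d (\<alpha> t)" for t
  have Feq: "F t = (\<Sum>i<n. fps_const (of_int (c i) * chi k (v i) t) * fps_X ^ N i)" for t
    by (simp add: F_def f_def fps_of_poly_sum fps_of_poly_monom)
  have F\<alpha>: "F t = (\<Prod>i<d. 1 - fps_const (\<alpha> t i) * fps_X)" for t
    unfolding F_def f\<alpha> fps_of_poly_prod fps_of_poly_linear'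
    by (simp flip: fps_const_neg)
  have F0: "fps_nth (F t) 0 = 1" for t by (simp add: F_def f0)
  have Fint: "int_trig_fps k F"
    unfolding Feq[abs_def] by (intro int_trig_fps_sum int_trig_fps_monom)
  have FS: "F t * S t = - fps_X * fps_deriv (F t)" for t
    unfolding F\<alpha> S_def by (rule newton_power_sums)
  have S0: "fps_nth (S t) 0 = 0" for t by (simp add: S_def power_sums_def)
  have Sm: "fps_nth (S t) m = (\<Sum>i<d. \<alpha> t i ^ m)" if "m \<ge> 1" for t m
    unfolding S_def using that by (rule power_sums_nth)
  \<comment> \<open>Newton's identities: as the constant coefficient of \<open>F t\<close> is 1, the
    recursion involves no division and integrality is preserved.\<close>
  have Sint: "int_trig k (\<lambda>t. fps_nth (S t) m)" for m
  proof (induction m rule: less_induct)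
    case (less m)
    have "fps_nth (S t) m = of_int (- int m) * fps_nth (F t) m - (\<Sum>j\<in>{1..m}. fps_nth (F t) j * fps_nth (S t) (m - j))" for t
    proof -
      have "fps_nth (F t * S t) m = (\<Sum>j\<in>{0..m}. fps_nth (F t) j * fps_nth (S t) (m - j))"
        by (simp add: fps_mult_nth)
      also have "\<dots> = fps_nth (S t) m + (\<Sum>j\<in>{1..m}. fps_nth (F t) j * fps_nth (S t) (m - j))"
        by (subst sum.atLeast_Suc_atMost) (auto simp: F0)
      finally have "fps_nth (S t) m + (\<Sum>j\<in>{1..m}. fps_nth (F t) j * fps_nth (S t) (m - j)) =
          fps_nth (- fps_X * fps_deriv (F t)) m" by (simp only: FS)
      also have "\<dots> = of_int (- int m) * fps_nth (F t) m" by (cases m) (auto simp: algebra_simps)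
      finally show ?thesis by (simp add: algebra_simps)
    qed
    moreover have "int_trig k (\<lambda>t. of_int (- int m) * fps_nth (F t) m - (\<Sum>j\<in>{1..m}. fps_nth (F t) j * fps_nth (S t) (m - j)))"
      using Fint less unfolding int_trig_fps_def
      by (intro int_trig_diff int_trig_mult int_trig_const int_trig_sum) auto
    ultimately show ?case by simp
  qed
  then have Sint': "int_trig_fps k S" by (simp add: int_trig_fps_def)
  define e where "e m = (\<integral>t. fps_nth (S t) m \<partial>torus k)" for m
  have Sb: "norm (fps_nth (S t) m) \<le> real d" for t m
  proof (cases "m \<ge> 1")
    case True
    have "norm (\<Sum>i<d. \<alpha> t i ^ m) \<le> (\<Sum>i<d. 1)"
      by (rule sum_norm_le) (simp add: norm_power power_le_one le)
    with True show ?thesis by (simp add: Sm)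
  next
    case False then have "m = 0" by simp
    then show ?thesis by (simp add: S0)
  qed
  have eb: "norm (e m) \<le> real d" for m
  proof -
    have "norm (e m) \<le> (\<integral>t. norm (fps_nth (S t) m) \<partial>torus k)"
      unfolding e_def by (rule integral_norm_bound)
    also have "\<dots> \<le> (\<integral>t. real d \<partial>torus k)"
      by (intro integral_mono integrable_norm int_trig_integrable Sint Sb) auto
    finally show ?thesis by (simp add: torus.prob_space)
  qed
  have ep: "e (p * m) = e m" if p: "prime p" "p > 2 * d" for p m
  proof -
    have "frob_cong k p F (\<lambda>t. F (\<lambda>l. of_int (int p) * t l) oo fps_X ^ p)"
    proof -
      have comp: "F (\<lambda>l. of_int (int p) * t l) oo fps_X ^ p =
          (\<Sum>i<n. fps_const (of_int (c i) * chi k (v i) (\<lambda>l. of_int (int p) * t l)) * fps_X ^ (p * N i))" for t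
        unfolding Feq using prime_gt_0_nat[OF p(1)]
        by (intro fps_ext) (auto simp: fps_compose_X_power_nth fps_sum_nth elim!: dvdE intro!: sum.cong sum.neutral)
      have "F = (\<lambda>t. \<Sum>i<n. fps_const (of_int (c i) * chi k (v i) t) * fps_X ^ N i)"
        by (rule ext) (rule Feq)
      then show ?thesis unfolding comp by (simp only:) (rule frob_cong_poly[OF p(1)])
    qed
    from power_sum_congruence[OF p(1) Fint F0 Sint' FS this, of m]
    obtain Y where Y: "int_trig k Y"
      and SY: "\<And>t. fps_nth (S t) (p * m) - fps_nth (S (\<lambda>l. of_int (int p) * t l)) m = of_nat p * Y t" by blast
    obtain z where z: "(\<integral>t. Y t \<partial>torus k) = of_int z"
      using int_trig_integral_Ints[OF Y] by (elim Ints_cases)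
    \<comment> \<open>The scaling of \<open>t\<close> by \<open>p\<close> leaves means unchanged, so
      the pointwise congruence becomes one between \<open>e (p * m)\<close> and
      \<open>e m\<close>.\<close>
    have "e (p * m) - e m = (\<integral>t. fps_nth (S t) (p * m) - fps_nth (S (\<lambda>l. of_int (int p) * t l)) m \<partial>torus k)"
      using int_trig_integral_scale[OF Sint[of m], of "int p"] prime_gt_0_nat[OF p(1)]
        int_trig_integrable[OF Sint] int_trig_integrable[OF int_trig_scale[OF Sint[of m], of "int p"]]
      by (simp add: e_def)
    also have "\<dots> = of_nat p * of_int z" unfolding SY integral_mult_right_zero z ..
    finally have ez: "e (p * m) - e m = of_nat p * of_int z" .
    have "z = 0"
    proof (rule ccontr)
      assume "z \<noteq> 0"
      then have "1 \<le> \<bar>real_of_int z\<bar>" by linarith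
      then have "real p * 1 \<le> real p * \<bar>real_of_int z\<bar>" by (intro mult_left_mono) auto
      also have "\<dots> = norm (e (p * m) - e m)" unfolding ez by (simp add: norm_mult)
      also have "\<dots> \<le> norm (e (p * m)) + norm (e m)" by (rule norm_triangle_ineq4)
      also have "\<dots> \<le> real d + real d" by (intro add_mono eb)
      finally show False using p(2) by linarith
    qed
    with ez show ?thesis by simp
  qed
  have ej: "e (j * s) = e s" if "j > 0" "\<And>p. prime p \<Longrightarrow> p dvd j \<Longrightarrow> p > 2 * d" for j s
    using that
  proof (induction j rule: less_induct)
    case (less j)
    show ?case
    proof (cases "j = 1")
      case False
      then obtain p where p: "prime p" "p dvd j" using prime_factor_nat by blast
      then obtain j' where j': "j = p * j'" by (auto elim: dvdE)
      have "j' > 0" "j' < j" using less.prems(1) prime_gt_1_nat[OF p(1)] by (auto simp: j')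
      moreover have "q > 2 * d" if "prime q" "q dvd j'" for q
        using less.prems(2)[of q] that by (simp add: j')
      ultimately have "e (j' * s) = e s" using less.IH by blast
      moreover have "e (j * s) = e (j' * s)"
        using ep[OF p(1) less.prems(2)[OF p], of "j' * s"] by (simp add: j' mult_ac)
      ultimately show ?thesis by simp
    qed simp
  qed
  \<comment> \<open>The powers of \<open>z\<close> are absorbed into the coefficients, whose moduli
    stay at least 1, so the zero set is null by the small-ball estimate.\<close>
  have nzae: "AE t in torus k. poly (f t) z \<noteq> 0" if "norm z = 1" for z
  proof -
    have "AE t in torus k. tpoly k n (\<lambda>i. of_int (c i) * z ^ N i) v t \<noteq> 0"
    proof (rule integrable_ln_tpoly(2)[OF n1 _ sep])
      fix i assume "i < n"
      then have "\<bar>c i\<bar> \<ge> 1" using c[of i] by simp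
      then have "1 \<le> \<bar>real_of_int (c i)\<bar>" by linarith
      then show "1 \<le> norm (of_int (c i) * z ^ N i)" using that by (simp add: norm_mult norm_power)
    qed
    then show ?thesis by (simp add: pf tpoly_def mult_ac)
  qed
  have e0: "e s = 0" if s: "s \<ge> 1" for s
  proof -
    \<comment> \<open>Every prime factor of \<open>1 + Q * q\<close> exceeds \<open>2 * d\<close>.\<close>
    define Q :: nat where "Q = fact (2 * d)"
    have Q0: "Q > 0" by (simp add: Q_def)
    have eq: "e ((1 + Q * q) * s) = e s" for q
    proof (rule ej)
      fix p :: nat assume p: "prime p" "p dvd 1 + Q * q"
      show "p > 2 * d"
      proof (rule ccontr)
        assume "\<not> 2 * d < p"
        then have "p dvd Q" unfolding Q_def using prime_gt_0_nat[OF p(1)] by (intro dvd_fact) auto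
        then have "p dvd 1" using p(2) by (metis dvd_add_left_iff dvd_mult2)
        then show False using p(1) by simp
      qed
    qed simp
    define A where "A J t = (\<Sum>q<J. fps_nth (S t) ((1 + Q * q) * s)) / of_nat J" for J t
    have Ai: "int_trig k (\<lambda>t. \<Sum>q<J. fps_nth (S t) ((1 + Q * q) * s))" for J
      by (intro int_trig_sum Sint)
    have EA: "(\<integral>t. A J t \<partial>torus k) = e s" if "J \<ge> 1" for J
    proof -
      have "(\<integral>t. A J t \<partial>torus k) = (\<Sum>q<J. e ((1 + Q * q) * s)) / of_nat J"
        unfolding A_def e_def
        by (simp add: Bochner_Integration.integral_sum int_trig_integrable Sint)
      then show ?thesis using that unfolding eq by simp
    qed
    \<comment> \<open>This excludes \<open>\<alpha> t i ^ (Q * s) = 1\<close>, the one case in which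
      the averages of the powers of \<open>\<alpha> t i\<close> along the progression would not tend
      to 0. Only finitely many roots of unity are involved.\<close>
    have ae: "AE t in torus k. \<forall>z\<in>{z. z ^ (Q * s) = 1}. poly (f t) z \<noteq> 0"
    proof (rule AE_finite_allI)
      show "finite {z::complex. z ^ (Q * s) = 1}"
        using Q0 s by (intro finite_roots_unity) (simp add: Suc_leI)
      fix z :: complex assume z: "z \<in> {z. z ^ (Q * s) = 1}"
      then have "norm (z ^ (Q * s)) = 1" by simp
      then have "norm z ^ (Q * s) = 1" by (simp only: norm_power)
      then have "norm z = 1" using Q0 s power_eq_iff_eq_base[of "Q * s" "norm z" 1] by simp
      then show "AE t in torus k. poly (f t) z \<noteq> 0" by (rule nzae)
    qed
    have "(\<lambda>J. \<integral>t. A J t \<partial>torus k) \<longlonglongrightarrow> (\<integral>t. 0 \<partial>torus k)"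
    proof (rule integral_dominated_convergence[where w = "\<lambda>_. real d"])
      show "AE t in torus k. (\<lambda>J. A J t) \<longlonglongrightarrow> 0"
        using ae
      proof eventually_elim
        case (elim t)
        have ne: "\<alpha> t i ^ (Q * s) \<noteq> 1" for i
        proof
          assume a: "\<alpha> t i ^ (Q * s) = 1"
          have "0 < Q * s" using Q0 s by simp
          then have "\<alpha> t i \<noteq> 0" using a zero_power[of "Q * s", where 'a = complex] zero_neq_one[where 'a = complex] by metis
          moreover have "(1 / \<alpha> t i) ^ (Q * s) = 1" using a by (simp add: power_one_over)
          ultimately show False using root[of t i] elim by blast
        qed
        have "A J t = (\<Sum>i<d. \<alpha> t i ^ s * ((\<Sum>q<J. (\<alpha> t i ^ (Q * s)) ^ q) / of_nat J))" for J
        proof -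
          have "A J t = (\<Sum>q<J. \<Sum>i<d. \<alpha> t i ^ s * (\<alpha> t i ^ (Q * s)) ^ q) / of_nat J"
          proof -
            have "fps_nth (S t) ((1 + Q * q) * s) = (\<Sum>i<d. \<alpha> t i ^ s * (\<alpha> t i ^ (Q * s)) ^ q)" for q
            proof -
              have e: "(1 + Q * q) * s = s + (Q * s) * q" by (simp add: algebra_simps)
              show ?thesis
                unfolding e by (subst Sm, use s in linarith) (simp only: power_add power_mult)
            qed
            then show ?thesis by (simp only: A_def)
          qed
          also have "\<dots> = (\<Sum>i<d. \<Sum>q<J. \<alpha> t i ^ s * (\<alpha> t i ^ (Q * s)) ^ q) / of_nat J"
            by (subst sum.swap) (rule refl)
          finally show ?thesis by (simp add: sum_divide_distrib sum_distrib_left)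
        qed
        moreover have "(\<lambda>J. \<Sum>i<d. \<alpha> t i ^ s * ((\<Sum>q<J. (\<alpha> t i ^ (Q * s)) ^ q) / of_nat J))
            \<longlonglongrightarrow> (\<Sum>i<d. \<alpha> t i ^ s * 0)"
          by (intro tendsto_sum tendsto_mult tendsto_const cesaro_power_tendsto_0 ne)
             (simp add: norm_power power_le_one le)
        ultimately show ?case by simp
      qed
      fix J
      show "AE t in torus k. norm (A J t) \<le> real d"
      proof (intro AE_I2)
        fix t
        have "norm (\<Sum>q<J. fps_nth (S t) ((1 + Q * q) * s)) \<le> (\<Sum>q<J. real d)"
          by (rule sum_norm_le) (rule Sb)
        then show "norm (A J t) \<le> real d"
          by (cases "J = 0") (auto simp: A_def norm_divide field_simps)
      qed
      show "A J \<in> borel_measurable (torus k)"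
        unfolding A_def[abs_def] using int_trig_measurable[OF Ai[of J]] by (rule borel_measurable_divide) simp
    qed auto
    moreover have "eventually (\<lambda>J. (\<integral>t. A J t \<partial>torus k) = e s) sequentially"
      using eventually_ge_at_top[of 1] by eventually_elim (rule EA)
    ultimately have "(\<lambda>J::nat. e s) \<longlonglongrightarrow> 0"
      by (simp add: tendsto_cong)
    then show ?thesis by (simp add: LIMSEQ_const_iff)
  qed
  have tp: "tpoly k n (\<lambda>i. of_int (c i)) v t = (\<Prod>i<d. 1 - \<alpha> t i)" for t
    using pf\<alpha>[of t 1] pf[of t 1] by (simp add: tpoly_def)
  have c1: "1 \<le> norm (complex_of_int (c i))" if "i < n" for i
  proof -
    have "1 \<le> \<bar>c i\<bar>" using c[OF that] by simp
    then show ?thesis unfolding norm_of_int by linarith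
  qed
  show ?thesis
    unfolding logint_def tp
  proof (rule torus.integral_ln_prod_eq_0[OF le])
    fix m :: nat assume m: "m \<ge> 1"
    show "(\<lambda>t. \<Sum>i<d. \<alpha> t i ^ m) \<in> borel_measurable (torus k)"
      using int_trig_measurable[OF Sint[of m]] by (simp add: Sm[OF m])
    show "(\<integral>t. (\<Sum>i<d. \<alpha> t i ^ m) \<partial>torus k) = 0"
      using e0[OF m] by (simp add: e_def Sm[OF m])
  next
    show "integrable (torus k) (\<lambda>t. ln (norm (\<Prod>i<d. 1 - \<alpha> t i)))"
      using integrable_ln_tpoly(1)[where c = "\<lambda>i. of_int (c i)", OF n1 c1 sep] by (simp only: tp)
    show "AE t in torus k. (\<Prod>i<d. 1 - \<alpha> t i) \<noteq> 0"
      using integrable_ln_tpoly(2)[where c = "\<lambda>i. of_int (c i)", OF n1 c1 sep] by (simp only: tp)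
  qed
qed

subsection \<open>Polynomials of Mahler measure zero\<close>

abbreviation circle_pt :: "(nat \<Rightarrow> real) \<Rightarrow> complex" where
  "circle_pt \<equiv> chi 1 (\<lambda>_. 1)"

text \<open>All positive powers of \<open>a * chi 1 (\<lambda>_. u) t\<close> have mean 0, so the
  criterion for products applies with a single factor. Integrability comes from the small-ball
  estimate for two terms if \<open>|a| = 1\<close>, and from boundedness if \<open>|a| < 1\<close>.
  The frequency \<open>u = -1\<close> will serve the case \<open>|a| > 1\<close>.\<close>

lemma integral_ln_linear_inner:
  fixes a :: complex and u :: int
  assumes a: "norm a \<le> 1" and u: "u \<noteq> 0"
  shows "integrable (torus 1) (\<lambda>t. ln (norm (1 - a * chi 1 (\<lambda>_. u) t)))"
    and "AE t in torus 1. 1 - a * chi 1 (\<lambda>_. u) t \<noteq> 0"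
    and "(\<integral>t. ln (norm (1 - a * chi 1 (\<lambda>_. u) t)) \<partial>torus 1) = 0"
proof -
  have "integrable (torus 1) (\<lambda>t. ln (norm (1 - a * chi 1 (\<lambda>_. u) t))) \<and>
     (AE t in torus 1. 1 - a * chi 1 (\<lambda>_. u) t \<noteq> 0)"
  proof (cases "norm a = 1")
    case True
    define c where "c i = (if i = 0 then 1 else - a)" for i :: nat
    define v where "v i l = (if i = 0 then 0 else u)" for i l :: nat
    have "tpoly 1 2 c v t = 1 - a * chi 1 (\<lambda>_. u) t" for t
      by (simp add: tpoly_def c_def v_def numeral_2_eq_2 chi_def)
    moreover have "separated 1 2 v" using u by (auto simp: separated_def v_def less_2_cases_iff)
    moreover have "1 \<le> norm (c i)" for i using True by (simp add: c_def)
    ultimately show ?thesis using integrable_ln_tpoly[of 2 c 1 v] by simp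
  next
    case False
    with a have a1: "norm a < 1" by simp
    have lo: "1 - norm a \<le> norm (1 - a * chi 1 (\<lambda>_. u) t)" for t
      using norm_triangle_ineq2[of 1 "a * chi 1 (\<lambda>_. u) t"] by (simp add: norm_mult)
    have hi: "norm (1 - a * chi 1 (\<lambda>_. u) t) \<le> 2" for t
      using norm_triangle_ineq4[of 1 "a * chi 1 (\<lambda>_. u) t"] a by (simp add: norm_mult)
    have "integrable (torus 1) (\<lambda>t. ln (norm (1 - a * chi 1 (\<lambda>_. u) t)))"
    proof (rule integrable_torus_bounded[where B = "\<bar>ln (1 - norm a)\<bar> + ln 2"])
      fix t
      have "norm (1 - a * chi 1 (\<lambda>_. u) t) > 0" using lo[of t] a1 by linarith
      then have "ln (1 - norm a) \<le> ln (norm (1 - a * chi 1 (\<lambda>_. u) t))"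
        "ln (norm (1 - a * chi 1 (\<lambda>_. u) t)) \<le> ln 2"
        using lo[of t] hi[of t] a1 by (simp_all del: zero_less_norm_iff)
      then show "norm (ln (norm (1 - a * chi 1 (\<lambda>_. u) t))) \<le> \<bar>ln (1 - norm a)\<bar> + ln 2"
        unfolding real_norm_def using ln_ge_zero[of "2::real"] by linarith
    qed measurable
    moreover have "1 - a * chi 1 (\<lambda>_. u) t \<noteq> 0" for t
      using lo[of t] a1 by fastforce
    ultimately show ?thesis by simp
  qed
  then show int: "integrable (torus 1) (\<lambda>t. ln (norm (1 - a * chi 1 (\<lambda>_. u) t)))"
    and ae: "AE t in torus 1. 1 - a * chi 1 (\<lambda>_. u) t \<noteq> 0" by auto
  have "(\<integral>t. ln (norm (\<Prod>i<1::nat. 1 - a * chi 1 (\<lambda>_. u) t)) \<partial>torus 1) = 0"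
  proof (rule torus.integral_ln_prod_eq_0)
    fix m :: nat assume m: "m \<ge> 1"
    have "(\<integral>t. (\<Sum>i<1::nat. (a * chi 1 (\<lambda>_. u) t) ^ m) \<partial>torus 1) =
        (\<integral>t. a ^ m * chi 1 (\<lambda>_. int m * u) t \<partial>torus 1)"
      by (simp add: power_mult_distrib chi_power)
    also have "\<dots> = 0"
    proof -
      have "\<not> (\<forall>l<1::nat. int m * u = 0)" using m u by auto
      then show ?thesis by (simp only: integral_mult_right_zero integral_chi if_False) simp
    qed
    finally show "(\<integral>t. (\<Sum>i<1::nat. (a * chi 1 (\<lambda>_. u) t) ^ m) \<partial>torus 1) = 0" .
  qed (use int ae a in \<open>auto simp: norm_mult\<close>)
  then show "(\<integral>t. ln (norm (1 - a * chi 1 (\<lambda>_. u) t)) \<partial>torus 1) = 0" by simp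
qed

lemma integral_ln_linear:
  fixes a :: complex
  shows "integrable (torus 1) (\<lambda>t. ln (norm (1 - a * circle_pt t)))"
    and "AE t in torus 1. 1 - a * circle_pt t \<noteq> 0"
    and "(\<integral>t. ln (norm (1 - a * circle_pt t)) \<partial>torus 1) = max 0 (ln (norm a))"
proof -
  have "integrable (torus 1) (\<lambda>t. ln (norm (1 - a * circle_pt t))) \<and>
    (AE t in torus 1. 1 - a * circle_pt t \<noteq> 0) \<and>
    (\<integral>t. ln (norm (1 - a * circle_pt t)) \<partial>torus 1) = max 0 (ln (norm a))"
  proof (cases "norm a \<le> 1")
    case True
    then have "max 0 (ln (norm a)) = 0" by (cases "a = 0") (auto simp: max_def)
    with True integral_ln_linear_inner[OF True, of 1] show ?thesis by simp
  next
    case False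
    then have a0: "a \<noteq> 0" and lt: "1 < norm a" by auto
    define g where "g t = 1 - 1 / a * chi 1 (\<lambda>_. -1) t" for t
    have "norm (1 / a) \<le> 1" using lt unfolding norm_divide by (simp add: divide_le_eq)
    note g = integral_ln_linear_inner[OF this, of "-1", folded g_def]
    \<comment> \<open>Pulling out \<open>- a z\<close> leaves \<open>1 - 1 / (a z)\<close>, whose
      coefficient lies inside the unit disc.\<close>
    have eq: "1 - a * circle_pt t = - a * circle_pt t * g t" for t
    proof -
      have "circle_pt t * chi 1 (\<lambda>_. -1) t = 1"
        using chi_add[of 1 "\<lambda>_. 1" "\<lambda>_. -1" t] by simp
      then show ?thesis using a0 by (simp add: g_def algebra_simps)
    qed
    have ae: "AE t in torus 1. g t \<noteq> 0" using g(2) by simp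
    then have ln: "AE t in torus 1. ln (norm (1 - a * circle_pt t)) = ln (norm a) + ln (norm (g t))"
      by eventually_elim (use a0 in \<open>simp add: eq norm_mult ln_mult del: One_nat_def\<close>)
    have [measurable]: "g \<in> borel_measurable (torus 1)" unfolding g_def[abs_def] by measurable
    have "integrable (torus 1) (\<lambda>t. ln (norm (1 - a * circle_pt t)))"
      using g(1) by (subst integrable_cong_AE[OF _ _ ln]) (auto simp del: One_nat_def)
    moreover have "AE t in torus 1. 1 - a * circle_pt t \<noteq> 0"
      using ae by eventually_elim (use a0 in \<open>simp add: eq del: One_nat_def\<close>)
    moreover have "(\<integral>t. ln (norm (1 - a * circle_pt t)) \<partial>torus 1) =
        (\<integral>t. ln (norm a) + ln (norm (g t)) \<partial>torus 1)"
      by (rule integral_cong_AE[OF _ _ ln]) measurable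
    moreover have "\<dots> = max 0 (ln (norm a))"
      using g(1,3) lt by (simp add: torus.prob_space max_def)
    ultimately show ?thesis by simp
  qed
  then show "integrable (torus 1) (\<lambda>t. ln (norm (1 - a * circle_pt t)))"
    and "AE t in torus 1. 1 - a * circle_pt t \<noteq> 0"
    and "(\<integral>t. ln (norm (1 - a * circle_pt t)) \<partial>torus 1) = max 0 (ln (norm a))" by blast+
qed

text \<open>The mean is \<open>ln |p(0)|\<close> plus the sum of the
  \<open>max 0 (ln |\<alpha> i|)\<close> over the reciprocal zeros. A zero in the open disc is the
  inverse of an \<open>\<alpha> i\<close> of modulus above 1, which makes the inequality strict;
  this strictness is the means of excluding zeros.\<close>

lemma jensen_poly:
  fixes p :: "complex poly"
  assumes p0: "coeff p 0 \<noteq> 0"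
  shows "integrable (torus 1) (\<lambda>t. ln (norm (poly p (circle_pt t))))"
    and "ln (norm (coeff p 0)) \<le> (\<integral>t. ln (norm (poly p (circle_pt t))) \<partial>torus 1)"
    and "\<And>z. norm z < 1 \<Longrightarrow> poly p z = 0 \<Longrightarrow>
           ln (norm (coeff p 0)) < (\<integral>t. ln (norm (poly p (circle_pt t))) \<partial>torus 1)"
proof -
  define a where "a = coeff p 0"
  define d where "d = degree p"
  have a0: "a \<noteq> 0" using p0 by (simp add: a_def)
  have "coeff (smult (1 / a) p) 0 = 1" "degree (smult (1 / a) p) \<le> d"
    using a0 by (auto simp: a_def d_def)
  then obtain \<alpha> where "smult (1 / a) p = (\<Prod>i<d. [:1, - \<alpha> i:])"
    using poly_eq_prod_reciprocal_roots by blast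
  then have "smult a (smult (1 / a) p) = smult a (\<Prod>i<d. [:1, - \<alpha> i:])" by simp
  then have pa: "p = smult a (\<Prod>i<d. [:1, - \<alpha> i:])" using a0 by simp
  have pp: "poly p z = a * (\<Prod>i<d. 1 - \<alpha> i * z)" for z
    by (subst pa) (simp add: poly_prod mult.commute)
  have "AE t in torus 1. \<forall>i\<in>{..<d}. 1 - \<alpha> i * circle_pt t \<noteq> 0"
    by (rule AE_finite_allI) (simp, rule integral_ln_linear(2))
  then have ae: "AE t in torus 1. ln (norm (poly p (circle_pt t))) = ln (norm a) + (\<Sum>i<d. ln (norm (1 - \<alpha> i * circle_pt t)))"
  proof eventually_elim
    case (elim t)
    then have pos: "0 < norm (1 - \<alpha> i * circle_pt t)" if "i \<in> {..<d}" for i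
      using that by simp
    have "ln (norm a * (\<Prod>i<d. norm (1 - \<alpha> i * circle_pt t))) =
        ln (norm a) + ln (\<Prod>i<d. norm (1 - \<alpha> i * circle_pt t))"
      using a0 prod_pos[of "{..<d}" "\<lambda>i. norm (1 - \<alpha> i * circle_pt t)", OF pos] by (intro ln_mult_pos) auto
    also have "ln (\<Prod>i<d. norm (1 - \<alpha> i * circle_pt t)) = (\<Sum>i<d. ln (norm (1 - \<alpha> i * circle_pt t)))"
      by (rule ln_prod) (use pos in auto)
    finally show ?case by (simp only: pp norm_mult prod_norm)
  qed
  have [measurable]: "(\<lambda>t. poly p (circle_pt t)) \<in> borel_measurable (torus 1)"
    unfolding pp by measurable
  have int_sum: "integrable (torus 1) (\<lambda>t. ln (norm a) + (\<Sum>i<d. ln (norm (1 - \<alpha> i * circle_pt t))))"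
    using integral_ln_linear(1) by auto
  have m: "(\<lambda>t. ln (norm (poly p (circle_pt t)))) \<in> borel_measurable (torus 1)" by measurable
  show "integrable (torus 1) (\<lambda>t. ln (norm (poly p (circle_pt t))))"
    using integrable_cong_AE[OF m borel_measurable_integrable[OF int_sum] ae] int_sum by blast
  have "(\<integral>t. ln (norm (poly p (circle_pt t))) \<partial>torus 1) =
      (\<integral>t. ln (norm a) + (\<Sum>i<d. ln (norm (1 - \<alpha> i * circle_pt t))) \<partial>torus 1)"
    by (rule integral_cong_AE[OF m borel_measurable_integrable[OF int_sum] ae])
  also have "\<dots> = ln (norm a) + (\<Sum>i<d. max 0 (ln (norm (\<alpha> i))))"
    using integral_ln_linear(1,3) by (simp add: torus.prob_space)
  finally have val: "(\<integral>t. ln (norm (poly p (circle_pt t))) \<partial>torus 1) = \<dots>" .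
  show "ln (norm (coeff p 0)) \<le> (\<integral>t. ln (norm (poly p (circle_pt t))) \<partial>torus 1)"
    unfolding val a_def[symmetric] by (simp add: sum_nonneg)
  fix z assume z: "norm z < 1" "poly p z = 0"
  then obtain i where i: "i < d" "1 = \<alpha> i * z" using a0 by (auto simp: pp)
  then have n1: "norm (\<alpha> i) * norm z = 1" by (metis norm_mult norm_one)
  then have "norm (\<alpha> i) > 1" using z(1)
    by (smt (verit) mult_left_le norm_ge_zero mult_cancel_right1)
  then have "0 < ln (norm (\<alpha> i))" by (rule ln_gt_zero)
  then have "0 < max 0 (ln (norm (\<alpha> i)))" by simp
  also have "\<dots> \<le> (\<Sum>i<d. max 0 (ln (norm (\<alpha> i))))"
    using i by (intro member_le_sum) auto
  finally show "ln (norm (coeff p 0)) < (\<integral>t. ln (norm (poly p (circle_pt t))) \<partial>torus 1)"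
    unfolding val a_def[symmetric] by simp
qed

text \<open>All reciprocal zeros have modulus at most 1, so each of the \<open>d\<close> factors is
  at least \<open>1 - |s|\<close>. Unlike mere nonvanishing, a bound in terms of \<open>d\<close>
  and \<open>|s|\<close> survives limits in the coefficients.\<close>

lemma norm_poly_ge_of_no_zeros:
  fixes p :: "complex poly"
  assumes p0: "norm (coeff p 0) = 1" and deg: "degree p \<le> d"
    and nz: "\<And>z. norm z < 1 \<Longrightarrow> poly p z \<noteq> 0" and s: "norm s < 1"
  shows "(1 - norm s) ^ d \<le> norm (poly p s)"
proof -
  define a where "a = coeff p 0"
  have a0: "a \<noteq> 0" using p0 by (auto simp: a_def)
  have "coeff (smult (1 / a) p) 0 = 1" "degree (smult (1 / a) p) \<le> d"
    using a0 deg by (auto simp: a_def)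
  then obtain \<alpha> where "smult (1 / a) p = (\<Prod>i<d. [:1, - \<alpha> i:])"
    using poly_eq_prod_reciprocal_roots by blast
  then have "smult a (smult (1 / a) p) = smult a (\<Prod>i<d. [:1, - \<alpha> i:])" by simp
  then have pa: "p = smult a (\<Prod>i<d. [:1, - \<alpha> i:])" using a0 by simp
  have pp: "poly p z = a * (\<Prod>i<d. 1 - \<alpha> i * z)" for z
    by (subst pa) (simp add: poly_prod mult.commute)
  have le: "norm (\<alpha> i) \<le> 1" if "i < d" for i
  proof (rule ccontr)
    assume "\<not> norm (\<alpha> i) \<le> 1"
    then have "norm (\<alpha> i) > 1" by simp
    then have "norm (1 / \<alpha> i) < 1" "\<alpha> i \<noteq> 0"
      unfolding norm_divide by (auto simp: divide_less_eq)
    moreover from this that have "(\<Prod>j<d. 1 - \<alpha> j * (1 / \<alpha> i)) = 0"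
      by (intro prod_zero) (auto intro!: bexI[of _ i])
    then have "poly p (1 / \<alpha> i) = 0" by (simp only: pp mult_zero_right)
    ultimately show False using nz by blast
  qed
  have "(1 - norm s) ^ d = (\<Prod>i<d. 1 - norm s)" by simp
  also have "\<dots> \<le> (\<Prod>i<d. norm (1 - \<alpha> i * s))"
  proof (intro prod_mono conjI)
    fix i assume "i \<in> {..<d}"
    have "norm (\<alpha> i * s) \<le> 1 * norm s" unfolding norm_mult
      using le \<open>i \<in> _\<close> by (intro mult_right_mono) auto
    then show "1 - norm s \<le> norm (1 - \<alpha> i * s)" using norm_triangle_ineq2[of 1 "\<alpha> i * s"] by simp
  qed (use s in auto)
  also have "\<dots> = norm (poly p s)" using p0 by (simp add: pp norm_mult a_def prod_norm)
  finally show ?thesis .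
qed

lemma emeasure_unif_interval: "0 \<le> x \<Longrightarrow> x \<le> 1 \<Longrightarrow> emeasure unif {0..x} = ennreal x"
proof -
  assume x: "0 \<le> x" "x \<le> 1"
  then have "{0..1} \<inter> {0..x} = {0..x}" by auto
  with x show ?thesis unfolding unif_def
    by (subst emeasure_uniform_measure) (auto simp: divide_ennreal_def)
qed

text \<open>A set of full measure is dense: a small box has positive measure, so some translate of
  \<open>z0\<close> by a point of the box satisfies \<open>P\<close>.\<close>

lemma AE_torus_approx:
  fixes n :: nat
  assumes ae: "AE z in torus r. P z" and \<epsilon>: "\<epsilon> > 0"
  shows "\<exists>z. P z \<and> (\<forall>i<n. norm (chi r (w i) z - chi r (w i) z0) < \<epsilon>)"
proof -
  define W where "W = (\<Sum>i<n. \<Sum>l<r. \<bar>real_of_int (w i l)\<bar>)"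
  have W0: "W \<ge> 0" unfolding W_def by (intro sum_nonneg) auto
  \<comment> \<open>\<open>W\<close> bounds the sum of the absolute entries of each
    \<open>w i\<close>, so moving every coordinate by at most \<open>\<eta>\<close> moves each
    character by at most \<open>2 * pi * W * \<eta> < \<epsilon>\<close>. The cap 1 keeps the box
    inside the unit cube.\<close>
  define \<eta> where "\<eta> = min 1 (\<epsilon> / (2 * pi * (W + 1)) / 2)"
  have \<eta>: "0 < \<eta>" "\<eta> \<le> 1" using \<epsilon> W0 by (auto simp: \<eta>_def)
  have \<eta>W: "2 * pi * W * \<eta> < \<epsilon>"
  proof -
    have "2 * pi * W * \<eta> \<le> 2 * pi * (W + 1) * (\<epsilon> / (2 * pi * (W + 1)) / 2)"
      using W0 \<eta> by (intro mult_mono) (auto simp: \<eta>_def)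
    also have "\<dots> = \<epsilon> / 2" using W0 pi_gt_zero by (simp only: times_divide_eq_right nonzero_mult_div_cancel_left) simp
    finally show ?thesis using \<epsilon> by linarith
  qed
  define box :: "(nat \<Rightarrow> real) set" where "box = PiE {..<r} (\<lambda>_. {0..\<eta>})"
  interpret Pr: product_prob_space "\<lambda>_::nat. unif"
    by (rule product_prob_spaceI) (rule prob_space_unif)
  have box: "box \<in> sets (torus r)" unfolding box_def torus_def by (rule sets_PiM_I_finite) auto
  have "emeasure (torus r) box = (\<Prod>l<r. emeasure unif {0..\<eta>})"
    unfolding box_def torus_def by (rule Pr.emeasure_PiM) auto
  also have "\<dots> = ennreal (\<eta> ^ r)" using \<eta> by (simp add: emeasure_unif_interval ennreal_power)
  finally have "emeasure (torus r) box \<noteq> 0" using \<eta> by simp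
  have "AE z in distr (torus r) (torus r) (shift r z0). P z" unfolding distr_torus_shift by (rule ae)
  then have ae': "AE z in torus r. P (shift r z0 z)" by (rule AE_distrD[rotated]) measurable
  have "\<exists>z\<in>box. P (shift r z0 z)"
  proof (rule ccontr)
    assume "\<not> ?thesis"
    then have "AE z in torus r. z \<notin> box" using ae' by (auto elim!: eventually_mono)
    moreover have "{z \<in> space (torus r). \<not> z \<notin> box} = box" using sets.sets_into_space[OF box] by auto
    ultimately have "emeasure (torus r) box = 0" 
      using AE_iff_measurable[OF box, where P = "\<lambda>z. z \<notin> box"] by simp
    with \<open>emeasure (torus r) box \<noteq> 0\<close> show False by simp
  qed
  then obtain z where z: "z \<in> box" "P (shift r z0 z)" by blast
  show ?thesis
  proof (intro exI[of _ "shift r z0 z"] conjI allI impI z(2))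
    fix i assume i: "i < n"
    define x where "x = 2 * pi * (\<Sum>l<r. of_int (w i l) * z l)"
    have "\<bar>\<Sum>l<r. of_int (w i l) * z l\<bar> \<le> (\<Sum>l<r. \<bar>real_of_int (w i l)\<bar> * \<eta>)"
    proof (rule order_trans[OF sum_abs sum_mono])
      fix l assume "l \<in> {..<r}"
      then have "\<bar>z l\<bar> \<le> \<eta>" using z(1) by (auto simp: box_def PiE_iff)
      then show "\<bar>of_int (w i l) * z l\<bar> \<le> \<bar>real_of_int (w i l)\<bar> * \<eta>"
        unfolding abs_mult by (rule mult_left_mono) simp
    qed
    also have "\<dots> = (\<Sum>l<r. \<bar>real_of_int (w i l)\<bar>) * \<eta>" by (rule sum_distrib_right[symmetric])
    also have "\<dots> \<le> W * \<eta>"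
      unfolding W_def using i \<eta>
      by (intro mult_right_mono member_le_sum[of i "{..<n}" "\<lambda>i. \<Sum>l<r. \<bar>real_of_int (w i l)\<bar>"]) (auto intro: sum_nonneg)
    finally have "2 * pi * \<bar>\<Sum>l<r. of_int (w i l) * z l\<bar> \<le> 2 * pi * (W * \<eta>)" by (intro mult_left_mono) auto
    moreover have "\<bar>x\<bar> = 2 * pi * \<bar>\<Sum>l<r. of_int (w i l) * z l\<bar>" by (simp add: x_def abs_mult)
    ultimately have "\<bar>x\<bar> < \<epsilon>" using \<eta>W by (simp only: mult.assoc)
    have "norm (chi r (w i) (shift r z0 z) - chi r (w i) z0) = norm (chi r (w i) z0 * (cis x - 1))"
      by (simp add: chi_shift chi_def[of _ _ z] x_def algebra_simps)
    also have "\<dots> = norm (exp (\<i> * of_real x) - 1)" by (simp add: norm_mult cis_conv_exp)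
    also have "\<dots> = 2 * \<bar>sin (x / 2)\<bar>" by (rule dist_exp_i_1)
    also have "\<dots> \<le> \<bar>x\<bar>" using abs_sin_x_le_abs_x[of "x / 2"] by simp
    also have "\<dots> < \<epsilon>" by fact
    finally show "norm (chi r (w i) (shift r z0 z) - chi r (w i) z0) < \<epsilon>" .
  qed
qed

lemma chi_direction:
  assumes "(\<Sum>l<r. b l * w l) = m"
  shows "chi r w (\<lambda>l. \<theta> 0 * of_int (b l)) = chi 1 (\<lambda>_. m) \<theta>"
proof -
  have "(\<Sum>l<r. of_int (w l) * (\<theta> 0 * of_int (b l))) = real_of_int m * \<theta> 0"
    unfolding assms[symmetric] of_int_sum sum_distrib_right
    by (intro sum.cong) auto
  then show ?thesis by (simp add: chi_def)
qed

text \<open>Translations along \<open>b\<close> preserve the torus, so \<open>logint\<close> is the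
  mean over \<open>z\<close> of the one-variable measures \<open>J z\<close> of
  \<open>F(z s^b)\<close> as a function of \<open>s\<close>. Jensen gives
  \<open>J z \<ge> ln |c \<tau>| \<ge> 0\<close>, hence \<open>J z = 0\<close> for almost every
  \<open>z\<close>. The offset \<open>B\<close> normalises the lowest exponent of \<open>s\<close>
  to 0.\<close>

lemma no_zeros_of_logint_eq_0:
  fixes c :: "nat \<Rightarrow> int" and w :: "nat \<Rightarrow> nat \<Rightarrow> int" and N :: "nat \<Rightarrow> nat" and b :: "nat \<Rightarrow> int"
  assumes \<tau>: "\<tau> < n" "N \<tau> = 0" and N: "\<And>i. i < n \<Longrightarrow> i \<noteq> \<tau> \<Longrightarrow> N i \<ge> 1"
    and c: "\<And>i. i < n \<Longrightarrow> c i \<noteq> 0" and sep: "separated r n w"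
    and b: "\<And>i. i < n \<Longrightarrow> (\<Sum>l<r. b l * w i l) = int (N i) + B"
    and L0: "logint r n (\<lambda>i. of_int (c i)) w = 0"
  shows "\<bar>c \<tau>\<bar> = 1"
    and "norm s < 1 \<Longrightarrow> (\<Sum>i<n. of_int (c i) * chi r (w i) z * s ^ N i) \<noteq> 0"
proof -
  have n1: "n \<ge> 1" using \<tau> by simp
  have c1: "1 \<le> norm (complex_of_int (c i))" if "i < n" for i
  proof -
    have "1 \<le> \<bar>c i\<bar>" using c[OF that] by simp
    then show ?thesis unfolding norm_of_int by linarith
  qed
  define f where "f z = (\<Sum>i<n. monom (of_int (c i) * chi r (w i) z) (N i))" for z
  define d where "d = (\<Sum>i<n. N i)"
  have pf: "poly (f z) s = (\<Sum>i<n. of_int (c i) * chi r (w i) z * s ^ N i)" for z s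
    by (simp add: f_def poly_sum poly_monom)
  have f0: "coeff (f z) 0 = of_int (c \<tau>) * chi r (w \<tau>) z" for z
  proof -
    have "coeff (f z) 0 = (\<Sum>i<n. if i = \<tau> then of_int (c \<tau>) * chi r (w \<tau>) z else 0)"
      unfolding f_def coeff_sum
    proof (intro sum.cong refl)
      fix i assume "i \<in> {..<n}"
      then show "coeff (monom (of_int (c i) * chi r (w i) z) (N i)) 0 = (if i = \<tau> then of_int (c \<tau>) * chi r (w \<tau>) z else 0)"
        using N[of i] \<tau> by auto
    qed
    then show ?thesis using \<tau> by simp
  qed
  have f0n: "norm (coeff (f z) 0) = \<bar>of_int (c \<tau>)\<bar>" for z by (simp add: f0 norm_mult)
  have f00: "coeff (f z) 0 \<noteq> 0" for z using c[OF \<tau>(1)] by (simp add: f0)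
  have fd: "degree (f z) \<le> d" for z
    unfolding f_def
  proof (rule degree_sum_le)
    fix i assume "i \<in> {..<n}"
    have "degree (monom (of_int (c i) * chi r (w i) z) (N i)) \<le> N i" by (rule degree_monom_le)
    also have "N i \<le> d" unfolding d_def using \<open>i \<in> _\<close> by (intro member_le_sum) auto
    finally show "degree (monom (of_int (c i) * chi r (w i) z) (N i)) \<le> d" .
  qed simp
  define tp where "tp = tpoly r n (\<lambda>i. of_int (c i)) w"
  have [measurable]: "tp \<in> borel_measurable (torus r)" by (simp add: tp_def)
  define C where "C = (\<Sum>i<n. norm (complex_of_int (c i)))"
  define L where "L = ln C"
  have "norm (complex_of_int (c \<tau>)) \<le> C"
    unfolding C_def using \<tau> by (intro member_le_sum) auto
  then have C1: "C \<ge> 1" using c1[OF \<tau>(1)] by linarith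
  have L: "ln (norm y) \<le> L" if "norm y \<le> C" for y :: complex
    unfolding L_def using that C1 by (cases "y = 0") auto
  have tpC: "norm (tp z) \<le> C" for z unfolding tp_def C_def by (rule norm_tpoly_le)
  \<comment> \<open>Subtracting the logarithm from its upper bound \<open>L\<close> makes the
    integrand nonnegative, so that Tonelli exchanges the integrals.\<close>
  define h where "h z \<theta> = ennreal (L - ln (norm (poly (f z) (circle_pt \<theta>))))" for z \<theta>
  have hm: "case_prod h \<in> borel_measurable (torus r \<Otimes>\<^sub>M torus 1)"
    unfolding h_def pf by measurable
  have pn: "norm (poly (f z) (circle_pt \<theta>)) = norm (tp (shift r (\<lambda>l. \<theta> 0 * of_int (b l)) z))" for z \<theta>
  proof -
    have "chi r (w i) (\<lambda>l. \<theta> 0 * of_int (b l)) = circle_pt \<theta> ^ N i * chi 1 (\<lambda>_. B) \<theta>" if "i < n" for i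
      by (subst chi_direction[OF b[OF that]]) (simp add: chi_power flip: chi_add)
    then have "tp (shift r (\<lambda>l. \<theta> 0 * of_int (b l)) z) = poly (f z) (circle_pt \<theta>) * chi 1 (\<lambda>_. B) \<theta>"
      unfolding tp_def tpoly_def pf chi_shift sum_distrib_right by (intro sum.cong) auto
    then show ?thesis by (simp add: norm_mult)
  qed
  have pC: "norm (poly (f z) (circle_pt \<theta>)) \<le> C" for z \<theta> unfolding pn by (rule tpC)
  interpret P: pair_sigma_finite "torus r" "torus 1" ..
  have inner\<theta>: "(\<integral>\<^sup>+z. h z \<theta> \<partial>torus r) = ennreal L" for \<theta>
  proof -
    have "(\<integral>\<^sup>+z. h z \<theta> \<partial>torus r) =
        (\<integral>\<^sup>+z. ennreal (L - ln (norm (tp (shift r (\<lambda>l. \<theta> 0 * of_int (b l)) z)))) \<partial>torus r)"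
      by (simp only: h_def pn)
    also have "\<dots> = (\<integral>\<^sup>+z. ennreal (L - ln (norm (tp z))) \<partial>torus r)"
      by (rule nn_integral_torus_shift[of "\<lambda>z. ennreal (L - ln (norm (tp z)))"]) measurable
    also have "\<dots> = ennreal (\<integral>z. L - ln (norm (tp z)) \<partial>torus r)"
      using integrable_ln_tpoly(1)[where c = "\<lambda>i. of_int (c i)", OF n1 c1 sep] L tpC
      by (intro nn_integral_eq_integral) (auto simp: tp_def[symmetric])
    also have "(\<integral>z. L - ln (norm (tp z)) \<partial>torus r) = L"
      using integrable_ln_tpoly(1)[where c = "\<lambda>i. of_int (c i)", OF n1 c1 sep] L0
      by (simp add: tp_def logint_def torus.prob_space)
    finally show ?thesis .
  qed
  define J where "J z = (\<integral>\<theta>. ln (norm (poly (f z) (circle_pt \<theta>))) \<partial>torus 1)" for z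
  have Jm [measurable]: "J \<in> borel_measurable (torus r)"
    unfolding J_def pf by (rule torus.borel_measurable_lebesgue_integral) measurable
  have J0: "ln \<bar>of_int (c \<tau>)\<bar> \<le> J z" for z
    using jensen_poly(2)[OF f00, of z] by (simp add: J_def f0n)
  have lnc: "0 \<le> ln \<bar>real_of_int (c \<tau>)\<bar>" using c1[OF \<tau>(1)] by simp
  have Jnn: "0 \<le> J z" for z using J0[of z] lnc by linarith
  have JL: "J z \<le> L" for z
  proof -
    have "J z \<le> (\<integral>\<theta>. L \<partial>torus 1)"
      unfolding J_def using jensen_poly(1)[OF f00] L[OF pC] by (intro integral_mono) auto
    then show ?thesis by (simp add: torus.prob_space)
  qed
  have innerz: "(\<integral>\<^sup>+\<theta>. h z \<theta> \<partial>torus 1) = ennreal (L - J z)" for z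
  proof -
    have "(\<integral>\<^sup>+\<theta>. h z \<theta> \<partial>torus 1) = ennreal (\<integral>\<theta>. L - ln (norm (poly (f z) (circle_pt \<theta>))) \<partial>torus 1)"
      unfolding h_def using jensen_poly(1)[OF f00] L[OF pC] by (intro nn_integral_eq_integral) auto
    then show ?thesis using jensen_poly(1)[OF f00] by (simp add: J_def torus.prob_space)
  qed
  have Ji: "integrable (torus r) J"
    by (rule integrable_torus_bounded[where B = L]) (use Jnn JL in auto)
  have "(\<integral>\<^sup>+z. (\<integral>\<^sup>+\<theta>. h z \<theta> \<partial>torus 1) \<partial>torus r) = (\<integral>\<^sup>+\<theta>. (\<integral>\<^sup>+z. h z \<theta> \<partial>torus r) \<partial>torus 1)"
    by (rule P.Fubini'[OF hm, symmetric])
  also have "\<dots> = ennreal L" by (simp add: inner\<theta> torus.emeasure_space_1)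
  also have "(\<integral>\<^sup>+z. (\<integral>\<^sup>+\<theta>. h z \<theta> \<partial>torus 1) \<partial>torus r) = ennreal (\<integral>z. L - J z \<partial>torus r)"
    unfolding innerz using Ji JL by (intro nn_integral_eq_integral) auto
  also have "(\<integral>z. L - J z \<partial>torus r) = L - (\<integral>z. J z \<partial>torus r)"
    using Ji by (simp add: torus.prob_space)
  finally have "ennreal (L - (\<integral>z. J z \<partial>torus r)) = ennreal L" .
  moreover have "(\<integral>z. J z \<partial>torus r) \<le> L"
    using integral_mono[OF Ji, of "\<lambda>_. L"] JL by (simp add: torus.prob_space)
  moreover have "L \<ge> 0" using C1 by (simp add: L_def)
  ultimately have "(\<integral>z. J z \<partial>torus r) = 0" by (subst (asm) ennreal_inj) auto
  then have aeJ: "AE z in torus r. J z = 0"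
    by (subst (asm) integral_nonneg_eq_0_iff_AE[OF Ji]) (use Jnn in auto)
  then obtain z1 where "J z1 = 0"
    using torus.AE_False[of r] by (metis (mono_tags, lifting) eventually_mono)
  then have "ln \<bar>real_of_int (c \<tau>)\<bar> = 0" using J0[of z1] lnc by linarith
  then have "\<bar>real_of_int (c \<tau>)\<bar> = 1" using c[OF \<tau>(1)] by simp
  then show ct: "\<bar>c \<tau>\<bar> = 1" by linarith
  assume s: "norm s < 1"
  \<comment> \<open>The given \<open>z\<close> may lie in the exceptional null set, so the
    conclusion is carried to it from a nearby \<open>z'\<close> by means of the quantitative
    bound.\<close>
  have "AE z in torus r. (1 - norm s) ^ d \<le> norm (poly (f z) s)"
    using aeJ
  proof eventually_elim
    case (elim z)
    show ?case
    proof (rule norm_poly_ge_of_no_zeros[OF _ fd _ s])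
      show "norm (coeff (f z) 0) = 1" using \<open>\<bar>real_of_int (c \<tau>)\<bar> = 1\<close> by (simp add: f0n)
      fix y :: complex assume "norm y < 1"
      then show "poly (f z) y \<noteq> 0"
        using jensen_poly(3)[OF f00, of y z] elim lnc by (auto simp: f0n J_def)
    qed
  qed
  \<comment> \<open>Characters closer than \<open>\<epsilon>\<close> change the value of the
    polynomial by at most \<open>C * \<epsilon>\<close>, half of the lower bound.\<close>
  moreover define \<epsilon> where "\<epsilon> = (1 - norm s) ^ d / (2 * C)"
  moreover have "\<epsilon> > 0" using s C1 by (simp add: \<epsilon>_def)
  ultimately obtain z' where z': "(1 - norm s) ^ d \<le> norm (poly (f z') s)"
    and close: "\<And>i. i < n \<Longrightarrow> norm (chi r (w i) z' - chi r (w i) z) < \<epsilon>"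
    using AE_torus_approx[of "\<lambda>z. (1 - norm s) ^ d \<le> norm (poly (f z) s)" r \<epsilon> n w z] by auto
  have "norm (poly (f z') s - poly (f z) s) =
      norm (\<Sum>i<n. of_int (c i) * (chi r (w i) z' - chi r (w i) z) * s ^ N i)"
    by (simp add: pf algebra_simps sum_subtractf)
  also have "\<dots> \<le> (\<Sum>i<n. norm (complex_of_int (c i)) * \<epsilon>)"
  proof (rule sum_norm_le)
    fix i assume "i \<in> {..<n}"
    then have "norm (chi r (w i) z' - chi r (w i) z) \<le> \<epsilon>" using close by (simp add: less_imp_le)
    moreover have "norm (s ^ N i) \<le> 1" using s by (simp add: norm_power power_le_one)
    ultimately have "norm (chi r (w i) z' - chi r (w i) z) * norm (s ^ N i) \<le> \<epsilon> * 1"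
      using \<open>\<epsilon> > 0\<close> by (intro mult_mono) auto
    then show "norm (of_int (c i) * (chi r (w i) z' - chi r (w i) z) * s ^ N i) \<le> norm (complex_of_int (c i)) * \<epsilon>"
      unfolding norm_mult mult.assoc by (intro mult_left_mono) auto
  qed
  also have "\<dots> = C * \<epsilon>" by (simp add: C_def sum_distrib_right)
  also have "\<dots> = (1 - norm s) ^ d / 2" using C1 by (simp add: \<epsilon>_def)
  also have "\<dots> < (1 - norm s) ^ d" using s by simp
  finally have "norm (poly (f z') s - poly (f z) s) < norm (poly (f z') s)" using z' by linarith
  then have "poly (f z) s \<noteq> 0" by auto
  then show "(\<Sum>i<n. of_int (c i) * chi r (w i) z * s ^ N i) \<noteq> 0" by (simp add: pf)
qed

text \<open>Take \<open>b l = y ^ l\<close>: two exponent vectors get the same value only if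
  \<open>y\<close> is a root of the nonzero polynomial whose coefficients are their differences, and
  this rules out finitely many integers \<open>y\<close>.\<close>

lemma separating_functional:
  assumes "separated r n w"
  obtains b :: "nat \<Rightarrow> int" where "\<And>i j. i < n \<Longrightarrow> j < n \<Longrightarrow> i \<noteq> j \<Longrightarrow> (\<Sum>l<r. b l * w i l) \<noteq> (\<Sum>l<r. b l * w j l)"
proof -
  define p where "p i j = (\<Sum>l<r. monom (w i l - w j l) l)" for i j
  have cp: "coeff (p i j) l = w i l - w j l" if "l < r" for i j l
    using that by (simp add: p_def coeff_sum coeff_monom)
  have p0: "p i j \<noteq> 0" if ij: "i < n" "j < n" "i \<noteq> j" for i j
  proof -
    obtain l where "l < r" "w i l \<noteq> w j l" using assms ij unfolding separated_def by blast
    then show ?thesis using cp[of l i j] by auto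
  qed
  have "finite (\<Union>(i, j)\<in>{(i, j). i < n \<and> j < n \<and> i \<noteq> j}. {y. poly (p i j) y = 0})"
  proof (rule finite_UN_I)
    show "finite {(i, j). i < n \<and> j < n \<and> i \<noteq> j}"
      by (rule finite_subset[of _ "{..<n} \<times> {..<n}"]) auto
    fix x assume "x \<in> {(i, j). i < n \<and> j < n \<and> i \<noteq> j}"
    then show "finite (case x of (i, j) \<Rightarrow> {y. poly (p i j) y = 0})"
      using p0 by (auto intro: poly_roots_finite)
  qed
  then obtain y :: int where y: "y \<notin> (\<Union>(i, j)\<in>{(i, j). i < n \<and> j < n \<and> i \<noteq> j}. {y. poly (p i j) y = 0})"
    using ex_new_if_finite[OF infinite_UNIV_int] by blast
  show ?thesis
  proof (rule that[of "\<lambda>l. y ^ l"])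
    fix i j assume ij: "i < n" "j < n" "i \<noteq> j"
    then have "poly (p i j) y \<noteq> 0" using y by blast
    then show "(\<Sum>l<r. y ^ l * w i l) \<noteq> (\<Sum>l<r. y ^ l * w j l)"
      by (simp add: p_def poly_sum poly_monom algebra_simps sum_subtractf)
  qed
qed

text \<open>The matrix \<open>A\<close> sends a point \<open>t\<close> to a point \<open>z\<close>
  where the characters of \<open>w\<close> take the values that those of \<open>M * v\<close> take
  at \<open>t\<close>. Nonvanishing at every \<open>z\<close> is thus inherited by the system
  \<open>M * v\<close>, which has the same relations as \<open>v\<close>.\<close>

lemma logint_eq_0_specialization:
  fixes c :: "nat \<Rightarrow> int" and w v A :: "nat \<Rightarrow> nat \<Rightarrow> int" and M :: int
  assumes n: "n \<ge> 1" and c: "\<And>i. i < n \<Longrightarrow> c i \<noteq> 0"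
    and w: "separated r n w" and v: "separated k n v"
    and M: "M \<noteq> 0" and A: "\<And>i l. i < n \<Longrightarrow> l < k \<Longrightarrow> M * v i l = (\<Sum>q<r. A l q * w i q)"
    and L0: "logint r n (\<lambda>i. of_int (c i)) w = 0"
  shows "logint k n (\<lambda>i. of_int (c i)) v = 0"
proof -
  obtain b :: "nat \<Rightarrow> int" where b: "\<And>i j. i < n \<Longrightarrow> j < n \<Longrightarrow> i \<noteq> j \<Longrightarrow> (\<Sum>l<r. b l * w i l) \<noteq> (\<Sum>l<r. b l * w j l)"
    using separating_functional[OF w] by blast
  define \<beta> where "\<beta> i = (\<Sum>l<r. b l * w i l)" for i
  \<comment> \<open>Since \<open>b\<close> separates the exponents, the minimum is attained at one
    index \<open>\<tau>\<close> only, and that single term becomes the constant coefficient in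
    \<open>s\<close>.\<close>
  define B where "B = Min (\<beta> ` {..<n})"
  have "B \<in> \<beta> ` {..<n}" unfolding B_def using n by (intro Min_in) (auto simp: lessThan_empty_iff)
  then obtain \<tau> where \<tau>: "\<tau> < n" "\<beta> \<tau> = B" by auto
  have Ble: "B \<le> \<beta> i" if "i < n" for i unfolding B_def using that by (intro Min_le) auto
  define N where "N i = nat (\<beta> i - B)" for i
  have N\<tau>: "N \<tau> = 0" by (simp add: N_def \<tau>)
  have Nb: "\<beta> i = int (N i) + B" if "i < n" for i using Ble[OF that] by (simp add: N_def)
  have N1: "N i \<ge> 1" if "i < n" "i \<noteq> \<tau>" for i
    using b[of i \<tau>] that \<tau> Nb[OF that(1)] by (cases "N i") (auto simp: \<beta>_def)
  note nz = no_zeros_of_logint_eq_0[OF \<tau>(1) N\<tau> N1 c w Nb[unfolded \<beta>_def] L0]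
  have K1: "\<bar>c \<tau>\<bar> = 1" by (rule nz(1))
  have K2: "(\<Sum>i<n. of_int (c i) * chi r (w i) z * s ^ N i) \<noteq> 0" if "norm s < 1" for s z
    by (rule nz(2)) (use that in auto)
  \<comment> \<open>Division by the extreme term: \<open>c \<tau>\<close> is its own inverse, and
    subtracting \<open>u \<tau>\<close> removes its character. The constant coefficient becomes 1
    and all moduli are kept.\<close>
  define c' where "c' i = c i * c \<tau>" for i
  define u where "u i l = (if l < k then M * v i l else 0)" for i l
  define v' where "v' i l = u i l - u \<tau> l" for i l
  have c\<tau>: "c \<tau> * c \<tau> = 1" using K1 by (metis abs_mult_self_eq mult_1)
  have c\<tau>n: "norm (complex_of_int (c \<tau>)) = 1" using K1 unfolding norm_of_int by linarith
  have sepu: "separated k n u"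
    unfolding separated_def
  proof (intro allI impI)
    fix i j assume "i < n" "j < n" "i \<noteq> j"
    then obtain l where "l < k" "v i l \<noteq> v j l" using v unfolding separated_def by blast
    then show "\<exists>l<k. u i l \<noteq> u j l" using M by (auto simp: u_def)
  qed
  have sep': "separated k n v'" using sepu by (simp add: separated_def v'_def)
  have chi_v': "chi k (v' i) t = chi k (u i) t * cnj (chi k (u \<tau>) t)" for i t
  proof -
    have "v' i = (\<lambda>l. u i l - u \<tau> l)" by (simp add: v'_def fun_eq_iff)
    then show ?thesis by (simp only: chi_diff)
  qed
  have "logint k n (\<lambda>i. of_int (c' i)) v' = 0"
  proof (rule logint_eq_0_of_no_zeros[where \<tau> = \<tau> and N = N])
    show "c' \<tau> = 1" using c\<tau> by (simp only: c'_def)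
    show "v' \<tau> l = 0" for l by (simp add: v'_def)
    show "c' i \<noteq> 0" if "i < n" for i using c[OF that] c[OF \<tau>(1)] by (simp add: c'_def)
    fix t :: "nat \<Rightarrow> real" and s :: complex assume s: "norm s < 1"
    define z :: "nat \<Rightarrow> real" where "z q = (\<Sum>l<k. of_int (A l q) * t l)" for q
    have zu: "chi r (w i) z = chi k (u i) t" if "i < n" for i
    proof -
      have "(\<Sum>q<r. of_int (w i q) * z q) = (\<Sum>q<r. \<Sum>l<k. of_int (A l q * w i q) * t l)"
        by (simp add: z_def sum_distrib_left mult_ac)
      also have "\<dots> = (\<Sum>l<k. \<Sum>q<r. of_int (A l q * w i q) * t l)" by (rule sum.swap)
      also have "\<dots> = (\<Sum>l<k. of_int (u i l) * t l)"
        using A[OF that] by (simp add: u_def sum_distrib_right[symmetric] of_int_sum[symmetric] del: of_int_sum of_int_mult)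
      finally show ?thesis by (simp add: chi_def)
    qed
    have "(\<Sum>i<n. of_int (c' i) * chi k (v' i) t * s ^ N i) =
        of_int (c \<tau>) * cnj (chi k (u \<tau>) t) * (\<Sum>i<n. of_int (c i) * chi r (w i) z * s ^ N i)"
      unfolding sum_distrib_left by (intro sum.cong) (auto simp: c'_def chi_v' zu)
    moreover have "(\<Sum>i<n. of_int (c i) * chi r (w i) z * s ^ N i) \<noteq> 0" by (rule K2[OF s])
    moreover have "complex_of_int (c \<tau>) \<noteq> 0" using c[OF \<tau>(1)] by simp
    ultimately show "(\<Sum>i<n. of_int (c' i) * chi k (v' i) t * s ^ N i) \<noteq> 0" by simp
  qed (use N1 \<tau> N\<tau> sep' in auto)
  moreover have "norm (tpoly k n (\<lambda>i. of_int (c' i)) v' t) = norm (tpoly k n (\<lambda>i. of_int (c i)) u t)" for t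
  proof -
    have "tpoly k n (\<lambda>i. of_int (c' i)) v' t = of_int (c \<tau>) * cnj (chi k (u \<tau>) t) * tpoly k n (\<lambda>i. of_int (c i)) u t"
      unfolding tpoly_def sum_distrib_left by (intro sum.cong) (auto simp: c'_def chi_v')
    then show ?thesis by (simp add: norm_mult c\<tau>n del: norm_of_int)
  qed
  ultimately have "logint k n (\<lambda>i. of_int (c i)) u = 0" by (simp add: logint_def)
  moreover have "logint k n (\<lambda>i. of_int (c i)) v = logint k n (\<lambda>i. of_int (c i)) u"
  proof (rule logint_cong_rel[OF n _ v sepu])
    fix i assume "i < n"
    then have "1 \<le> \<bar>c i\<bar>" using c[of i] by simp
    then show "1 \<le> norm (complex_of_int (c i))" unfolding norm_of_int by linarith
  next
    fix a
    have "(\<Sum>i<n. a i * u i l) = M * (\<Sum>i<n. a i * v i l)" if "l < k" for l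
      using that by (simp add: u_def sum_distrib_left mult_ac)
    then show "rel k n v a = rel k n u a" using M by (simp add: rel_def)
  qed
  ultimately show ?thesis by simp
qed

subsection \<open>Subsequences and the limit polynomial\<close>

text \<open>The finite set \<open>G\<close> generates \<open>\<Lambda>\<close> up to saturation: an exponent system \<open>u\<close> obeying the relations
  in \<open>G\<close> becomes, after multiplication by \<open>M\<close>, a linear image of \<open>w\<close>.\<close>

definition realizes_lattice ::
  "(nat \<Rightarrow> int) set \<Rightarrow> nat \<Rightarrow> nat \<Rightarrow> (nat \<Rightarrow> nat \<Rightarrow> int) \<Rightarrow> int \<Rightarrow> (nat \<Rightarrow> int) set \<Rightarrow> bool" where
  "realizes_lattice \<Lambda> n r w M G \<longleftrightarrow>
    M \<noteq> 0 \<and> finite G \<and> G \<subseteq> {a \<in> \<Lambda>. \<forall>i\<ge>n. a i = 0} \<and>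
    (\<forall>i l. l \<ge> r \<longrightarrow> w i l = 0) \<and>
    (\<forall>a. (\<forall>i\<ge>n. a i = 0) \<longrightarrow> (a \<in> \<Lambda> \<longleftrightarrow> (\<forall>l. (\<Sum>i<n. a i * w i l) = 0))) \<and>
    (\<forall>u. (\<forall>a\<in>G. (\<Sum>i<n. a i * u i) = 0) \<longrightarrow> (\<exists>A. \<forall>i<n. M * u i = (\<Sum>q<r. A q * w i q)))"

text \<open>The vectors are built one at a time: a new one is either independent of its predecessors
  or fixed by them through a relation with nonzero last entry.\<close>

lemma saturated_lattice_eq_relations:
  fixes \<Lambda> :: "(nat \<Rightarrow> int) set"
  assumes zero: "(\<lambda>_. 0) \<in> \<Lambda>"
    and comb: "\<And>a b p q. a \<in> \<Lambda> \<Longrightarrow> b \<in> \<Lambda> \<Longrightarrow> (\<lambda>i. p * a i + q * b i) \<in> \<Lambda>"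
    and sat: "\<And>m a. m \<noteq> 0 \<Longrightarrow> (\<lambda>i. m * a i) \<in> \<Lambda> \<Longrightarrow> a \<in> \<Lambda>"
  shows "\<exists>r w M G. realizes_lattice \<Lambda> n r w M G"
proof (induction n)
  case 0
  have "a = (\<lambda>_. 0)" if "\<forall>i\<ge>0. a i = (0::int)" for a :: "nat \<Rightarrow> int" using that by auto
  then have "realizes_lattice \<Lambda> 0 0 (\<lambda>_ _. 0) 1 {}"
    using zero unfolding realizes_lattice_def by auto
  then show ?case by blast
next
  case (Suc n)
  then obtain r w M G where RL: "realizes_lattice \<Lambda> n r w M G" by blast
  have M: "M \<noteq> 0" and G: "finite G" "G \<subseteq> {a \<in> \<Lambda>. \<forall>i\<ge>n. a i = 0}"
    and w0: "\<And>i l. l \<ge> r \<Longrightarrow> w i l = 0"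
    and \<Lambda>: "\<And>a. (\<forall>i\<ge>n. a i = 0) \<Longrightarrow> (a \<in> \<Lambda> \<longleftrightarrow> (\<forall>l. (\<Sum>i<n. a i * w i l) = 0))"
    and ex: "\<And>u. (\<forall>a\<in>G. (\<Sum>i<n. a i * u i) = 0) \<Longrightarrow> (\<exists>A. \<forall>i<n. M * u i = (\<Sum>q<r. A q * w i q))"
    using RL unfolding realizes_lattice_def by blast+
  show ?case
  proof (cases "\<exists>a\<in>\<Lambda>. (\<forall>i\<ge>Suc n. a i = 0) \<and> a n \<noteq> 0")
    case False
    \<comment> \<open>No element of \<open>\<Lambda>\<close> supported on the first
      \<open>Suc n\<close> indices involves index \<open>n\<close>, so the new vector gets a
      direction of its own.\<close>
    define w' where "w' i l = (if i = n then (if l = r then 1 else 0) else w i l)" for i l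
    have sum': "(\<Sum>i<Suc n. a i * w' i l) = (\<Sum>i<n. a i * w i l) + (if l = r then a n else 0)" for a l
      by (simp add: w'_def)
    have "realizes_lattice \<Lambda> (Suc n) (Suc r) w' M G"
      unfolding realizes_lattice_def
    proof (intro conjI allI impI)
      show "M \<noteq> 0" by fact
      show "finite G" by fact
      show "G \<subseteq> {a \<in> \<Lambda>. \<forall>i\<ge>Suc n. a i = 0}" using G(2) by auto
      show "w' i l = 0" if "l \<ge> Suc r" for i l using that w0 by (auto simp: w'_def)
      fix a :: "nat \<Rightarrow> int" assume a: "\<forall>i\<ge>Suc n. a i = 0"
      have supp: "\<forall>i\<ge>n. a i = 0" if "a n = 0" using a that by (metis Suc_leI le_neq_implies_less)
      show "a \<in> \<Lambda> \<longleftrightarrow> (\<forall>l. (\<Sum>i<Suc n. a i * w' i l) = 0)"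
      proof
        assume "a \<in> \<Lambda>"
        then have an: "a n = 0" using False a by blast
        with \<open>a \<in> \<Lambda>\<close> \<Lambda>[OF supp] show "\<forall>l. (\<Sum>i<Suc n. a i * w' i l) = 0" unfolding sum' by simp
      next
        assume s: "\<forall>l. (\<Sum>i<Suc n. a i * w' i l) = 0"
        note s = s[unfolded sum', rule_format]
        have "a n = 0" using s[of r] by (simp add: w0)
        then have "(\<Sum>i<n. a i * w i l) = 0" for l using s[of l] by (simp split: if_splits)
        then show "a \<in> \<Lambda>" using \<Lambda>[OF supp[OF \<open>a n = 0\<close>]] by simp
      qed
    next
      fix u :: "nat \<Rightarrow> int" assume u: "\<forall>a\<in>G. (\<Sum>i<Suc n. a i * u i) = 0"
      have "(\<Sum>i<n. a i * u i) = 0" if "a \<in> G" for a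
      proof -
        have "a n = 0" using G(2) that by auto
        then show ?thesis using u that by auto
      qed
      then obtain A where A: "\<forall>i<n. M * u i = (\<Sum>q<r. A q * w i q)" using ex by blast
      have "\<forall>i<Suc n. M * u i = (\<Sum>q<Suc r. (A(r := M * u n)) q * w' i q)"
        using A w0 by (auto simp: w'_def less_Suc_eq)
      then show "\<exists>A. \<forall>i<Suc n. M * u i = (\<Sum>q<Suc r. A q * w' i q)" by blast
    qed
    then show ?thesis by blast
  next
    case True
    then obtain g where g: "g \<in> \<Lambda>" "\<forall>i\<ge>Suc n. g i = 0" "g n \<noteq> 0" by blast
    \<comment> \<open>The relation \<open>g\<close> fixes the new vector up to division by
      \<open>g n\<close>. Scaling all earlier vectors by \<open>g n\<close> instead keeps the
      entries integral, and \<open>M\<close> picks up the same factor.\<close>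
    define w' where "w' i l = (if i = n then - (\<Sum>i<n. g i * w i l) else g n * w i l)" for i l
    have sum': "(\<Sum>i<Suc n. a i * w' i l) = (\<Sum>i<n. (g n * a i - a n * g i) * w i l)" for a l
    proof -
      have "(\<Sum>i<Suc n. a i * w' i l) = (\<Sum>i<n. a i * (g n * w i l)) - a n * (\<Sum>i<n. g i * w i l)"
        by (simp add: w'_def)
      then show ?thesis by (simp add: sum_distrib_left sum_subtractf algebra_simps)
    qed
    have "realizes_lattice \<Lambda> (Suc n) r w' (g n * M) (insert g G)"
      unfolding realizes_lattice_def
    proof (intro conjI allI impI)
      show "g n * M \<noteq> 0" using M g by simp
      show "finite (insert g G)" using G by simp
      show "insert g G \<subseteq> {a \<in> \<Lambda>. \<forall>i\<ge>Suc n. a i = 0}" using G(2) g by auto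
      show "w' i l = 0" if "l \<ge> r" for i l using that w0 by (auto simp: w'_def)
      fix a :: "nat \<Rightarrow> int" assume a: "\<forall>i\<ge>Suc n. a i = 0"
      \<comment> \<open>\<open>e\<close> eliminates index \<open>n\<close> from \<open>a\<close> by
        means of \<open>g\<close>. Returning from \<open>e \<in> \<Lambda>\<close> to
        \<open>a \<in> \<Lambda>\<close> is the step that uses saturation.\<close>
      define e where "e i = g n * a i - a n * g i" for i
      have "\<forall>i\<ge>n. e i = 0"
      proof (intro allI impI)
        fix i assume "i \<ge> n"
        then show "e i = 0" using a g by (cases "i = n") (auto simp: e_def)
      qed
      then have e: "e \<in> \<Lambda> \<longleftrightarrow> (\<forall>l. (\<Sum>i<n. e i * w i l) = 0)" by (rule \<Lambda>)
      have "e \<in> \<Lambda> \<longleftrightarrow> a \<in> \<Lambda>"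
      proof
        assume "a \<in> \<Lambda>"
        from comb[OF this g(1), of "g n" "- a n"] show "e \<in> \<Lambda>" by (simp add: e_def[abs_def])
      next
        assume "e \<in> \<Lambda>"
        from comb[OF this g(1), of 1 "a n"] have "(\<lambda>i. g n * a i) \<in> \<Lambda>" by (simp add: e_def)
        then show "a \<in> \<Lambda>" by (rule sat[OF g(3)])
      qed
      with e show "a \<in> \<Lambda> \<longleftrightarrow> (\<forall>l. (\<Sum>i<Suc n. a i * w' i l) = 0)" unfolding sum' e_def by blast
    next
      fix u :: "nat \<Rightarrow> int" assume u: "\<forall>a\<in>insert g G. (\<Sum>i<Suc n. a i * u i) = 0"
      have "(\<Sum>i<n. a i * u i) = 0" if "a \<in> G" for a
      proof -
        have "a n = 0" using G(2) that by auto
        then show ?thesis using u that by auto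
      qed
      then obtain A where A: "\<And>i. i < n \<Longrightarrow> M * u i = (\<Sum>q<r. A q * w i q)" using ex by blast
      have "\<forall>i<Suc n. g n * M * u i = (\<Sum>q<r. A q * w' i q)"
      proof (intro allI impI)
        fix i assume "i < Suc n"
        then consider "i < n" | "i = n" by linarith
        then show "g n * M * u i = (\<Sum>q<r. A q * w' i q)"
        proof cases
          case 1
          then have "g n * M * u i = g n * (\<Sum>q<r. A q * w i q)" using A[OF 1] by simp
          with 1 show ?thesis by (simp add: w'_def sum_distrib_left mult_ac)
        next
          case 2
          have "g n * u n = - (\<Sum>i<n. g i * u i)" using u by simp
          then have "g n * M * u n = - (\<Sum>i<n. g i * (M * u i))"
            by (simp add: sum_distrib_left mult_ac)
          also have "\<dots> = - (\<Sum>i<n. \<Sum>q<r. g i * (A q * w i q))" by (simp add: A sum_distrib_left)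
          also have "\<dots> = - (\<Sum>q<r. \<Sum>i<n. g i * (A q * w i q))" by (subst sum.swap) (rule refl)
          also have "\<dots> = (\<Sum>q<r. A q * w' n q)"
            by (simp add: w'_def sum_distrib_left sum_negf mult_ac)
          finally show ?thesis using 2 by simp
        qed
      qed
      then show "\<exists>A. \<forall>i<Suc n. g n * M * u i = (\<Sum>q<r. A q * w' i q)" by blast
    qed
    then show ?thesis by blast
  qed
qed

text \<open>Diagonal argument: for a single \<open>x\<close>, either the property holds infinitely
  often and one passes to those indices, or it eventually fails.\<close>

lemma subseq_eventually_decided:
  fixes R :: "nat \<Rightarrow> 'a::countable \<Rightarrow> bool"
  shows "\<exists>s. strict_mono (s :: nat \<Rightarrow> nat) \<and> (\<forall>x. \<exists>b. eventually (\<lambda>j. R (s j) x = b) sequentially)"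
proof -
  define P where "P m s = (\<exists>b. eventually (\<lambda>j. R (s j) (from_nat m) = b) sequentially)" for m and s :: "nat \<Rightarrow> nat"
  interpret subseqs P
  proof
    fix m and s :: "nat \<Rightarrow> nat" assume s: "strict_mono s"
    show "\<exists>r'. strict_mono r' \<and> P m (s \<circ> r')"
    proof (cases "infinite {j. R (s j) (from_nat m)}")
      case True
      then obtain r' :: "nat \<Rightarrow> nat" where "strict_mono r'" "\<forall>j. r' j \<in> {j. R (s j) (from_nat m)}"
        using infinite_enumerate by blast
      then show ?thesis unfolding P_def by (intro exI[of _ r'] conjI exI[of _ True]) auto
    next
      case False
      then have "eventually (\<lambda>j. \<not> R (s j) (from_nat m)) sequentially"
        by (simp add: eventually_cofinite flip: cofinite_eq_sequentially)
      then show ?thesis unfolding P_def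
        by (intro exI[of _ id] conjI exI[of _ False]) (auto simp: strict_mono_id)
    qed
  qed
  have "\<exists>b. eventually (\<lambda>j. R (diagseq j) x = b) sequentially" for x
  proof -
    have "P (to_nat x) (diagseq \<circ> (+) (Suc (to_nat x)))"
    proof (rule diagseq_holds)
      fix r s m assume "strict_mono (r :: nat \<Rightarrow> nat)" "P m s"
      then show "P m (s \<circ> r)" unfolding P_def
        using eventually_subseq by (auto simp: o_def)
    qed
    then obtain b where "eventually (\<lambda>j. R (diagseq (j + Suc (to_nat x))) x = b) sequentially"
      unfolding P_def by (auto simp: add.commute)
    then have "eventually (\<lambda>j. R (diagseq j) x = b) sequentially"
      by (subst (asm) eventually_sequentially_seg[of "\<lambda>j. R (diagseq j) x = b"])
    then show ?thesis by blast
  qed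
  with subseq_diagseq show ?thesis by blast
qed

lemma rel_cong:
  assumes "\<And>i. i < n \<Longrightarrow> a i = a' i"
  shows "rel k n v a = rel k n v a'"
proof -
  have "(\<Sum>i<n. a i * v i l) = (\<Sum>i<n. a' i * v i l)" for l
    by (intro sum.cong) (auto simp: assms)
  then show ?thesis by (simp only: rel_def)
qed

lemma logint_subsequence:
  fixes c :: "nat \<Rightarrow> int"
  assumes n: "n \<ge> 1" and c: "\<And>i. i < n \<Longrightarrow> c i \<noteq> 0" and V: "\<And>j. separated (K j) n (V j)"
  shows "\<exists>s r w. strict_mono (s :: nat \<Rightarrow> nat) \<and> r \<ge> 1 \<and> separated r n w \<and>
     (\<lambda>j. logint (K (s j)) n (\<lambda>i. of_int (c i)) (V (s j))) \<longlonglongrightarrow> logint r n (\<lambda>i. of_int (c i)) w \<and>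
     (logint r n (\<lambda>i. of_int (c i)) w = 0 \<longrightarrow>
        eventually (\<lambda>j. logint (K (s j)) n (\<lambda>i. of_int (c i)) (V (s j)) = 0) sequentially)"
proof -
  \<comment> \<open>Relations are coded as integer lists because these form a countable type, unlike
    functions; the first \<open>n\<close> entries determine whether a relation holds.\<close>
  obtain s where s: "strict_mono (s :: nat \<Rightarrow> nat)"
    and dec: "\<And>x :: int list. \<exists>b. eventually (\<lambda>j. rel (K (s j)) n (V (s j)) (\<lambda>i. x ! i) = b) sequentially"
    using subseq_eventually_decided[of "\<lambda>j x. rel (K j) n (V j) (\<lambda>i. x ! i)"] by blast
  define \<Lambda> where "\<Lambda> = {a. eventually (\<lambda>j. rel (K (s j)) n (V (s j)) a) sequentially}"
  have decided: "a \<in> \<Lambda> \<or> eventually (\<lambda>j. \<not> rel (K (s j)) n (V (s j)) a) sequentially" for a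
  proof -
    have "rel k n v (\<lambda>i. map a [0..<n] ! i) = rel k n v a" for k v by (rule rel_cong) simp
    then obtain b where "eventually (\<lambda>j. rel (K (s j)) n (V (s j)) a = b) sequentially"
      using dec[of "map a [0..<n]"] by auto
    then show ?thesis by (cases b) (auto simp: \<Lambda>_def)
  qed
  have "\<exists>r w M G. realizes_lattice \<Lambda> n r w M G"
  proof (rule saturated_lattice_eq_relations)
    show "(\<lambda>_. 0) \<in> \<Lambda>" by (simp add: \<Lambda>_def rel_def)
    fix a b :: "nat \<Rightarrow> int" and p q :: int
    assume "a \<in> \<Lambda>" "b \<in> \<Lambda>"
    then have "eventually (\<lambda>j. rel (K (s j)) n (V (s j)) a \<and> rel (K (s j)) n (V (s j)) b) sequentially"
      by (simp add: \<Lambda>_def eventually_conj)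
    then have "eventually (\<lambda>j. rel (K (s j)) n (V (s j)) (\<lambda>i. p * a i + q * b i)) sequentially"
    proof eventually_elim
      case (elim j)
      have "(\<Sum>i<n. (p * a i + q * b i) * V (s j) i l) =
          p * (\<Sum>i<n. a i * V (s j) i l) + q * (\<Sum>i<n. b i * V (s j) i l)" for l
        by (simp add: sum_distrib_left sum.distrib algebra_simps)
      with elim show ?case by (simp add: rel_def)
    qed
    then show "(\<lambda>i. p * a i + q * b i) \<in> \<Lambda>" by (simp add: \<Lambda>_def)
  next
    fix m :: int and a assume m: "m \<noteq> 0" and "(\<lambda>i. m * a i) \<in> \<Lambda>"
    then have "eventually (\<lambda>j. rel (K (s j)) n (V (s j)) (\<lambda>i. m * a i)) sequentially"
      by (simp add: \<Lambda>_def)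
    then have "eventually (\<lambda>j. rel (K (s j)) n (V (s j)) a) sequentially"
    proof eventually_elim
      case (elim j)
      have "(\<Sum>i<n. m * a i * V (s j) i l) = m * (\<Sum>i<n. a i * V (s j) i l)" for l
        by (simp add: sum_distrib_left mult_ac)
      with elim m show ?case by (simp add: rel_def)
    qed
    then show "a \<in> \<Lambda>" by (simp add: \<Lambda>_def)
  qed
  then obtain r w M G where RL: "realizes_lattice \<Lambda> n r w M G" by blast
  have M: "M \<noteq> 0" and G: "finite G" "G \<subseteq> {a \<in> \<Lambda>. \<forall>i\<ge>n. a i = 0}"
    and w0: "\<And>i l. l \<ge> r \<Longrightarrow> w i l = 0"
    and \<Lambda>w: "\<And>a. (\<forall>i\<ge>n. a i = 0) \<Longrightarrow> (a \<in> \<Lambda> \<longleftrightarrow> (\<forall>l. (\<Sum>i<n. a i * w i l) = 0))"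
    and ex: "\<And>u. (\<forall>a\<in>G. (\<Sum>i<n. a i * u i) = 0) \<Longrightarrow> (\<exists>A. \<forall>i<n. M * u i = (\<Sum>q<r. A q * w i q))"
    using RL unfolding realizes_lattice_def by blast+
  \<comment> \<open>\<open>Suc r\<close> variables, the last one with exponent 0 throughout:
    \<open>r\<close> may be 0, but a Mahler measure takes at least one variable.\<close>
  have relw: "rel (Suc r) n w a \<longleftrightarrow> a \<in> \<Lambda>" for a
  proof -
    define a' where "a' i = (if i < n then a i else 0)" for i
    have "a \<in> \<Lambda> \<longleftrightarrow> a' \<in> \<Lambda>"
      unfolding \<Lambda>_def using rel_cong[of n a a'] by (simp add: a'_def)
    also have "\<dots> \<longleftrightarrow> (\<forall>l. (\<Sum>i<n. a' i * w i l) = 0)" by (rule \<Lambda>w) (simp add: a'_def)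
    also have "\<dots> \<longleftrightarrow> (\<forall>l. (\<Sum>i<n. a i * w i l) = 0)" by (simp add: a'_def)
    also have "\<dots> \<longleftrightarrow> rel (Suc r) n w a"
      unfolding rel_def using w0 by (metis (no_types, lifting) less_SucI mult_zero_right not_le sum.neutral)
    finally show ?thesis ..
  qed
  have ev: "eventually (\<lambda>j. rel (K (s j)) n (V (s j)) a = rel (Suc r) n w a) sequentially" for a
  proof (cases "a \<in> \<Lambda>")
    case True
    then show ?thesis unfolding relw by (simp add: \<Lambda>_def)
  next
    case False
    then show ?thesis using decided[of a] unfolding relw by simp
  qed
  \<comment> \<open>Two equal limit exponents would amount to a relation with entries 1 and -1. It
    would then hold for late members as well, whose exponents are distinct.\<close>
  have sepw: "separated (Suc r) n w"
    unfolding separated_def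
  proof (intro allI impI, rule ccontr)
    fix i j assume ij: "i < n" "j < n" "i \<noteq> j" and eq: "\<not> (\<exists>l<Suc r. w i l \<noteq> w j l)"
    define a where "a p = (if p = i then 1 else 0) - (if p = j then 1 else (0::int))" for p
    have sa: "(\<Sum>p<n. a p * v p l) = v i l - v j l" for v l
    proof -
      have "(\<Sum>p<n. a p * v p l) = (\<Sum>p<n. (if p = i then v p l else 0) - (if p = j then v p l else 0))"
        by (intro sum.cong) (auto simp: a_def)
      then show ?thesis using ij by (simp add: sum_subtractf)
    qed
    have "rel (Suc r) n w a" using eq by (auto simp: rel_def sa)
    then have "eventually (\<lambda>t. rel (K (s t)) n (V (s t)) a) sequentially" unfolding relw \<Lambda>_def by simp
    then obtain t where "rel (K (s t)) n (V (s t)) a" using eventually_happens by fastforce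
    then have "\<forall>l<K (s t). V (s t) i l = V (s t) j l" by (simp add: rel_def sa)
    with V[of "s t"] ij show False unfolding separated_def by blast
  qed
  have c1: "1 \<le> norm (complex_of_int (c i))" if "i < n" for i
  proof -
    have "1 \<le> \<bar>c i\<bar>" using c[OF that] by simp
    then show ?thesis unfolding norm_of_int by linarith
  qed
  have lim: "(\<lambda>j. logint (K (s j)) n (\<lambda>i. of_int (c i)) (V (s j))) \<longlonglongrightarrow> logint (Suc r) n (\<lambda>i. of_int (c i)) w"
    by (rule logint_tendsto[OF n]) (use c1 V sepw ev in auto)
  have "eventually (\<lambda>j. logint (K (s j)) n (\<lambda>i. of_int (c i)) (V (s j)) = 0) sequentially"
    if L0: "logint (Suc r) n (\<lambda>i. of_int (c i)) w = 0"
  proof -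
    \<comment> \<open>Finiteness of \<open>G\<close> gives a common index from which all its
      relations hold, and these force \<open>M\<close> times the exponents to be a linear image of
      \<open>w\<close>.\<close>
    have "eventually (\<lambda>j. \<forall>a\<in>G. rel (K (s j)) n (V (s j)) a) sequentially"
      using G by (intro eventually_ball_finite) (auto simp: \<Lambda>_def)
    then show ?thesis
    proof eventually_elim
      case (elim j)
      have "\<forall>l. \<exists>A. l < K (s j) \<longrightarrow> (\<forall>i<n. M * V (s j) i l = (\<Sum>q<r. A q * w i q))"
        using elim ex[of "\<lambda>i. V (s j) i _"] unfolding rel_def by blast
      then obtain A where A: "\<And>l i. l < K (s j) \<Longrightarrow> i < n \<Longrightarrow> M * V (s j) i l = (\<Sum>q<r. A l q * w i q)"
        by metis
      show ?case
        by (rule logint_eq_0_specialization[OF n c sepw V M _ L0, where A = A]) (auto simp: A w0)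
    qed
  qed
  with s sepw lim show ?thesis by (intro exI[of _ s] exI[of _ "Suc r"] exI[of _ w]) auto
qed

subsection \<open>Mahler measures as torus integrals\<close>

lemma density_box_eq_torus:
  "density (PiM {..<k} (\<lambda>_. lborel)) (indicator (PiE {..<k} (\<lambda>_. {0..1}))) = torus k"
proof -
  interpret P: product_prob_space "\<lambda>_::nat. unif"
    by (rule product_prob_spaceI) (rule prob_space_unif)
  interpret L: product_sigma_finite "\<lambda>_::nat. lborel :: real measure" ..
  let ?box = "PiE {..<k} (\<lambda>_. {0..1::real})"
  have box: "?box \<in> sets (PiM {..<k} (\<lambda>_. lborel))" by (rule sets_PiM_I_finite) auto
  show ?thesis
    unfolding torus_def
  proof (rule P.PiM_eqI)
    show "sets (density (PiM {..<k} (\<lambda>_. lborel)) (indicator ?box)) = sets (PiM {..<k} (\<lambda>_. unif))"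
      unfolding sets_density by (rule sets_PiM_cong) auto
    fix A :: "nat \<Rightarrow> real set" assume A: "\<And>i. i \<in> {..<k} \<Longrightarrow> A i \<in> sets unif"
    have PA: "PiE {..<k} A \<in> sets (PiM {..<k} (\<lambda>_. lborel))"
      using A by (intro sets_PiM_I_finite) auto
    have "emeasure (density (PiM {..<k} (\<lambda>_. lborel)) (indicator ?box)) (PiE {..<k} A) =
        (\<integral>\<^sup>+t. indicator ?box t * indicator (PiE {..<k} A) t \<partial>PiM {..<k} (\<lambda>_. lborel))"
      using PA box by (intro emeasure_density) auto
    also have "\<dots> = (\<integral>\<^sup>+t. indicator (PiE {..<k} (\<lambda>i. {0..1} \<inter> A i)) t \<partial>PiM {..<k} (\<lambda>_. lborel))"
      by (intro nn_integral_cong) (auto simp: indicator_def PiE_iff)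
    also have "\<dots> = emeasure (PiM {..<k} (\<lambda>_. lborel)) (PiE {..<k} (\<lambda>i. {0..1} \<inter> A i))"
      using A by (intro nn_integral_indicator sets_PiM_I_finite) auto
    also have "\<dots> = (\<Prod>i<k. emeasure lborel ({0..1} \<inter> A i))"
      using A by (intro L.emeasure_PiM) auto
    also have "\<dots> = (\<Prod>i<k. emeasure unif (A i))"
      unfolding unif_def using A
      by (intro prod.cong refl, subst emeasure_uniform_measure) (auto simp: divide_ennreal_def)
    finally show "emeasure (density (PiM {..<k} (\<lambda>_. lborel)) (indicator ?box)) (PiE {..<k} A) =
        (\<Prod>i<k. emeasure unif (A i))" .
  qed simp
qed

lemma set_integral_box_eq_torus:
  fixes f :: "(nat \<Rightarrow> real) \<Rightarrow> real"
  assumes "f \<in> borel_measurable (torus k)"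
  shows "(LINT t:PiE {..<k} (\<lambda>_. {0..1})|PiM {..<k} (\<lambda>_. lborel). f t) = (\<integral>t. f t \<partial>torus k)"
proof -
  let ?box = "PiE {..<k} (\<lambda>_. {0..1::real})"
  have box: "?box \<in> sets (PiM {..<k} (\<lambda>_. lborel))" by (rule sets_PiM_I_finite) auto
  have "sets (torus k) = sets (PiM {..<k} (\<lambda>_. lborel))"
    unfolding sets_torus by (rule sets_PiM_cong) auto
  then have f: "f \<in> borel_measurable (PiM {..<k} (\<lambda>_. lborel))"
    using assms measurable_cong_sets[of "torus k" "PiM {..<k} (\<lambda>_. lborel)" borel borel] by blast
  have "(\<integral>t. f t \<partial>torus k) =
      (\<integral>t. f t \<partial>density (PiM {..<k} (\<lambda>_. lborel)) (\<lambda>t. ennreal (indicator ?box t)))"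
    by (simp add: density_box_eq_torus[symmetric] ennreal_indicator)
  also have "\<dots> = (\<integral>t. indicator ?box t *\<^sub>R f t \<partial>PiM {..<k} (\<lambda>_. lborel))"
    using f box by (intro integral_density) auto
  finally show ?thesis by (simp add: set_lebesgue_integral_def)
qed

lemma laurent_eval_eq_tpoly:
  assumes u: "inj_on u {..<n}" "Poly_Mapping.keys F = u ` {..<n}" and F: "in_variables k F"
  shows "laurent_eval F (\<lambda>j. exp (2 * complex_of_real pi * \<i> * complex_of_real (t j))) =
    tpoly k n (\<lambda>i. Poly_Mapping.lookup F (u i)) (\<lambda>i. Poly_Mapping.lookup (u i)) t"
proof -
  have "(\<Prod>i\<in>Poly_Mapping.keys v. exp (2 * complex_of_real pi * \<i> * complex_of_real (t i)) powi Poly_Mapping.lookup v i)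
      = chi k (Poly_Mapping.lookup v) t" if "v \<in> Poly_Mapping.keys F" for v
  proof -
    have "Poly_Mapping.keys v \<subseteq> {..<k}" using F that by (auto simp: in_variables_def)
    then have "(\<Prod>i\<in>Poly_Mapping.keys v. exp (2 * complex_of_real pi * \<i> * complex_of_real (t i)) powi Poly_Mapping.lookup v i)
        = (\<Prod>i<k. exp (2 * complex_of_real pi * \<i> * complex_of_real (t i)) powi Poly_Mapping.lookup v i)"
      by (intro prod.mono_neutral_left) (auto simp: in_keys_iff)
    also have "\<dots> = (\<Prod>i<k. exp (of_int (Poly_Mapping.lookup v i) * (2 * complex_of_real pi * \<i> * complex_of_real (t i))))"
      by (simp only: exp_power_int)
    also have "\<dots> = exp (\<Sum>i<k. of_int (Poly_Mapping.lookup v i) * (2 * complex_of_real pi * \<i> * complex_of_real (t i)))"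
      by (rule exp_sum[symmetric]) simp
    also have "\<dots> = chi k (Poly_Mapping.lookup v) t"
      unfolding chi_def cis_conv_exp by (rule arg_cong[where f = exp]) (simp add: sum_distrib_left mult_ac)
    finally show ?thesis .
  qed
  then have "laurent_eval F (\<lambda>j. exp (2 * complex_of_real pi * \<i> * complex_of_real (t j))) =
      (\<Sum>v\<in>Poly_Mapping.keys F. Poly_Mapping.lookup F v * chi k (Poly_Mapping.lookup v) t)"
    unfolding laurent_eval_def by (intro sum.cong) auto
  also have "\<dots> = (\<Sum>i<n. Poly_Mapping.lookup F (u i) * chi k (Poly_Mapping.lookup (u i)) t)"
    unfolding u(2) by (subst sum.reindex[OF u(1)]) simp
  finally show ?thesis by (simp add: tpoly_def)
qed

lemma mahler_measure_eq_logint: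
  assumes u: "inj_on u {..<n}" "Poly_Mapping.keys F = u ` {..<n}" and F: "in_variables k F"
  shows "mahler_measure k F =
    logint k n (\<lambda>i. Poly_Mapping.lookup F (u i)) (\<lambda>i. Poly_Mapping.lookup (u i))"
  unfolding mahler_measure_def logint_def laurent_eval_eq_tpoly[OF assms]
  by (rule set_integral_box_eq_torus) measurable

definition logint_set :: "int list \<Rightarrow> real set" where
  "logint_set c = {logint k (length c) (\<lambda>i. of_int (c ! i)) v | k v. k \<ge> 1 \<and> separated k (length c) v}"

definition coeff_lists :: "real \<Rightarrow> int list set" where
  "coeff_lists B = {c. c \<noteq> [] \<and> 0 \<notin> set c \<and> (\<Sum>i<length c. \<bar>real_of_int (c ! i)\<bar>) \<le> B}"

text \<open>A nonzero integer has modulus at least 1, so \<open>B\<close> bounds the number of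
  entries as well as each entry.\<close>

lemma finite_coeff_lists: "finite (coeff_lists B)"
proof (rule finite_subset)
  show "coeff_lists B \<subseteq> {c. set c \<subseteq> {-\<lceil>B\<rceil>..\<lceil>B\<rceil>} \<and> length c \<le> nat \<lceil>B\<rceil>}"
  proof
    fix c assume c: "c \<in> coeff_lists B"
    then have B: "(\<Sum>i<length c. \<bar>real_of_int (c ! i)\<bar>) \<le> B" and nz: "0 \<notin> set c"
      by (auto simp: coeff_lists_def)
    have "x \<in> {-\<lceil>B\<rceil>..\<lceil>B\<rceil>}" if x: "x \<in> set c" for x
    proof -
      obtain i where i: "i < length c" "x = c ! i" using x unfolding in_set_conv_nth by blast
      have "\<bar>real_of_int (c ! i)\<bar> \<le> (\<Sum>i<length c. \<bar>real_of_int (c ! i)\<bar>)"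
        using i by (intro member_le_sum) auto
      then have "\<bar>real_of_int x\<bar> \<le> B" using B i by simp
      then show ?thesis by simp linarith
    qed
    moreover have "real (length c) \<le> B"
    proof -
      have "(\<Sum>i<length c. 1) \<le> (\<Sum>i<length c. \<bar>real_of_int (c ! i)\<bar>)"
      proof (rule sum_mono)
        fix i assume "i \<in> {..<length c}"
        then have "c ! i \<noteq> 0" using nz by (metis lessThan_iff nth_mem)
        then show "1 \<le> \<bar>real_of_int (c ! i)\<bar>" by linarith
      qed
      with B show ?thesis by simp
    qed
    moreover from this have "length c \<le> nat \<lceil>B\<rceil>" by linarith
    ultimately show "c \<in> {c. set c \<subseteq> {-\<lceil>B\<rceil>..\<lceil>B\<rceil>} \<and> length c \<le> nat \<lceil>B\<rceil>}" by auto
  qed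
  show "finite {c. set c \<subseteq> {-\<lceil>B\<rceil>..\<lceil>B\<rceil>} \<and> length c \<le> nat \<lceil>B\<rceil>}"
    by (rule finite_lists_length_le) simp
qed

lemma mahler_set_subset: "mahler_set B \<subseteq> (\<Union>c\<in>coeff_lists B. logint_set c)"
proof
  fix x assume "x \<in> mahler_set B"
  then obtain k F where x: "x = mahler_measure k F" and k: "k \<ge> 1" and F0: "F \<noteq> 0"
    and F: "in_variables k F" and int: "integer_coeffs F" and len: "poly_length F \<le> B"
    unfolding mahler_set_def by blast
  define n where "n = card (Poly_Mapping.keys F)"
  obtain u where "bij_betw u {0..<n} (Poly_Mapping.keys F)"
    using ex_bij_betw_nat_finite[of "Poly_Mapping.keys F"] by (auto simp: n_def)
  then have u: "inj_on u {..<n}" "Poly_Mapping.keys F = u ` {..<n}"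
    by (auto simp: bij_betw_def atLeast0LessThan)
  define c where "c = map (\<lambda>i. \<lfloor>Re (Poly_Mapping.lookup F (u i))\<rfloor>) [0..<n]"
  have lc: "length c = n" by (simp add: c_def)
  have ci: "of_int (c ! i) = Poly_Mapping.lookup F (u i)" if "i < n" for i
  proof -
    obtain m where "Poly_Mapping.lookup F (u i) = of_int m"
      using int unfolding integer_coeffs_def by (metis Ints_cases)
    then show ?thesis using that by (simp add: c_def)
  qed
  have "Poly_Mapping.keys F \<noteq> {}" using F0 by simp
  then have "n > 0" by (simp add: n_def card_gt_0_iff)
  have "c ! i \<noteq> 0" if "i < n" for i
  proof -
    have "u i \<in> Poly_Mapping.keys F" using that u by auto
    then show ?thesis using ci[OF that] by (auto simp: in_keys_iff)
  qed
  then have "0 \<notin> set c" using lc by (metis in_set_conv_nth)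
  have "poly_length F = (\<Sum>i<n. norm (Poly_Mapping.lookup F (u i)))"
    unfolding poly_length_def u(2) by (subst sum.reindex[OF u(1)]) simp
  also have "\<dots> = (\<Sum>i<n. \<bar>real_of_int (c ! i)\<bar>)"
    by (intro sum.cong refl) (simp flip: ci)
  finally have "c \<in> coeff_lists B"
    using \<open>n > 0\<close> \<open>0 \<notin> set c\<close> len lc by (auto simp: coeff_lists_def)
  moreover have "x \<in> logint_set c"
  proof -
    have "x = logint k n (\<lambda>i. of_int (c ! i)) (\<lambda>i. Poly_Mapping.lookup (u i))"
      unfolding x mahler_measure_eq_logint[OF u F] logint_def tpoly_def
      by (simp add: ci)
    moreover have "separated k n (\<lambda>i. Poly_Mapping.lookup (u i))"
      unfolding separated_def
    proof (intro allI impI)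
      fix i j assume ij: "i < n" "j < n" "i \<noteq> j"
      then have "u i \<noteq> u j" using u(1) by (auto simp: inj_on_def)
      then obtain l where l: "Poly_Mapping.lookup (u i) l \<noteq> Poly_Mapping.lookup (u j) l"
        by (metis poly_mapping_eqI)
      then have "l \<in> Poly_Mapping.keys (u i) \<union> Poly_Mapping.keys (u j)" by (auto simp: in_keys_iff)
      moreover have "u i \<in> Poly_Mapping.keys F" "u j \<in> Poly_Mapping.keys F" using ij u(2) by auto
      ultimately have "l < k" using F unfolding in_variables_def by blast
      with l show "\<exists>l<k. Poly_Mapping.lookup (u i) l \<noteq> Poly_Mapping.lookup (u j) l" by blast
    qed
    ultimately show ?thesis using k lc unfolding logint_set_def by blast
  qed
  ultimately show "x \<in> (\<Union>c\<in>coeff_lists B. logint_set c)" by blast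
qed

lemma logint_set_subset:
  assumes c: "c \<in> coeff_lists B"
  shows "logint_set c \<subseteq> mahler_set B"
proof
  fix x assume "x \<in> logint_set c"
  then obtain k v where x: "x = logint k (length c) (\<lambda>i. of_int (c ! i)) v"
    and k: "k \<ge> 1" and v: "separated k (length c) v" unfolding logint_set_def by blast
  define n where "n = length c"
  have n0: "n > 0" using c by (simp add: n_def coeff_lists_def)
  have cn: "c ! i \<noteq> 0" if "i < n" for i
    using c that by (metis (mono_tags, lifting) coeff_lists_def mem_Collect_eq n_def nth_mem)
  \<comment> \<open>Added to every exponent, \<open>S\<close> makes all of them nonnegative. This
    multiplies the polynomial by one monomial and keeps its modulus on the torus.\<close>
  define S where "S = (\<Sum>i<n. \<Sum>l<k. \<bar>v i l\<bar>)"
  have S: "0 \<le> v i l + S" if "i < n" "l < k" for i l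
  proof -
    have "\<bar>v i l\<bar> \<le> (\<Sum>l<k. \<bar>v i l\<bar>)" using that by (intro member_le_sum) auto
    also have "\<dots> \<le> S" unfolding S_def using that
      by (intro member_le_sum[of i "{..<n}" "\<lambda>i. \<Sum>l<k. \<bar>v i l\<bar>"]) (auto intro: sum_nonneg)
    finally show ?thesis by linarith
  qed
  define u :: "nat \<Rightarrow> (nat \<Rightarrow>\<^sub>0 int)" where "u i = (\<Sum>l<k. Poly_Mapping.single l (v i l + S))" for i
  have lu: "Poly_Mapping.lookup (u i) l = (if l < k then v i l + S else 0)" for i l
  proof -
    have "Poly_Mapping.lookup (u i) l = (\<Sum>q<k. if q = l then v i q + S else 0)"
      unfolding u_def lookup_sum lookup_single when_def by (intro sum.cong) auto
    then show ?thesis by simp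
  qed
  have u_inj: "inj_on u {..<n}"
  proof (rule inj_onI)
    fix i j assume ij: "i \<in> {..<n}" "j \<in> {..<n}" "u i = u j"
    show "i = j"
    proof (rule ccontr)
      assume "i \<noteq> j"
      then obtain l where l: "l < k" "v i l \<noteq> v j l" using v ij unfolding separated_def n_def by auto
      with arg_cong[OF ij(3), of "\<lambda>p. Poly_Mapping.lookup p l"] show False by (simp add: lu)
    qed
  qed
  define F :: laurent_poly where "F = (\<Sum>i<n. Poly_Mapping.single (u i) (of_int (c ! i)))"
  have lF: "Poly_Mapping.lookup F (u i) = of_int (c ! i)" if "i < n" for i
  proof -
    have "Poly_Mapping.lookup F (u i) = (\<Sum>j<n. if j = i then of_int (c ! j) else 0)"
      unfolding F_def lookup_sum lookup_single when_def
      using u_inj that by (intro sum.cong) (auto simp: inj_on_def)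
    then show ?thesis using that by simp
  qed
  have lF0: "Poly_Mapping.lookup F p = 0" if "p \<notin> u ` {..<n}" for p
    unfolding F_def lookup_sum lookup_single when_def using that by (intro sum.neutral) auto
  have keysF: "Poly_Mapping.keys F = u ` {..<n}"
    using lF lF0 cn by (auto simp: in_keys_iff)
  have inv: "in_variables k F"
    unfolding in_variables_def keysF by (auto simp: in_keys_iff lu split: if_splits)
  have pol: "is_polynomial F"
    unfolding is_polynomial_def keysF using S by (auto simp: lu)
  have int: "integer_coeffs F"
    unfolding integer_coeffs_def
  proof
    fix p
    show "Poly_Mapping.lookup F p \<in> \<int>" by (cases "p \<in> u ` {..<n}") (auto simp: lF lF0)
  qed
  have "poly_length F = (\<Sum>i<n. \<bar>real_of_int (c ! i)\<bar>)"
    unfolding poly_length_def keysF by (subst sum.reindex[OF u_inj]) (simp add: lF)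
  then have len: "poly_length F \<le> B" using c by (simp add: coeff_lists_def n_def)
  have "F \<noteq> 0" using keysF n0 by (metis image_is_empty keys_zero lessThan_empty_iff neq0_conv)
  moreover have "mahler_measure k F = x"
  proof -
    have chi: "chi k (Poly_Mapping.lookup (u i)) t = chi k (v i) t * chi k (\<lambda>_. S) t" for i t
      using chi_cong[of k "Poly_Mapping.lookup (u i)" "\<lambda>l. v i l + S" t] by (simp add: lu chi_add)
    have "tpoly k n (\<lambda>i. Poly_Mapping.lookup F (u i)) (\<lambda>i. Poly_Mapping.lookup (u i)) t =
        tpoly k n (\<lambda>i. of_int (c ! i)) v t * chi k (\<lambda>_. S) t" for t
      unfolding tpoly_def sum_distrib_right by (intro sum.cong) (auto simp: lF chi)
    then show ?thesis
      unfolding mahler_measure_eq_logint[OF u_inj keysF inv] x n_def[symmetric]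
      by (simp add: logint_def norm_mult)
  qed
  ultimately show "x \<in> mahler_set B"
    unfolding mahler_set_def using k inv pol int len by blast
qed

lemma mahler_set_eq: "mahler_set B = (\<Union>c\<in>coeff_lists B. logint_set c)"
  using mahler_set_subset logint_set_subset by blast

text \<open>If nonzero values tended to 0, the limit polynomial would have measure 0, and then late
  terms of a subsequence would vanish as well.\<close>

lemma closed_logint_set_minus_0:
  assumes "c \<noteq> []" "0 \<notin> set c"
  shows "closed (logint_set c - {0})"
  unfolding closed_sequential_limits
proof (intro allI impI, elim conjE)
  fix x l assume x: "\<forall>j. x j \<in> logint_set c - {0}" and lim: "x \<longlonglongrightarrow> l"
  have "\<forall>j. \<exists>k v. separated k (length c) v \<and> x j = logint k (length c) (\<lambda>i. of_int (c ! i)) v"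
    using x unfolding logint_set_def by blast
  then obtain K V where V: "\<And>j. separated (K j) (length c) (V j)"
    and xj: "\<And>j. x j = logint (K j) (length c) (\<lambda>i. of_int (c ! i)) (V j)" by metis
  have "length c \<ge> 1" using assms by (cases c) auto
  moreover have "c ! i \<noteq> 0" if "i < length c" for i using assms that by (metis nth_mem)
  ultimately obtain s r w where s: "strict_mono (s :: nat \<Rightarrow> nat)" and r: "r \<ge> 1" and w: "separated r (length c) w"
    and lim': "(\<lambda>j. x (s j)) \<longlonglongrightarrow> logint r (length c) (\<lambda>i. of_int (c ! i)) w"
    and ev: "logint r (length c) (\<lambda>i. of_int (c ! i)) w = 0 \<longrightarrow> eventually (\<lambda>j. x (s j) = 0) sequentially"
    unfolding xj using logint_subsequence[of "length c" "\<lambda>i. c ! i" K V] V by blast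
  have l: "l = logint r (length c) (\<lambda>i. of_int (c ! i)) w"
    using LIMSEQ_unique[OF LIMSEQ_subseq_LIMSEQ[OF lim s, unfolded o_def] lim'] .
  then have "l \<in> logint_set c" unfolding logint_set_def using r w by blast
  moreover have "l \<noteq> 0"
  proof
    assume "l = 0"
    then have "eventually (\<lambda>j. x (s j) = 0) sequentially" using ev l by simp
    then obtain j where "x (s j) = 0" using eventually_happens by fastforce
    with x show False by blast
  qed
  ultimately show "l \<in> logint_set c - {0}" by blast
qed

lemma zero_in_logint_set: "0 \<in> logint_set [1]"
proof -
  have "logint 1 1 (\<lambda>i. of_int ([1] ! i)) (\<lambda>_ _. 0) = 0"
    by (simp add: logint_def tpoly_def)
  moreover have "separated 1 1 (\<lambda>_ _. 0)" by (simp add: separated_def)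
  ultimately show ?thesis unfolding logint_set_def by force
qed

theorem theorem3:
  fixes B :: real
  assumes "B > 0"
  shows "closed (mahler_set B) \<and> (1 \<le> B \<longrightarrow> 0 isolated_in mahler_set B)"
proof (intro conjI impI)
  \<comment> \<open>A finite union of closed sets. Adding the point 0 keeps it closed, and its
    complement is the neighbourhood that isolates 0.\<close>
  define N where "N = (\<Union>c\<in>coeff_lists B. logint_set c - {0})"
  have N: "closed N"
    unfolding N_def
    by (intro closed_UN finite_coeff_lists closed_logint_set_minus_0 ballI) (auto simp: coeff_lists_def)
  have eq: "mahler_set B - {0} = N" unfolding mahler_set_eq N_def by blast
  show "closed (mahler_set B)"
  proof (cases "0 \<in> mahler_set B")
    case True
    then have "mahler_set B = insert 0 N" using eq by blast
    then show ?thesis using N by simp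
  next
    case False
    then have "mahler_set B = N" using eq by blast
    then show ?thesis using N by simp
  qed
  \<comment> \<open>\<open>isolated_in\<close> includes membership of 0, which the constant
    polynomial 1, of length 1, provides.\<close>
  assume "1 \<le> B"
  then have "[1] \<in> coeff_lists B" by (simp add: coeff_lists_def)
  then have 0: "0 \<in> mahler_set B" unfolding mahler_set_eq using zero_in_logint_set by blast
  moreover have "open (- N)" using N by (simp add: open_Compl)
  moreover have "- N \<inter> mahler_set B = {0}" using 0 eq by blast
  ultimately show "0 isolated_in mahler_set B" unfolding isolated_in_def by blast
qed

end
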